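(* Let $(G,H,P_G,B_H)$ be as in Case (A) or Case (B) (context). Then there are bijections $$\Gamma(n)\simeq \mathbb Z_2^n\backslash\Omega^\circ_n/(\mathbb Z_2^n\rtimes\mathfrak S_n)\simeq B_H\backslash G/P_G\simeq H\backslash\mathfrak X.$$
   Context: Case (A): $G=\mathrm U(n,n)$ (preserving $u^*J_nv$, $J_n=\sqrt{-1}\begin{pmatrix}0&\mathbf 1_n\\-\mathbf 1_n&0\end{pmatrix}$), $P_G$ the stabilizer of $\mathbb C^n\oplus0$, $H=\{\mathrm{diag}(a,(a^* )^{-1}):a\in\mathrm{GL}_n(\mathbb C)\}$, $B_H$ the subgroup with $a$ upper triangular. Case (B): $G=\mathrm{Sp}_{2n}(\mathbb R)$ (preserving $\Sigma_n=\begin{pmatrix}0&\mathbf 1_n\\-\mathbf 1_n&0\end{pmatrix}$), $P_G$ the stabilizer of $\mathbb R^n\oplus0$, $H=\{\mathrm{diag}(a,(a^t)^{-1}):a\in\mathrm{GL}_n(\mathbb R)\}$, $B_H$ the subgroup with $a$ upper triangular. $\mathfrak X=H/B_H\times G/P_G$ with diagonal $H$-action. $\Omega^\circ_n$ is the set of $\begin{pmatrix}\tau_1\\\tau_2\end{pmatrix}\in\mathrm M_{2n,n}(\mathbb Z)$ where $\tau_1,\tau_2$ have entries in $\{-1,0,1\}$ with at most one nonzero entry per row and column, $\tau_1^t\tau_2$ is symmetric, and the rank is $n$; $\mathbb Z_2^n$ acts on the left by $\mathrm{diag}(\varepsilon,\varepsilon)$ ($\varepsilon=\mathrm{diag}(\varepsilon_1,\dots,\varepsilon_n)$,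 $\varepsilon_i=\pm1$), and $\mathbb Z_2^n\rtimes\mathfrak S_n$ (signed permutation matrices) acts by right multiplication; the map to $B_H\backslash G/P_G$ sends $\omega$ to the $B_H$-orbit of its column space. $\Gamma(n)$ (decorated $n$-clans) is the set of maps $\gamma:[n]\to[n]\cup\{+,-,c,d\}$ (with $[n]=\{1,\dots,n\}$) such that whenever $\gamma(i)=j\in[n]$ we have $i\ne j$ and $\gamma(j)=i$ (graphically: $n$ vertices each decorated by $+,-,c,d$ or an endpoint of an arc joining two distinct vertices). *)

theory Defs
  imports "Jordan_Normal_Form.Schur_Decomposition" "Jordan_Normal_Form.DL_Rank"
    "HOL-Library.FuncSet"
begin

section \<open>Matrix groups (generic over a conjugatable field; conjugate = id on the reals)\<close>

definition Sigma_mat :: "nat \<Rightarrow> 'a::ring_1 mat" where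
  "Sigma_mat n = four_block_mat (0\<^sub>m n n) (1\<^sub>m n) (- 1\<^sub>m n) (0\<^sub>m n n)"

definition J_mat :: "nat \<Rightarrow> complex mat" where
  "J_mat n = \<i> \<cdot>\<^sub>m Sigma_mat n"

text \<open>The isometry group of the form (u,v) |-> u^* F v on 'a^(2n).
  For 'a = complex, F = J_n this is U(n,n); for 'a = real, F = Sigma_n it is Sp_2n(R)
  (on the reals mat_adjoint is the transpose).\<close>
definition isom_grp :: "'a::conjugatable_field mat \<Rightarrow> nat \<Rightarrow> 'a mat set" where
  "isom_grp F n = {g \<in> carrier_mat (2*n) (2*n). mat_adjoint g * F * g = F}"

definition L0 :: "nat \<Rightarrow> 'a::zero vec set" where
  "L0 n = {v \<in> carrier_vec (2*n). \<forall>i. n \<le> i \<and> i < 2*n \<longrightarrow> v $ i = 0}"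

definition img_subspace :: "'a::semiring_0 mat \<Rightarrow> 'a vec set \<Rightarrow> 'a vec set" where
  "img_subspace g V = (\<lambda>v. g *\<^sub>v v) ` V"

definition P_grp :: "'a::conjugatable_field mat \<Rightarrow> nat \<Rightarrow> 'a mat set" where
  "P_grp F n = {g \<in> isom_grp F n. img_subspace g (L0 n) = L0 n}"

text \<open>H = { diag(a, (a^*)^(-1)) : a in GL_n }; the condition a^* d = 1 for square a, d
  says exactly that a is invertible and d = (a^*)^(-1).\<close>
definition H_grp :: "nat \<Rightarrow> 'a::conjugatable_field mat set" where
  "H_grp n = {four_block_mat a (0\<^sub>m n n) (0\<^sub>m n n) d | a d.
      a \<in> carrier_mat n n \<and> d \<in> carrier_mat n n \<and> mat_adjoint a * d = 1\<^sub>m n}"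

definition B_grp :: "nat \<Rightarrow> 'a::conjugatable_field mat set" where
  "B_grp n = {four_block_mat a (0\<^sub>m n n) (0\<^sub>m n n) d | a d.
      a \<in> carrier_mat n n \<and> d \<in> carrier_mat n n \<and> mat_adjoint a * d = 1\<^sub>m n
      \<and> upper_triangular a}"

definition lcoset :: "'a::semiring_0 mat \<Rightarrow> 'a mat set \<Rightarrow> 'a mat set" where
  "lcoset g S = (\<lambda>s. g * s) ` S"

definition dcoset :: "'a::semiring_0 mat set \<Rightarrow> 'a mat \<Rightarrow> 'a mat set \<Rightarrow> 'a mat set" where
  "dcoset B g P = {b * g * p | b p. b \<in> B \<and> p \<in> P}"

definition BGP :: "'a::conjugatable_field mat \<Rightarrow> nat \<Rightarrow> 'a mat set set" where
  "BGP F n = {dcoset (B_grp n) g (P_grp F n) | g. g \<in> isom_grp F n}"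

definition Xspace :: "'a::conjugatable_field mat \<Rightarrow> nat \<Rightarrow> ('a mat set \<times> 'a mat set) set" where
  "Xspace F n = {(lcoset h (B_grp n), lcoset g (P_grp F n)) | h g.
      h \<in> H_grp n \<and> g \<in> isom_grp F n}"

definition H_orbit :: "nat \<Rightarrow> 'a::conjugatable_field mat set \<times> 'a mat set
    \<Rightarrow> ('a mat set \<times> 'a mat set) set" where
  "H_orbit n x = {((\<lambda>y. k * y) ` fst x, (\<lambda>y. k * y) ` snd x) | k. k \<in> H_grp n}"

definition HX :: "'a::conjugatable_field mat \<Rightarrow> nat \<Rightarrow> ('a mat set \<times> 'a mat set) set set" where
  "HX F n = H_orbit n ` Xspace F n"

definition upper_blk :: "nat \<Rightarrow> int mat \<Rightarrow> int mat" where
  "upper_blk n w = mat n n (\<lambda>(i,j). w $$ (i,j))"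

definition lower_blk :: "nat \<Rightarrow> int mat \<Rightarrow> int mat" where
  "lower_blk n w = mat n n (\<lambda>(i,j). w $$ (n+i,j))"

definition partial_signed_perm :: "nat \<Rightarrow> int mat \<Rightarrow> bool" where
  "partial_signed_perm n t \<longleftrightarrow> t \<in> carrier_mat n n \<and>
     (\<forall>i<n. \<forall>j<n. t $$ (i,j) \<in> {-1,0,1}) \<and>
     (\<forall>i<n. \<forall>j<n. \<forall>j'<n. t $$ (i,j) \<noteq> 0 \<and> t $$ (i,j') \<noteq> 0 \<longrightarrow> j = j') \<and>
     (\<forall>j<n. \<forall>i<n. \<forall>i'<n. t $$ (i,j) \<noteq> 0 \<and> t $$ (i',j) \<noteq> 0 \<longrightarrow> i = i')"

text \<open>Omega^circ_n (rank taken over the rationals, equivalently over any field of char 0).\<close>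
definition Omega :: "nat \<Rightarrow> int mat set" where
  "Omega n = {w \<in> carrier_mat (2*n) n.
      partial_signed_perm n (upper_blk n w) \<and> partial_signed_perm n (lower_blk n w) \<and>
      transpose_mat (upper_blk n w) * lower_blk n w
        = transpose_mat (transpose_mat (upper_blk n w) * lower_blk n w) \<and>
      vec_space.rank (2*n) (map_mat rat_of_int w :: rat mat) = n}"

definition sign_diag :: "nat \<Rightarrow> int mat set" where
  "sign_diag n = {e \<in> carrier_mat n n. \<forall>i<n. \<forall>j<n.
      (i \<noteq> j \<longrightarrow> e $$ (i,j) = 0) \<and> (e $$ (i,i) = 1 \<or> e $$ (i,i) = -1)}"

definition signed_perm :: "nat \<Rightarrow> int mat set" where
  "signed_perm n = {s. partial_signed_perm n s \<and>
      (\<forall>i<n. \<exists>j<n. s $$ (i,j) \<noteq> 0) \<and> (\<forall>j<n. \<exists>i<n. s $$ (i,j) \<noteq> 0)}"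

definition Omega_class :: "nat \<Rightarrow> int mat \<Rightarrow> int mat set" where
  "Omega_class n w = {four_block_mat e (0\<^sub>m n n) (0\<^sub>m n n) e * w * s | e s.
      e \<in> sign_diag n \<and> s \<in> signed_perm n}"

definition Omega_quot :: "nat \<Rightarrow> int mat set set" where
  "Omega_quot n = Omega_class n ` Omega n"

definition colspace :: "'a::semiring_0 mat \<Rightarrow> 'a vec set" where
  "colspace M = {M *\<^sub>v x | x. x \<in> carrier_vec (dim_col M)}"

datatype clan_val = Pt nat | Plus | Minus | Cdec | Ddec

definition Gamma :: "nat \<Rightarrow> (nat \<Rightarrow> clan_val) set" where
  "Gamma n = {\<gamma> \<in> {1..n} \<rightarrow>\<^sub>E (Pt ` {1..n} \<union> {Plus, Minus, Cdec, Ddec}).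
      \<forall>i\<in>{1..n}. \<forall>j. \<gamma> i = Pt j \<longrightarrow> i \<noteq> j \<and> \<gamma> j = Pt i}"

end

theory Submission
  imports Defs
begin

text \<open>
  Points of \<open>G/P\<^sub>G\<close> are Lagrangian subspaces \<open>W = W\<^sup>\<bottom>\<close>. The leading positions of the first
  components of \<open>W\<close> select a set \<open>I\<close> of indices such that, up to \<open>B\<^sub>H\<close>, \<open>W\<close> is the column
  space of \<open>(E; S + D)\<close> with \<open>E\<close>, \<open>D\<close> the coordinate projections to \<open>I\<close> and its complement and
  \<open>S\<close> hermitian, supported on \<open>I\<close>. Congruence by upper triangular matrices makes \<open>S\<close> a signed
  involution, whose fixed points, 2-cycles and zero rows are the signs, arcs and \<open>c\<close>'s of a clan,
  the complement of \<open>I\<close> being the \<open>d\<close>'s. Different clans are separated by the intersections of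
  \<open>W\<close> with the \<open>B\<^sub>H\<close>-stable flags and by the sign of the invariant form \<open>x\<^sup>*y\<close> on them.
\<close>

section \<open>Fields with a sign\<close>

text \<open>The group moves the two halves of a vector contragrediently: \<open>a\<close> acts on
  the first half, the inverse of its adjoint on the second. In the resulting congruence a triangular
  move can add earlier basis vectors to later ones only. This dictates the order of elimination in
  the hermitian part, and it is why arcs, and not just a signature, survive as invariants. An arc
  carries no sign because rescaling one of its ends absorbs it; a fixed point keeps its sign because
  t^* t is never -1. The conjugation stays abstract, so one argument serves both cases: the factor
  sqrt(-1) in J_n cancels from the isometry condition. That different clans give different classes
  in Omega is not checked combinatorially: equivalent matrices have column spaces in one B_H-orbit,
  and the orbit invariants over the reals separate these.\<close>

text \<open>The only properties of the real and complex numbers that the classification uses.\<close>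

class sign_field = conjugatable_field +
  assumes ex_normalizer:
      "conjugate c = c \<Longrightarrow> c \<noteq> 0 \<Longrightarrow> \<exists>t. conjugate t * c * t = 1 \<or> conjugate t * c * t = - 1"
    and norm_neq_minus_one: "conjugate t * t \<noteq> - 1"

text \<open>A self-conjugate complex number is real, so t = 1 / sqrt |c| scales it to its sign; t^*
  t is a sum of two squares and cannot be -1.\<close>

instance complex :: sign_field
proof
  fix c :: complex assume c: "conjugate c = c" "c \<noteq> 0"
  define r where "r = Re c"
  have cr: "c = of_real r" using c by (auto simp: r_def complex_eq_iff)
  then have "r \<noteq> 0" using c by auto
  have "(1 / sqrt \<bar>r\<bar>) * (1 / sqrt \<bar>r\<bar>) * r = 1 \<or> (1 / sqrt \<bar>r\<bar>) * (1 / sqrt \<bar>r\<bar>) * r = - 1"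
    using \<open>r \<noteq> 0\<close> by (cases "r > 0") (auto simp: field_simps)
  then have "conjugate (complex_of_real (1 / sqrt \<bar>r\<bar>)) * c * of_real (1 / sqrt \<bar>r\<bar>) = 1
     \<or> conjugate (complex_of_real (1 / sqrt \<bar>r\<bar>)) * c * of_real (1 / sqrt \<bar>r\<bar>) = - 1"
    unfolding cr by (simp add: complex_eq_iff field_simps)
  then show "\<exists>t. conjugate t * c * t = 1 \<or> conjugate t * c * t = - 1" by blast
next
  fix t :: complex
  have "Re t * Re t + Im t * Im t \<noteq> - 1"
    using zero_le_square[of "Re t"] zero_le_square[of "Im t"] by linarith
  then show "conjugate t * t \<noteq> - 1"
    by (auto simp: complex_eq_iff)
qed

instance real :: sign_field
proof
  fix c :: real assume c: "conjugate c = c" "c \<noteq> 0"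
  have "(1 / sqrt \<bar>c\<bar>) * c * (1 / sqrt \<bar>c\<bar>) = 1 \<or> (1 / sqrt \<bar>c\<bar>) * c * (1 / sqrt \<bar>c\<bar>) = - 1"
    using c by (cases "c > 0") (auto simp: field_simps)
  then show "\<exists>t. conjugate t * c * t = 1 \<or> conjugate t * c * t = - 1"
    unfolding conjugate_real_def by blast
next
  fix t :: real
  show "conjugate t * t \<noteq> - 1"
    unfolding conjugate_real_def using zero_le_square[of t] by linarith
qed

lemma conjugate_one [simp]: "conjugate (1 :: 'a :: conjugatable_field) = 1"
proof -
  have "conjugate (1::'a) * conjugate 1 = conjugate 1"
    by (metis conjugate_dist_mul mult_1)
  then show ?thesis by auto
qed

lemma conjugate_minus_one [simp]: "conjugate (- 1 :: 'a :: conjugatable_field) = - 1"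
  by (simp add: conjugate_neg)

text \<open>If 2 were 0, then 1 = -1 would be a norm. Division by 2 is needed when the far end of an
  arc is cleared of its diagonal entry.\<close>

lemma two_neq_zero: "(2 :: 'a :: sign_field) \<noteq> 0"
proof
  assume "(2::'a) = 0"
  then have "(1::'a) + 1 = 0" by simp
  then have "(1::'a) = - 1" by (simp add: eq_neg_iff_add_eq_0)
  then show False using norm_neq_minus_one[of "1::'a"] by simp
qed

section \<open>Adjoint matrices\<close>

lemma dim_mat_adjoint [simp]:
  "dim_row (mat_adjoint A) = dim_col A" "dim_col (mat_adjoint A) = dim_row A"
  by (auto simp: mat_adjoint_def)

lemma mat_adjoint_carrier [simp]:
  "A \<in> carrier_mat n m \<Longrightarrow> mat_adjoint A \<in> carrier_mat m n"
  by auto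

lemma index_mat_adjoint [simp]:
  "i < dim_col A \<Longrightarrow> j < dim_row A \<Longrightarrow> mat_adjoint A $$ (i, j) = conjugate (A $$ (j, i))"
  by (simp add: mat_adjoint_def mat_of_rows_index)

lemma mat_adjoint_mult:
  assumes "A \<in> carrier_mat n m" "B \<in> carrier_mat m k"
  shows "mat_adjoint (A * B) = mat_adjoint B * mat_adjoint A"
  using assms
  by (intro eq_matI)
     (auto simp: scalar_prod_def sum_conjugate conjugate_dist_mul mult.commute intro!: sum.cong)

lemma mat_adjoint_adjoint [simp]: "mat_adjoint (mat_adjoint A) = A"
  by (intro eq_matI) auto

lemma mat_adjoint_one [simp]: "mat_adjoint (1\<^sub>m n) = 1\<^sub>m n"
  by (intro eq_matI) auto

lemma mat_adjoint_zero [simp]: "mat_adjoint (0\<^sub>m n m) = 0\<^sub>m m n"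
  by (intro eq_matI) auto

lemma mat_adjoint_four_block:
  assumes "A \<in> carrier_mat n n" "B \<in> carrier_mat n n" "C \<in> carrier_mat n n" "D \<in> carrier_mat n n"
  shows "mat_adjoint (four_block_mat A B C D)
    = four_block_mat (mat_adjoint A) (mat_adjoint C) (mat_adjoint B) (mat_adjoint D)"
  using assms by (intro eq_matI) auto

lemma cscalar_prod_mult_mat_vec:
  fixes A :: "'a :: conjugatable_field mat"
  assumes A: "A \<in> carrier_mat n m" and v: "v \<in> carrier_vec m" and w: "w \<in> carrier_vec n"
  shows "(A *\<^sub>v v) \<bullet>c w = v \<bullet>c (mat_adjoint A *\<^sub>v w)"
proof -
  have "(A *\<^sub>v v) \<bullet>c w = (\<Sum>i<n. \<Sum>j<m. A $$ (i,j) * v $ j * conjugate (w $ i))"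
    using A v w by (auto simp: scalar_prod_def sum_distrib_right atLeast0LessThan intro!: sum.cong)
  also have "\<dots> = (\<Sum>j<m. \<Sum>i<n. A $$ (i,j) * v $ j * conjugate (w $ i))"
    by (rule sum.swap)
  also have "\<dots> = v \<bullet>c (mat_adjoint A *\<^sub>v w)"
    using A v w
    by (auto simp: scalar_prod_def sum_distrib_left atLeast0LessThan sum_conjugate
        conjugate_dist_mul mult_ac intro!: sum.cong)
  finally show ?thesis .
qed

lemma conjugate_append_vec: "conjugate (v @\<^sub>v w) = conjugate v @\<^sub>v conjugate w"
  by (intro eq_vecI) auto

section \<open>The skew form\<close>

text \<open>The form u^* Sigma v, linear in \<open>v\<close> and conjugate-linear in
  \<open>u\<close>. The size is recovered from \<open>dim_vec u\<close>, so it need not be carried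
  along as an argument.\<close>

definition skew :: "'a :: conjugatable_field vec \<Rightarrow> 'a vec \<Rightarrow> 'a" where
  "skew u v = (Sigma_mat (dim_vec u div 2) *\<^sub>v v) \<bullet>c u"

lemma Sigma_mat_carrier [simp]: "Sigma_mat n \<in> carrier_mat (2*n) (2*n)"
  by (auto simp: Sigma_mat_def)

lemma dim_Sigma_mat [simp]: "dim_row (Sigma_mat n) = 2*n" "dim_col (Sigma_mat n) = 2*n"
  using Sigma_mat_carrier by (auto simp del: Sigma_mat_carrier)

lemma skew_append:
  fixes x y x' y' :: "'a :: conjugatable_field vec"
  assumes "x \<in> carrier_vec n" "y \<in> carrier_vec n" "x' \<in> carrier_vec n" "y' \<in> carrier_vec n"
  shows "skew (x @\<^sub>v y) (x' @\<^sub>v y') = y' \<bullet>c x - x' \<bullet>c y"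
proof -
  have "dim_vec (x @\<^sub>v y) div 2 = n" using assms by auto
  moreover have "Sigma_mat n *\<^sub>v (x' @\<^sub>v y') = y' @\<^sub>v (- x')"
    unfolding Sigma_mat_def using assms
    by (subst four_block_mat_mult_vec[of _ n n _ n _ n]) (auto intro!: eq_vecI)
  ultimately show ?thesis
    using assms unfolding skew_def
    by (simp add: conjugate_append_vec scalar_prod_append[of _ n _ n])
qed

lemma append_vec_cases:
  assumes "v \<in> carrier_vec (2*n)"
  obtains x y where "x \<in> carrier_vec n" "y \<in> carrier_vec n" "v = x @\<^sub>v y"
  using assms vec_first_last_append[of v n n] vec_first_carrier vec_last_carrier
  by (metis mult_2)

lemma append_vec_carrier [simp]:
  "x \<in> carrier_vec n \<Longrightarrow> y \<in> carrier_vec n \<Longrightarrow> x @\<^sub>v y \<in> carrier_vec (2*n)"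
  by (auto simp: mult_2)

section \<open>Groups of matrices\<close>

text \<open>A set-based notion of group: square matrices of a fixed size do not form a type, and
  inverses are required as elements of the set.\<close>

definition mat_group :: "nat \<Rightarrow> 'a :: semiring_1 mat set \<Rightarrow> bool" where
  "mat_group n G \<longleftrightarrow> G \<subseteq> carrier_mat n n \<and> 1\<^sub>m n \<in> G \<and> (\<forall>g\<in>G. \<forall>h\<in>G. g * h \<in> G) \<and>
    (\<forall>g\<in>G. \<exists>h\<in>G. g * h = 1\<^sub>m n \<and> h * g = 1\<^sub>m n)"

lemma mat_groupD:
  assumes "mat_group n G"
  shows "g \<in> G \<Longrightarrow> g \<in> carrier_mat n n" "1\<^sub>m n \<in> G" "g \<in> G \<Longrightarrow> h \<in> G \<Longrightarrow> g * h \<in> G"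
  using assms by (auto simp: mat_group_def)

lemma mat_group_subset: "mat_group n G \<Longrightarrow> G \<subseteq> carrier_mat n n"
  by (simp add: mat_group_def)

lemma mat_group_inverse:
  assumes "mat_group n G" "g \<in> G"
  obtains h where "h \<in> G" "g * h = 1\<^sub>m n" "h * g = 1\<^sub>m n"
  using assms by (auto simp: mat_group_def)

section \<open>Action on subspaces, and the isometry group of the skew form\<close>

lemma img_subspace_mult:
  assumes "g \<in> carrier_mat n n" "h \<in> carrier_mat n n" "V \<subseteq> carrier_vec n"
  shows "img_subspace (g * h) V = img_subspace g (img_subspace h V)"
  using assms by (force simp: img_subspace_def image_image intro!: image_cong)

lemma img_subspace_one:
  assumes "V \<subseteq> carrier_vec n"
  shows "img_subspace (1\<^sub>m n :: 'a :: semiring_1 mat) V = V"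
proof -
  have "(\<lambda>v. (1\<^sub>m n :: 'a mat) *\<^sub>v v) ` V = id ` V"
    using assms by (intro image_cong) auto
  then show ?thesis by (simp add: img_subspace_def)
qed

lemma img_subspace_carrier:
  "g \<in> carrier_mat n n \<Longrightarrow> V \<subseteq> carrier_vec n \<Longrightarrow> img_subspace g V \<subseteq> carrier_vec n"
  by (auto simp: img_subspace_def)

lemma L0_carrier [simp]: "L0 n \<subseteq> carrier_vec (2*n)"
  by (auto simp: L0_def)

lemma Sigma_mat_square: "Sigma_mat n * Sigma_mat n = - (1\<^sub>m (2*n) :: 'a :: conjugatable_field mat)"
proof -
  have "four_block_mat (- 1\<^sub>m n) (0\<^sub>m n n) (- 0\<^sub>m n n) (- 1\<^sub>m n) = - (1\<^sub>m (2*n) :: 'a mat)"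
    by (intro eq_matI) auto
  then show ?thesis
  unfolding Sigma_mat_def
  by (subst mult_four_block_mat[of _ n n _ n _ n _ _ n _ n]) auto
qed

lemma isom_grp_mat_group: "mat_group (2*n) (isom_grp (Sigma_mat n :: 'a :: conjugatable_field mat) n)"
  (is "mat_group ?m ?G")
proof -
  let ?S = "Sigma_mat n :: 'a mat"
  have S: "?S \<in> carrier_mat ?m ?m" by simp
  have "g * h \<in> ?G" if g: "g \<in> ?G" and h: "h \<in> ?G" for g h
  proof -
    have gc: "g \<in> carrier_mat ?m ?m" and hc: "h \<in> carrier_mat ?m ?m"
      and ge: "mat_adjoint g * ?S * g = ?S" and he: "mat_adjoint h * ?S * h = ?S"
      using g h by (auto simp: isom_grp_def)
    have "mat_adjoint (g * h) * ?S * (g * h) = mat_adjoint h * (mat_adjoint g * ?S * g) * h"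
      using gc hc S by (simp add: mat_adjoint_mult[OF gc hc] assoc_mult_mat[of _ ?m ?m _ ?m _ ?m] mult_carrier_mat[of _ ?m ?m])
    then show ?thesis using gc hc ge he by (auto simp: isom_grp_def)
  qed
  moreover have "\<exists>h\<in>?G. g * h = 1\<^sub>m ?m \<and> h * g = 1\<^sub>m ?m" if g: "g \<in> ?G" for g
  proof -
    have gc: "g \<in> carrier_mat ?m ?m" and ge: "mat_adjoint g * ?S * g = ?S"
      using g by (auto simp: isom_grp_def)
    \<comment> \<open>From g^* Sigma g = Sigma and Sigma^2 = -1 a left inverse of g can be read off;
      for square matrices it is also a right inverse.\<close>
    define h where "h = - ?S * mat_adjoint g * ?S"
    have hc: "h \<in> carrier_mat ?m ?m" using gc S unfolding h_def
      by (meson mult_carrier_mat mat_adjoint_carrier uminus_carrier_mat)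
    have "h * g = - ?S * (mat_adjoint g * ?S * g)" unfolding h_def
      using gc S by (simp add: assoc_mult_mat[of _ ?m ?m _ ?m _ ?m] mult_carrier_mat[of _ ?m ?m])
    also have "\<dots> = 1\<^sub>m ?m"
      unfolding ge by (subst uminus_mult_left_mat) (auto simp: Sigma_mat_square)
    finally have hg: "h * g = 1\<^sub>m ?m" .
    have gh: "g * h = 1\<^sub>m ?m" using mat_mult_left_right_inverse[OF hc gc hg] .
    have adj: "mat_adjoint h * mat_adjoint g = 1\<^sub>m ?m"
      using mat_adjoint_mult[OF gc hc] gh by simp
    have "mat_adjoint h * ?S * h = mat_adjoint h * (mat_adjoint g * ?S * g) * h"
      by (simp add: ge)
    also have "\<dots> = (mat_adjoint h * mat_adjoint g) * ?S * (g * h)"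
      using gc hc S by (simp add: assoc_mult_mat[of _ ?m ?m _ ?m _ ?m] mult_carrier_mat[of _ ?m ?m])
    also have "\<dots> = ?S" using adj gh S by simp
    finally show ?thesis using hc hg gh by (auto simp: isom_grp_def)
  qed
  moreover have "1\<^sub>m ?m \<in> ?G" using S by (auto simp: isom_grp_def)
  ultimately show ?thesis by (auto simp: mat_group_def isom_grp_def)
qed

lemma skew_isom:
  assumes "g \<in> isom_grp (Sigma_mat n) n" "u \<in> carrier_vec (2*n)" "v \<in> carrier_vec (2*n)"
  shows "skew (g *\<^sub>v u) (g *\<^sub>v v) = skew u v"
proof -
  let ?S = "Sigma_mat n" and ?m = "2*n"
  have g: "g \<in> carrier_mat ?m ?m" "mat_adjoint g * ?S * g = ?S"
    using assms by (auto simp: isom_grp_def)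
  have "skew (g *\<^sub>v u) (g *\<^sub>v v) = (?S *\<^sub>v (g *\<^sub>v v)) \<bullet>c (g *\<^sub>v u)"
    using g assms by (simp add: skew_def)
  also have "\<dots> = (mat_adjoint g *\<^sub>v (?S *\<^sub>v (g *\<^sub>v v))) \<bullet>c u"
    using cscalar_prod_mult_mat_vec[of "mat_adjoint g" ?m ?m "?S *\<^sub>v (g *\<^sub>v v)" u] g assms
    by (metis Sigma_mat_carrier mat_adjoint_adjoint mat_adjoint_carrier mult_mat_vec_carrier)
  also have "mat_adjoint g *\<^sub>v (?S *\<^sub>v (g *\<^sub>v v)) = (mat_adjoint g * ?S * g) *\<^sub>v v"
    using g(1) assms Sigma_mat_carrier[of n]
    by (simp add: assoc_mult_mat_vec[of _ ?m ?m _ ?m] mult_carrier_mat[of _ ?m ?m])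
  also have "\<dots> \<bullet>c u = skew u v"
    using g assms by (simp add: skew_def)
  finally show ?thesis .
qed

section \<open>Triangular matrices\<close>

lemma upper_triangular_mult:
  fixes a b :: "'a :: semiring_0 mat"
  assumes "a \<in> carrier_mat n n" "b \<in> carrier_mat n n" "upper_triangular a" "upper_triangular b"
  shows "upper_triangular (a * b)"
proof (rule upper_triangularI)
  fix i j assume ij: "j < i" "i < dim_row (a * b)"
  have "(a * b) $$ (i, j) = (\<Sum>k\<in>{0..<n}. a $$ (i, k) * b $$ (k, j))"
    using assms ij by (auto simp: scalar_prod_def intro!: sum.cong)
  also have "\<dots> = 0"
  proof (intro sum.neutral ballI)
    fix k assume "k \<in> {0..<n}"
    then show "a $$ (i, k) * b $$ (k, j) = 0"
      using assms ij upper_triangularD[of a k i] upper_triangularD[of b j k]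
      by (cases "k < i") auto
  qed
  finally show "(a * b) $$ (i, j) = 0" .
qed

lemma upper_triangular_diag_neq_zero:
  fixes a c :: "'a :: field mat"
  assumes a: "a \<in> carrier_mat n n" "upper_triangular a" and c: "c \<in> carrier_mat n n"
    and ac: "a * c = 1\<^sub>m n" and i: "i < n"
  shows "a $$ (i, i) \<noteq> 0"
proof -
  have "det a * det c = 1" using det_mult[OF a(1) c] ac by simp
  then have "0 \<notin> set (diag_mat a)"
    using upper_triangular_imp_det_eq_0_iff[OF a] by auto
  then show ?thesis using a i by (auto simp: diag_mat_def)
qed

text \<open>Rows are treated from the bottom up. Below the diagonal, entry (i, j) of
  \<open>a * c\<close> reduces to \<open>a $$ (i, i) * c $$ (i, j)\<close>: the terms with k < i
  vanish in \<open>a\<close>, those with k > i vanish in \<open>c\<close> by induction.\<close>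

lemma upper_triangular_inverse:
  fixes a c :: "'a :: field mat"
  assumes a: "a \<in> carrier_mat n n" "upper_triangular a" and c: "c \<in> carrier_mat n n"
    and ac: "a * c = 1\<^sub>m n"
  shows "upper_triangular c"
proof -
  have "c $$ (i, j) = 0" if "j < i" "i < n" for i j
    using that
  proof (induction "n - i" arbitrary: i rule: less_induct)
    case less
    have "0 = (a * c) $$ (i, j)" using ac less.prems by simp
    also have "\<dots> = (\<Sum>k\<in>{0..<n}. a $$ (i, k) * c $$ (k, j))"
      using a c less.prems by (auto simp: scalar_prod_def intro!: sum.cong)
    also have "\<dots> = (\<Sum>k\<in>{0..<n}. if k = i then a $$ (i, i) * c $$ (i, j) else 0)"
    proof (intro sum.cong refl)
      fix k assume k: "k \<in> {0..<n}"
      show "a $$ (i, k) * c $$ (k, j) = (if k = i then a $$ (i, i) * c $$ (i, j) else 0)"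
        using a upper_triangularD[of a k i] less k by (cases k i rule: linorder_cases) auto
    qed
    also have "\<dots> = a $$ (i, i) * c $$ (i, j)" using less.prems by simp
    finally show ?case
      using upper_triangular_diag_neq_zero[OF a c ac] less.prems by auto
  qed
  then show ?thesis using c by (intro upper_triangularI) auto
qed

lemma obtain_inverse_upper_triangular:
  fixes a :: "'a :: field mat"
  assumes a: "a \<in> carrier_mat n n" "upper_triangular a" and nz: "\<And>i. i < n \<Longrightarrow> a $$ (i, i) \<noteq> 0"
  obtains c where "c \<in> carrier_mat n n" "a * c = 1\<^sub>m n" "c * a = 1\<^sub>m n" "upper_triangular c"
proof -
  have "0 \<notin> set (diag_mat a)" using a nz by (auto simp: diag_mat_def)
  then have "det a \<noteq> 0" using upper_triangular_imp_det_eq_0_iff[OF a] by auto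
  from det_non_zero_imp_unit[OF a(1) this] obtain c
    where "c \<in> carrier_mat n n" "a * c = 1\<^sub>m n" "c * a = 1\<^sub>m n"
    by (auto simp: Units_def ring_mat_def)
  then show thesis using that upper_triangular_inverse[OF a] by blast
qed

section \<open>The groups acting\<close>

abbreviation bdiag :: "nat \<Rightarrow> 'a :: zero mat \<Rightarrow> 'a mat \<Rightarrow> 'a mat" where
  "bdiag n a d \<equiv> four_block_mat a (0\<^sub>m n n) (0\<^sub>m n n) d"

lemma bdiag_carrier:
  "a \<in> carrier_mat n n \<Longrightarrow> d \<in> carrier_mat n n \<Longrightarrow> bdiag n a d \<in> carrier_mat (2*n) (2*n)"
  by auto

lemma bdiag_mult:
  fixes a :: "'a :: semiring_1 mat"
  assumes "a \<in> carrier_mat n n" "d \<in> carrier_mat n n" "a' \<in> carrier_mat n n" "d' \<in> carrier_mat n n"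
  shows "bdiag n a d * bdiag n a' d' = bdiag n (a * a') (d * d')"
  using assms by (subst mult_four_block_mat[of _ n n _ n _ n _ _ n _ n]) auto

lemma bdiag_one: "bdiag n (1\<^sub>m n) (1\<^sub>m n) = 1\<^sub>m (2*n)"
  by (intro eq_matI) auto

lemma bdiag_mult_append:
  fixes a :: "'a :: comm_semiring_1 mat"
  assumes "a \<in> carrier_mat n n" "d \<in> carrier_mat n n" "x \<in> carrier_vec n" "y \<in> carrier_vec n"
  shows "bdiag n a d *\<^sub>v (x @\<^sub>v y) = (a *\<^sub>v x) @\<^sub>v (d *\<^sub>v y)"
proof -
  have "0\<^sub>m n n *\<^sub>v x = 0\<^sub>v n" "0\<^sub>m n n *\<^sub>v y = 0\<^sub>v n" using assms by auto
  then show ?thesis using assms by (subst four_block_mat_mult_vec[of _ n n _ n _ n]) auto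
qed

text \<open>The groups record only the identity a^* d = 1. The others follow because one-sided
  inverses of square matrices are two-sided and adjoints reverse products.\<close>

lemma adjoint_inverse_swap:
  fixes a :: "'a :: conjugatable_field mat"
  assumes a: "a \<in> carrier_mat n n" and d: "d \<in> carrier_mat n n" and ad: "mat_adjoint a * d = 1\<^sub>m n"
  shows "d * mat_adjoint a = 1\<^sub>m n" "a * mat_adjoint d = 1\<^sub>m n" "mat_adjoint d * a = 1\<^sub>m n"
proof -
  show 1: "d * mat_adjoint a = 1\<^sub>m n"
    using mat_mult_left_right_inverse[OF mat_adjoint_carrier[OF a] d ad] .
  show "a * mat_adjoint d = 1\<^sub>m n"
    using mat_adjoint_mult[OF d mat_adjoint_carrier[OF a]] 1 by simp
  show "mat_adjoint d * a = 1\<^sub>m n"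
    using mat_adjoint_mult[OF mat_adjoint_carrier[OF a] d] ad by simp
qed

lemma adjoint_inverse_mult:
  fixes a :: "'a :: conjugatable_field mat"
  assumes "a \<in> carrier_mat n n" "d \<in> carrier_mat n n" "mat_adjoint a * d = 1\<^sub>m n"
    "a' \<in> carrier_mat n n" "d' \<in> carrier_mat n n" "mat_adjoint a' * d' = 1\<^sub>m n"
  shows "mat_adjoint (a * a') * (d * d') = 1\<^sub>m n"
proof -
  have "mat_adjoint (a * a') * (d * d') = mat_adjoint a' * (mat_adjoint a * d) * d'"
    using assms(1,2,4,5)
    by (simp add: mat_adjoint_mult[of _ n n] assoc_mult_mat[of _ n n _ n _ n] mult_carrier_mat[of _ n n])
  also have "\<dots> = 1\<^sub>m n" using assms by simp
  finally show ?thesis .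
qed

lemma B_grpI:
  "a \<in> carrier_mat n n \<Longrightarrow> d \<in> carrier_mat n n \<Longrightarrow> mat_adjoint a * d = 1\<^sub>m n \<Longrightarrow>
    upper_triangular a \<Longrightarrow> bdiag n a d \<in> B_grp n"
  by (auto simp: B_grp_def)

lemma B_grpE:
  assumes "b \<in> B_grp n"
  obtains a d where "b = bdiag n a d" "a \<in> carrier_mat n n" "d \<in> carrier_mat n n"
    "mat_adjoint a * d = 1\<^sub>m n" "upper_triangular a"
  using assms by (auto simp: B_grp_def)

lemma H_grpI:
  "a \<in> carrier_mat n n \<Longrightarrow> d \<in> carrier_mat n n \<Longrightarrow> mat_adjoint a * d = 1\<^sub>m n \<Longrightarrow>
    bdiag n a d \<in> H_grp n"
  by (auto simp: H_grp_def)

lemma H_grpE: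
  assumes "b \<in> H_grp n"
  obtains a d where "b = bdiag n a d" "a \<in> carrier_mat n n" "d \<in> carrier_mat n n"
    "mat_adjoint a * d = 1\<^sub>m n"
  using assms by (auto simp: H_grp_def)

lemma H_grp_mat_group: "mat_group (2*n) (H_grp n :: 'a :: conjugatable_field mat set)"
  unfolding mat_group_def
proof (intro conjI ballI)
  show "(H_grp n :: 'a mat set) \<subseteq> carrier_mat (2*n) (2*n)"
    by (auto simp: H_grp_def)
  show "(1\<^sub>m (2*n) :: 'a mat) \<in> H_grp n"
    unfolding bdiag_one[symmetric] by (intro H_grpI) auto
  fix g h :: "'a mat" assume "g \<in> H_grp n"
  then obtain a d where g: "g = bdiag n a d" "a \<in> carrier_mat n n" "d \<in> carrier_mat n n"
    "mat_adjoint a * d = 1\<^sub>m n" by (rule H_grpE)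
  show "g * h \<in> H_grp n" if "h \<in> H_grp n"
    using that by (elim H_grpE) (auto simp: g(1) bdiag_mult g(2,3)
        intro!: H_grpI adjoint_inverse_mult g mult_carrier_mat[of _ n n])
  \<comment> \<open>The inverse has diagonal blocks d^* and a^*, which satisfy the same defining
    relation.\<close>
  show "\<exists>h\<in>H_grp n. g * h = 1\<^sub>m (2*n) \<and> h * g = 1\<^sub>m (2*n)"
    using g adjoint_inverse_swap[OF g(2-4)]
    by (intro bexI[of _ "bdiag n (mat_adjoint d) (mat_adjoint a)"])
       (auto simp: bdiag_mult bdiag_one intro!: H_grpI)
qed

lemma B_grp_mat_group: "mat_group (2*n) (B_grp n :: 'a :: conjugatable_field mat set)"
  unfolding mat_group_def
proof (intro conjI ballI)
  show "(B_grp n :: 'a mat set) \<subseteq> carrier_mat (2*n) (2*n)"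
    by (auto simp: B_grp_def)
  show "(1\<^sub>m (2*n) :: 'a mat) \<in> B_grp n"
    unfolding bdiag_one[symmetric] by (intro B_grpI) auto
  fix g h :: "'a mat" assume "g \<in> B_grp n"
  then obtain a d where g: "g = bdiag n a d" "a \<in> carrier_mat n n" "d \<in> carrier_mat n n"
    "mat_adjoint a * d = 1\<^sub>m n" "upper_triangular a" by (rule B_grpE)
  show "g * h \<in> B_grp n" if "h \<in> B_grp n"
    using that
    by (elim B_grpE)
      (auto simp: g(1) bdiag_mult g(2,3)
        intro!: B_grpI adjoint_inverse_mult g mult_carrier_mat[of _ n n] upper_triangular_mult[of _ n])
  show "\<exists>h\<in>B_grp n. g * h = 1\<^sub>m (2*n) \<and> h * g = 1\<^sub>m (2*n)"
    using g adjoint_inverse_swap[OF g(2-4)] upper_triangular_inverse[OF g(2) g(5), of "mat_adjoint d"]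
    by (intro bexI[of _ "bdiag n (mat_adjoint d) (mat_adjoint a)"])
       (auto simp: bdiag_mult bdiag_one intro!: B_grpI)
qed

lemma B_grp_le_H_grp: "B_grp n \<subseteq> H_grp n"
  by (auto simp: B_grp_def H_grp_def)

abbreviation G_grp :: "nat \<Rightarrow> 'a :: conjugatable_field mat set" where
  "G_grp n \<equiv> isom_grp (Sigma_mat n) n"

abbreviation PS_grp :: "nat \<Rightarrow> 'a :: conjugatable_field mat set" where
  "PS_grp n \<equiv> P_grp (Sigma_mat n) n"

lemma H_grp_le_G_grp: "H_grp n \<subseteq> (G_grp n :: 'a :: conjugatable_field mat set)"
proof
  fix h :: "'a mat" assume "h \<in> H_grp n"
  then obtain a d where h: "h = bdiag n a d" "a \<in> carrier_mat n n" "d \<in> carrier_mat n n"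
    "mat_adjoint a * d = 1\<^sub>m n" by (rule H_grpE)
  have "mat_adjoint h = bdiag n (mat_adjoint a) (mat_adjoint d)"
    using h by (simp add: mat_adjoint_four_block)
  moreover have "bdiag n (mat_adjoint a) (mat_adjoint d) * Sigma_mat n
      = four_block_mat (0\<^sub>m n n) (mat_adjoint a) (- mat_adjoint d) (0\<^sub>m n n)"
    unfolding Sigma_mat_def using h
    by (subst mult_four_block_mat[of _ n n _ n _ n _ _ n _ n]) auto
  moreover have "\<dots> * bdiag n a d = Sigma_mat n"
    unfolding Sigma_mat_def using h adjoint_inverse_swap[OF h(2-4)]
    by (subst mult_four_block_mat[of _ n n _ n _ n _ _ n _ n]) auto
  ultimately have "mat_adjoint h * Sigma_mat n * h = Sigma_mat n" using h(1) by simp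
  then show "h \<in> G_grp n" using h(1-3) by (auto simp: isom_grp_def)
qed

text \<open>Square versions with a single size parameter, so that one instantiation suffices for
  rewriting.\<close>

lemma assoc_mult_square:
  "a \<in> carrier_mat n n \<Longrightarrow> b \<in> carrier_mat n n \<Longrightarrow> c \<in> carrier_mat n n \<Longrightarrow> a * b * c = a * (b * c)"
  by (rule assoc_mult_mat)

lemma mult_carrier_square:
  "a \<in> carrier_mat n n \<Longrightarrow> b \<in> carrier_mat n n \<Longrightarrow> a * b \<in> carrier_mat n n"
  by (rule mult_carrier_mat)

lemma assoc_mult_square5:
  assumes "a \<in> carrier_mat n n" "b \<in> carrier_mat n n" "c \<in> carrier_mat n n"
    "d \<in> carrier_mat n n" "e \<in> carrier_mat n n"
  shows "a * (b * c * d) * e = (a * b) * c * (d * e)"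
  using assms by (simp add: assoc_mult_square[of _ n] mult_carrier_square[of _ n])

lemmas G_grpD = mat_groupD[OF isom_grp_mat_group]

lemma PS_grp_mat_group: "mat_group (2*n) (PS_grp n :: 'a :: conjugatable_field mat set)"
  unfolding mat_group_def
proof (intro conjI ballI)
  show "(PS_grp n :: 'a mat set) \<subseteq> carrier_mat (2*n) (2*n)"
    by (auto simp: P_grp_def isom_grp_def)
  show "(1\<^sub>m (2*n) :: 'a mat) \<in> PS_grp n"
    using G_grpD(2)[where 'a = 'a] by (auto simp: P_grp_def img_subspace_one)
  fix g h :: "'a mat" assume "g \<in> PS_grp n"
  then have g: "g \<in> G_grp n" "img_subspace g (L0 n) = L0 n" by (auto simp: P_grp_def)
  show "g * h \<in> PS_grp n" if "h \<in> PS_grp n"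
    using that g G_grpD[where 'a = 'a]
    by (auto simp: P_grp_def img_subspace_mult[of _ "2*n"])
  obtain h where h: "h \<in> G_grp n" "g * h = 1\<^sub>m (2*n)" "h * g = 1\<^sub>m (2*n)"
    using mat_group_inverse[OF isom_grp_mat_group g(1)] .
  have "img_subspace h (img_subspace g (L0 n)) = L0 n"
    using h g G_grpD(1)[where 'a = 'a] by (subst img_subspace_mult[symmetric, of _ "2*n"]) (auto simp: img_subspace_one)
  then show "\<exists>h\<in>PS_grp n. g * h = 1\<^sub>m (2*n) \<and> h * g = 1\<^sub>m (2*n)"
    using h g by (auto simp: P_grp_def)
qed

section \<open>Cosets and orbits\<close>

lemma lcoset_mult:
  assumes "g \<in> carrier_mat n n" "h \<in> carrier_mat n n" "S \<subseteq> carrier_mat n n"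
  shows "lcoset (g * h) S = lcoset g (lcoset h S)"
  using assms unfolding lcoset_def image_image
  by (intro image_cong refl assoc_mult_mat[of _ n n _ n _ n]) auto

lemma lcoset_self:
  assumes S: "mat_group n S" and s: "s \<in> S"
  shows "lcoset s S = S"
proof
  show "lcoset s S \<subseteq> S" using mat_groupD[OF S] s by (auto simp: lcoset_def)
  obtain t where t: "t \<in> S" "s * t = 1\<^sub>m n" "t * s = 1\<^sub>m n" using mat_group_inverse[OF S s] .
  show "S \<subseteq> lcoset s S"
  proof
    fix x assume x: "x \<in> S"
    have "s * (t * x) = (s * t) * x"
      using mat_groupD(1)[OF S] s t(1) x by (intro assoc_mult_mat[symmetric, of _ n n _ n _ n]) auto
    then have "x = s * (t * x)" using mat_groupD(1)[OF S x] t by simp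
    then show "x \<in> lcoset s S" using mat_groupD(3)[OF S t(1) x] by (auto simp: lcoset_def)
  qed
qed

lemma lcoset_eqD:
  assumes S: "mat_group n S" and g: "g \<in> carrier_mat n n" and h: "h \<in> carrier_mat n n"
    and eq: "lcoset g S = lcoset h S"
  obtains s where "s \<in> S" "h = g * s"
proof -
  have "h = h * 1\<^sub>m n" using h by simp
  then have "h \<in> lcoset g S"
    unfolding eq using mat_groupD(2)[OF S] by (auto simp: lcoset_def)
  then show thesis using that by (auto simp: lcoset_def)
qed

text \<open>\<open>PS_grp n\<close> is the stabilizer of \<open>L0 n\<close>, so G/P_G is the orbit
  of \<open>L0 n\<close> and a coset may be replaced by a subspace.\<close>

lemma lcoset_PS_eq_iff:
  fixes g h :: "'a :: conjugatable_field mat"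
  assumes g: "g \<in> G_grp n" and h: "h \<in> G_grp n"
  shows "lcoset g (PS_grp n) = lcoset h (PS_grp n) \<longleftrightarrow> img_subspace g (L0 n) = img_subspace h (L0 n)"
proof
  note P = PS_grp_mat_group[of n, where 'a = 'a]
  note gc = G_grpD(1)[OF g] and hc = G_grpD(1)[OF h]
  {
    assume "lcoset g (PS_grp n) = lcoset h (PS_grp n)"
    then obtain p where "p \<in> PS_grp n" "h = g * p" using lcoset_eqD[OF P gc hc] by blast
    then show "img_subspace g (L0 n) = img_subspace h (L0 n)"
      using mat_groupD(1)[OF P] gc by (auto simp: P_grp_def img_subspace_mult[of _ "2*n"])
  }
  assume eq: "img_subspace g (L0 n) = img_subspace h (L0 n)"
  obtain k where k: "k \<in> G_grp n" "g * k = 1\<^sub>m (2*n)" "k * g = 1\<^sub>m (2*n)"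
    using mat_group_inverse[OF isom_grp_mat_group g] .
  note kc = G_grpD(1)[OF k(1)]
  have "img_subspace (k * h) (L0 n) = img_subspace (k * g) (L0 n)"
    using gc hc kc eq by (simp add: img_subspace_mult[of _ "2*n"])
  then have p: "k * h \<in> PS_grp n"
    using G_grpD(3)[OF k(1) h] k(3) by (auto simp: P_grp_def img_subspace_one)
  have "h = (g * k) * h" using hc k(2) by simp
  also have "\<dots> = g * (k * h)" using gc hc kc by (intro assoc_mult_mat[of _ "2*n" "2*n" _ "2*n" _ "2*n"])
  finally have "lcoset h (PS_grp n) = lcoset g (lcoset (k * h) (PS_grp n))"
    using gc hc kc mat_groupD(1)[OF P] lcoset_mult[of g "2*n" "k * h" "PS_grp n"]
    by (metis mult_carrier_mat subsetI)
  then show "lcoset g (PS_grp n) = lcoset h (PS_grp n)"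
    using lcoset_self[OF P p] by simp
qed

abbreviation BgP :: "nat \<Rightarrow> 'a :: conjugatable_field mat \<Rightarrow> 'a mat set" where
  "BgP n g \<equiv> dcoset (B_grp n) g (PS_grp n)"

lemma B_grp_G_grp: "b \<in> B_grp n \<Longrightarrow> b \<in> G_grp n"
  using B_grp_le_H_grp H_grp_le_G_grp by blast

lemma dcoset_subset:
  fixes g h :: "'a :: conjugatable_field mat"
  assumes g: "g \<in> G_grp n" and h: "h \<in> G_grp n" and b: "b \<in> B_grp n"
    and eq: "img_subspace (b * g) (L0 n) = img_subspace h (L0 n)"
  shows "BgP n h \<subseteq> BgP n g"
proof
  note P = PS_grp_mat_group[of n, where 'a = 'a] and B = B_grp_mat_group[of n, where 'a = 'a]
  have bg: "b * g \<in> G_grp n" using G_grpD(3)[OF B_grp_G_grp[OF b] g] .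
  have "lcoset (b * g) (PS_grp n) = lcoset h (PS_grp n)" using lcoset_PS_eq_iff[OF bg h] eq by simp
  then obtain p where p: "p \<in> PS_grp n" "h = b * g * p"
    using lcoset_eqD[OF P G_grpD(1)[OF bg] G_grpD(1)[OF h]] by blast
  fix x assume "x \<in> BgP n h"
  then obtain b' p' where x: "x = b' * h * p'" "b' \<in> B_grp n" "p' \<in> PS_grp n"
    by (auto simp: dcoset_def)
  have "x = (b' * b) * g * (p * p')"
    unfolding x p(2)
    by (rule assoc_mult_square5[OF mat_groupD(1)[OF B x(2)] mat_groupD(1)[OF B b] G_grpD(1)[OF g]
          mat_groupD(1)[OF P p(1)] mat_groupD(1)[OF P x(3)]])
  then show "x \<in> BgP n g"
    using mat_groupD(3)[OF B x(2) b] mat_groupD(3)[OF P p(1) x(3)] by (auto simp: dcoset_def)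
qed

text \<open>Double cosets become B_H-orbits on the subspaces \<open>img_subspace g (L0 n)\<close>,
  where the classification takes place. The two inclusions are \<open>dcoset_subset\<close> for b
  and for its inverse.\<close>

lemma dcoset_eq_iff:
  fixes g h :: "'a :: conjugatable_field mat"
  assumes g: "g \<in> G_grp n" and h: "h \<in> G_grp n"
  shows "BgP n g = BgP n h \<longleftrightarrow> (\<exists>b\<in>B_grp n. img_subspace (b * g) (L0 n) = img_subspace h (L0 n))"
proof
  note P = PS_grp_mat_group[of n, where 'a = 'a] and B = B_grp_mat_group[of n, where 'a = 'a]
  note gc = G_grpD(1)[OF g] and hc = G_grpD(1)[OF h]
  {
    assume eq: "BgP n g = BgP n h"
    have "h = 1\<^sub>m (2*n) * h * 1\<^sub>m (2*n)" using hc by simp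
    then have "h \<in> BgP n g" unfolding eq
      using mat_groupD(2)[OF P] mat_groupD(2)[OF B] unfolding dcoset_def by blast
    then obtain b p where bp: "h = b * g * p" "b \<in> B_grp n" "p \<in> PS_grp n"
      by (auto simp: dcoset_def)
    have "img_subspace h (L0 n) = img_subspace (b * g) (L0 n)"
      using bp(3) mat_groupD(1)[OF P bp(3)] mat_groupD(1)[OF B bp(2)] gc
      unfolding bp(1) by (subst img_subspace_mult[of _ "2*n"]) (auto simp: P_grp_def)
    then show "\<exists>b\<in>B_grp n. img_subspace (b * g) (L0 n) = img_subspace h (L0 n)" using bp by auto
  }
  assume "\<exists>b\<in>B_grp n. img_subspace (b * g) (L0 n) = img_subspace h (L0 n)"
  then obtain b where b: "b \<in> B_grp n" "img_subspace (b * g) (L0 n) = img_subspace h (L0 n)" by auto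
  obtain c where c: "c \<in> B_grp n" "b * c = 1\<^sub>m (2*n)" "c * b = 1\<^sub>m (2*n)"
    using mat_group_inverse[OF B b(1)] .
  note bc = mat_groupD(1)[OF B b(1)] and cc = mat_groupD(1)[OF B c(1)]
  have "img_subspace (c * h) (L0 n) = img_subspace c (img_subspace b (img_subspace g (L0 n)))"
    using b(2) gc hc bc cc by (simp add: img_subspace_mult[of _ "2*n"])
  also have "\<dots> = img_subspace (c * b) (img_subspace g (L0 n))"
    using img_subspace_mult[OF cc bc img_subspace_carrier[OF gc L0_carrier]] by simp
  also have "\<dots> = img_subspace g (L0 n)"
    unfolding c(3) by (rule img_subspace_one[OF img_subspace_carrier[OF gc L0_carrier]])
  finally show "BgP n g = BgP n h"
    using dcoset_subset[OF g h b] dcoset_subset[OF h g c(1)] by blast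
qed

section \<open>H-orbits on pairs of cosets\<close>

lemma H_orbit_lcoset:
  fixes g h :: "'a :: conjugatable_field mat"
  assumes "g \<in> carrier_mat (2*n) (2*n)" "h \<in> carrier_mat (2*n) (2*n)"
  shows "H_orbit n (lcoset h (B_grp n), lcoset g (PS_grp n))
    = {(lcoset (k * h) (B_grp n), lcoset (k * g) (PS_grp n)) | k. k \<in> H_grp n}"
proof -
  have "lcoset (k * h) (B_grp n) = (\<lambda>y. k * y) ` lcoset h (B_grp n)"
    "lcoset (k * g) (PS_grp n) = (\<lambda>y. k * y) ` lcoset g (PS_grp n)" if "k \<in> H_grp n" for k
    using lcoset_mult[OF mat_groupD(1)[OF H_grp_mat_group that] assms(2)
        mat_group_subset[OF B_grp_mat_group]]
      lcoset_mult[OF mat_groupD(1)[OF H_grp_mat_group that] assms(1)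
        mat_group_subset[OF PS_grp_mat_group]]
    by (simp_all add: lcoset_def[of k])
  then show ?thesis unfolding H_orbit_def by (intro Collect_cong) (auto intro!: ex_cong1)
qed

text \<open>Moving the point by m in H only reindexes the orbit, as k m runs through H when k
  does.\<close>

lemma H_orbit_translate:
  fixes g h m :: "'a :: conjugatable_field mat"
  assumes g: "g \<in> carrier_mat (2*n) (2*n)" and h: "h \<in> carrier_mat (2*n) (2*n)" and m: "m \<in> H_grp n"
  shows "H_orbit n (lcoset (m * h) (B_grp n), lcoset (m * g) (PS_grp n))
    = H_orbit n (lcoset h (B_grp n), lcoset g (PS_grp n))"
proof -
  note H = H_grp_mat_group[of n, where 'a = 'a]
  note mc = mat_groupD(1)[OF H m]
  obtain m' where m': "m' \<in> H_grp n" "m * m' = 1\<^sub>m (2*n)" "m' * m = 1\<^sub>m (2*n)"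
    using mat_group_inverse[OF H m] .
  have assoc: "k * (m * x) = (k * m) * x"
    if "k \<in> H_grp n" "x \<in> carrier_mat (2*n) (2*n)" for k x :: "'a mat"
    using that mc mat_groupD(1)[OF H] by (intro assoc_mult_mat[symmetric, of _ "2*n" "2*n" _ "2*n" _ "2*n"]) auto
  have right: "(k * m') * m = k" if "k \<in> H_grp n" for k
  proof -
    have "(k * m') * m = k * (m' * m)"
      using that m m' mat_groupD(1)[OF H] by (intro assoc_mult_mat[of _ "2*n" "2*n" _ "2*n" _ "2*n"]) auto
    then show ?thesis using m' mat_groupD(1)[OF H that] by simp
  qed
  have "{(lcoset (k * (m * h)) (B_grp n), lcoset (k * (m * g)) (PS_grp n)) | k. k \<in> H_grp n}
    = {(lcoset (k * h) (B_grp n), lcoset (k * g) (PS_grp n)) | k. k \<in> H_grp n}" (is "?L = ?R")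
  proof (intro equalityI subsetI)
    fix x assume "x \<in> ?L"
    then obtain k where k: "k \<in> H_grp n"
      and x: "x = (lcoset ((k * m) * h) (B_grp n), lcoset ((k * m) * g) (PS_grp n))"
      using assoc g h by auto
    show "x \<in> ?R" using x mat_groupD(3)[OF H k m] by blast
  next
    fix x assume "x \<in> ?R"
    then obtain k where k: "k \<in> H_grp n"
      and x: "x = (lcoset (k * h) (B_grp n), lcoset (k * g) (PS_grp n))" by auto
    have "x = (lcoset ((k * m') * (m * h)) (B_grp n), lcoset ((k * m') * (m * g)) (PS_grp n))"
      using x right[OF k] assoc[OF mat_groupD(3)[OF H k m'(1)]] g h by simp
    then show "x \<in> ?L" using mat_groupD(3)[OF H k m'(1)] by blast
  qed
  then show ?thesis using g h mc by (simp add: H_orbit_lcoset)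
qed

lemma lcoset_one:
  assumes "S \<subseteq> carrier_mat n n"
  shows "lcoset (1\<^sub>m n :: 'a :: semiring_1 mat) S = S"
proof -
  have "(\<lambda>s. (1\<^sub>m n :: 'a mat) * s) ` S = id ` S"
    using assms by (intro image_cong) auto
  then show ?thesis by (simp add: lcoset_def)
qed

text \<open>The stabilizer in H of the base point of H/B_H is B_H. Hence an element of H relating
  two points of the fibre over the base point already lies in B_H.\<close>

lemma H_orbit_eq_iff:
  fixes g h :: "'a :: conjugatable_field mat"
  assumes g: "g \<in> G_grp n" and h: "h \<in> G_grp n"
  shows "H_orbit n (B_grp n, lcoset g (PS_grp n)) = H_orbit n (B_grp n, lcoset h (PS_grp n))
    \<longleftrightarrow> BgP n g = BgP n h"
proof
  note P = PS_grp_mat_group[of n, where 'a = 'a] and B = B_grp_mat_group[of n, where 'a = 'a]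
    and H = H_grp_mat_group[of n, where 'a = 'a]
  note gc = G_grpD(1)[OF g] and hc = G_grpD(1)[OF h]
  have B1: "B_grp n = lcoset (1\<^sub>m (2*n)) (B_grp n :: 'a mat set)"
    using lcoset_one[OF mat_group_subset[OF B]] by simp
  {
    assume "H_orbit n (B_grp n, lcoset g (PS_grp n)) = H_orbit n (B_grp n, lcoset h (PS_grp n))"
    moreover have "(B_grp n, lcoset h (PS_grp n)) \<in> H_orbit n (B_grp n, lcoset h (PS_grp n))"
    proof -
      have "(lcoset (1\<^sub>m (2*n) * 1\<^sub>m (2*n)) (B_grp n), lcoset (1\<^sub>m (2*n) * h) (PS_grp n))
        \<in> H_orbit n (lcoset (1\<^sub>m (2*n)) (B_grp n), lcoset h (PS_grp n))"
        unfolding H_orbit_lcoset[OF hc one_carrier_mat] using mat_groupD(2)[OF H] by blast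
      then show ?thesis using hc B1 by simp
    qed
    ultimately have "(B_grp n, lcoset h (PS_grp n)) \<in> H_orbit n (lcoset (1\<^sub>m (2*n)) (B_grp n), lcoset g (PS_grp n))"
      using B1 by simp
    then obtain k where k: "k \<in> H_grp n" "B_grp n = lcoset (k * 1\<^sub>m (2*n)) (B_grp n)"
      "lcoset h (PS_grp n) = lcoset (k * g) (PS_grp n)"
      using gc by (auto simp: H_orbit_lcoset)
    have kc: "k \<in> carrier_mat (2*n) (2*n)" using mat_groupD(1)[OF H k(1)] .
    have "lcoset (1\<^sub>m (2*n)) (B_grp n) = lcoset k (B_grp n)" using k(2) kc B1 by simp
    then obtain b where b: "b \<in> B_grp n" "k = 1\<^sub>m (2*n) * b"
      using lcoset_eqD[OF B one_carrier_mat kc] by blast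
    then have kB: "k \<in> B_grp n" using mat_groupD(1)[OF B b(1)] by simp
    have "k * g \<in> G_grp n" using G_grpD(3)[OF B_grp_G_grp[OF kB] g] .
    then show "BgP n g = BgP n h"
      using dcoset_eq_iff[OF g h] lcoset_PS_eq_iff[OF h] k(3) kB by metis
  }
  assume "BgP n g = BgP n h"
  then obtain b where b: "b \<in> B_grp n" "img_subspace (b * g) (L0 n) = img_subspace h (L0 n)"
    using dcoset_eq_iff[OF g h] by auto
  have bH: "b \<in> H_grp n" using b B_grp_le_H_grp by auto
  have bg: "b * g \<in> G_grp n" using G_grpD(3)[OF B_grp_G_grp[OF b(1)] g] .
  have eq: "lcoset (b * g) (PS_grp n) = lcoset h (PS_grp n)"
    using lcoset_PS_eq_iff[OF bg h] b by simp
  have "H_orbit n (lcoset (1\<^sub>m (2*n)) (B_grp n), lcoset g (PS_grp n))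
      = H_orbit n (lcoset (b * 1\<^sub>m (2*n)) (B_grp n), lcoset (b * g) (PS_grp n))"
    using H_orbit_translate[OF gc _ bH] by simp
  also have "b * 1\<^sub>m (2*n) = b" using mat_groupD(1)[OF B b(1)] by simp
  finally show "H_orbit n (B_grp n, lcoset g (PS_grp n)) = H_orbit n (B_grp n, lcoset h (PS_grp n))"
    using B1 eq lcoset_self[OF B b(1)] by simp
qed

text \<open>H is transitive on H/B_H: translating by the inverse of h brings every orbit to the
  fibre over the base point.\<close>

lemma HX_eq: "HX (Sigma_mat n) n = (\<lambda>g. H_orbit n (B_grp n, lcoset g (PS_grp n))) ` (G_grp n :: 'a :: conjugatable_field mat set)"
proof -
  note B = B_grp_mat_group[of n, where 'a = 'a] and H = H_grp_mat_group[of n, where 'a = 'a]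
  have B1: "B_grp n = lcoset (1\<^sub>m (2*n)) (B_grp n :: 'a mat set)"
    using lcoset_one[OF mat_group_subset[OF B]] by simp
  have "\<exists>g'\<in>G_grp n. H_orbit n (lcoset h (B_grp n), lcoset g (PS_grp n)) = H_orbit n (B_grp n, lcoset g' (PS_grp n))"
    if h: "h \<in> H_grp n" and g: "g \<in> G_grp n" for g h :: "'a mat"
  proof -
    obtain h' where h': "h' \<in> H_grp n" "h * h' = 1\<^sub>m (2*n)" "h' * h = 1\<^sub>m (2*n)"
      using mat_group_inverse[OF H h] .
    have "h' * g \<in> G_grp n" using G_grpD(3) H_grp_le_G_grp h'(1) g by blast
    then show ?thesis
      using H_orbit_translate[OF G_grpD(1)[OF g] mat_groupD(1)[OF H h] h'(1)] h'(3) B1 by metis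
  qed
  moreover have "(B_grp n, lcoset g (PS_grp n)) \<in> Xspace (Sigma_mat n) n" if "g \<in> G_grp n" for g :: "'a mat"
    unfolding Xspace_def using that mat_groupD(2)[OF H] B1 by blast
  ultimately show ?thesis unfolding HX_def Xspace_def by (fastforce simp: image_iff)
qed

section \<open>Hermitian matrices under upper triangular congruence\<close>

lemma index_mult_mat_sum:
  assumes "A \<in> carrier_mat n m" "B \<in> carrier_mat m k" "i < n" "j < k"
  shows "(A * B) $$ (i, j) = (\<Sum>l\<in>{0..<m}. A $$ (i, l) * B $$ (l, j))"
  using assms by (auto simp: scalar_prod_def intro!: sum.cong)

definition UT :: "nat \<Rightarrow> 'a :: field mat set" where
  "UT n = {a \<in> carrier_mat n n. upper_triangular a \<and> (\<forall>i<n. a $$ (i, i) \<noteq> 0)}"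

text \<open>Upper triangular matrices stabilize the standard flag and act on its m-th graded piece
  by the m-th diagonal entry. This makes leading positions invariant and supplies one half of the
  orbit invariants.\<close>

lemma upper_triangular_leading:
  fixes a :: "'a :: semiring_0 mat"
  assumes a: "a \<in> carrier_mat n n" "upper_triangular a" and x: "x \<in> carrier_vec n"
    and lead: "\<And>k. m < k \<Longrightarrow> k < n \<Longrightarrow> x $ k = 0"
  shows "\<And>k. m < k \<Longrightarrow> k < n \<Longrightarrow> (a *\<^sub>v x) $ k = 0"
    and "m < n \<Longrightarrow> (a *\<^sub>v x) $ m = a $$ (m, m) * x $ m"
proof -
  have eq: "(a *\<^sub>v x) $ k = (\<Sum>l\<in>{0..<n}. a $$ (k, l) * x $ l)" if "k < n" for k
    using a x that by (auto simp: scalar_prod_def intro!: sum.cong)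
  show "(a *\<^sub>v x) $ k = 0" if k: "m < k" "k < n" for k
    unfolding eq[OF k(2)]
  proof (intro sum.neutral ballI)
    fix l assume "l \<in> {0..<n}"
    then show "a $$ (k, l) * x $ l = 0"
      using k a lead[of l] upper_triangularD[of a l k] by (cases "l < k") auto
  qed
  assume m: "m < n"
  have "(a *\<^sub>v x) $ m = (\<Sum>l\<in>{0..<n}. if l = m then a $$ (m, m) * x $ m else 0)"
    unfolding eq[OF m]
  proof (intro sum.cong refl)
    fix l assume "l \<in> {0..<n}"
    then show "a $$ (m, l) * x $ l = (if l = m then a $$ (m, m) * x $ m else 0)"
      using m a lead[of l] upper_triangularD[of a l m] by (cases l m rule: linorder_cases) auto
  qed
  then show "(a *\<^sub>v x) $ m = a $$ (m, m) * x $ m" using m by simp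
qed

lemma UT_mult:
  assumes a: "a \<in> UT n" and b: "b \<in> UT n"
  shows "a * b \<in> UT n"
proof -
  have "(a * b) $$ (i, i) = a $$ (i, i) * b $$ (i, i)" if i: "i < n" for i
  proof -
    have "(a * b) $$ (i, i) = (a *\<^sub>v col b i) $ i"
      using a b i by (auto simp: UT_def)
    also have "\<dots> = a $$ (i, i) * col b i $ i"
      using a b i upper_triangularD[of b i] by (intro upper_triangular_leading) (auto simp: UT_def)
    finally show ?thesis using b i by (auto simp: UT_def)
  qed
  then show ?thesis using a b by (auto simp: UT_def upper_triangular_mult[of _ n])
qed

lemma one_UT: "1\<^sub>m n \<in> UT n"
  by (auto simp: UT_def)

section \<open>Congruence by invertible upper triangular matrices\<close>

definition congruent_UT :: "nat \<Rightarrow> 'a :: conjugatable_field mat \<Rightarrow> 'a mat \<Rightarrow> bool" where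
  "congruent_UT n S T \<longleftrightarrow> (\<exists>a\<in>UT n. T = mat_adjoint a * S * a)"

definition hermitian :: "nat \<Rightarrow> 'a :: conjugatable_field mat \<Rightarrow> bool" where
  "hermitian n S \<longleftrightarrow> S \<in> carrier_mat n n \<and> mat_adjoint S = S"

lemma hermitian_carrier: "hermitian n S \<Longrightarrow> S \<in> carrier_mat n n"
  by (simp add: hermitian_def)

lemma hermitianD:
  assumes "hermitian n S" "i < n" "j < n"
  shows "S $$ (j, i) = conjugate (S $$ (i, j))"
proof -
  have "mat_adjoint S $$ (j, i) = conjugate (S $$ (i, j))"
    using assms(2,3) hermitian_carrier[OF assms(1)] by (intro index_mat_adjoint) auto
  moreover have "mat_adjoint S = S" using assms by (simp add: hermitian_def)
  ultimately show ?thesis by simp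
qed

lemma hermitianI:
  assumes "S \<in> carrier_mat n n" "\<And>i j. i < n \<Longrightarrow> j < n \<Longrightarrow> S $$ (j, i) = conjugate (S $$ (i, j))"
  shows "hermitian n S"
proof -
  have "mat_adjoint S = S"
  proof (rule eq_matI)
    fix i j assume "i < dim_row S" "j < dim_col S"
    then show "mat_adjoint S $$ (i, j) = S $$ (i, j)" using assms(1) assms(2)[of j i] by auto
  qed (use assms(1) in auto)
  then show ?thesis using assms(1) by (simp add: hermitian_def)
qed

lemma congruent_UT_hermitian:
  assumes S: "hermitian n S" and ST: "congruent_UT n S T"
  shows "hermitian n T"
proof -
  obtain a where a: "a \<in> carrier_mat n n" "T = mat_adjoint a * S * a"
    using ST by (auto simp: congruent_UT_def UT_def)
  have Sc: "S \<in> carrier_mat n n" "mat_adjoint S = S" using S by (auto simp: hermitian_def)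
  have "mat_adjoint T = mat_adjoint a * (mat_adjoint S * mat_adjoint (mat_adjoint a))"
    unfolding a(2) using a Sc(1)
    by (simp add: mat_adjoint_mult[of _ n n] mult_carrier_square[of _ n])
  also have "\<dots> = T" unfolding a(2) using a Sc by (simp add: assoc_mult_square[of _ n])
  finally show ?thesis using a Sc by (auto simp: hermitian_def)
qed

lemma congruent_UT_refl: "S \<in> carrier_mat n n \<Longrightarrow> congruent_UT n S S"
  unfolding congruent_UT_def by (intro bexI[OF _ one_UT]) auto

lemma congruent_UT_trans:
  assumes "S \<in> carrier_mat n n" "congruent_UT n S T" "congruent_UT n T U"
  shows "congruent_UT n S U"
proof -
  obtain a b where a: "a \<in> UT n" "T = mat_adjoint a * S * a" and b: "b \<in> UT n" "U = mat_adjoint b * T * b"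
    using assms by (auto simp: congruent_UT_def)
  have c: "a \<in> carrier_mat n n" "b \<in> carrier_mat n n" using a b by (auto simp: UT_def)
  have "U = mat_adjoint (a * b) * S * (a * b)"
    unfolding a(2) b(2) using c assms(1)
    by (simp add: mat_adjoint_mult[of _ n n] mult_carrier_square[of _ n] assoc_mult_square[of _ n])
  then show ?thesis using UT_mult[OF a(1) b(1)] by (auto simp: congruent_UT_def)
qed

text \<open>Adding multiples of the \<open>r\<close>-th basis vector to later ones, on both sides.\<close>

lemma congruent_UT_row_op:
  fixes S :: "'a :: conjugatable_field mat"
  assumes S: "S \<in> carrier_mat n n" and r: "r < n" and \<alpha>: "\<And>j. j \<le> r \<Longrightarrow> \<alpha> j = 0"
  shows "congruent_UT n S (mat n n (\<lambda>(p, q). S $$ (p, q) + S $$ (p, r) * \<alpha> q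
    + conjugate (\<alpha> p) * (S $$ (r, q) + S $$ (r, r) * \<alpha> q)))" (is "congruent_UT n S ?T")
proof -
  define a where "a = mat n n (\<lambda>(i, j). (if i = j then 1 else 0) + (if i = r then \<alpha> j else 0))"
  have a: "a \<in> carrier_mat n n" by (auto simp: a_def)
  have "upper_triangular a"
    by (rule upper_triangularI) (auto simp: a_def \<alpha>)
  then have UT: "a \<in> UT n"
    using \<alpha>[of r] a by (auto simp: UT_def) (auto simp: a_def split: if_splits)
  have Sa: "(S * a) $$ (p, q) = S $$ (p, q) + S $$ (p, r) * \<alpha> q" if "p < n" "q < n" for p q
  proof -
    have "(S * a) $$ (p, q) = (\<Sum>k\<in>{0..<n}. S $$ (p, k) * ((if k = q then 1 else 0) + (if k = r then \<alpha> q else 0)))"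
      using S that by (auto simp: scalar_prod_def a_def intro!: sum.cong)
    also have "\<dots> = (\<Sum>k\<in>{0..<n}. (if k = q then S $$ (p, q) else 0) + (if k = r then S $$ (p, r) * \<alpha> q else 0))"
      by (intro sum.cong) (auto simp: algebra_simps)
    also have "\<dots> = S $$ (p, q) + S $$ (p, r) * \<alpha> q"
      using that r by (simp add: sum.distrib)
    finally show ?thesis .
  qed
  have "(mat_adjoint a * (S * a)) $$ (p, q) = ?T $$ (p, q)" if "p < n" "q < n" for p q
  proof -
    have "(mat_adjoint a * (S * a)) $$ (p, q)
        = (\<Sum>k\<in>{0..<n}. conjugate ((if k = p then 1 else 0) + (if k = r then \<alpha> p else 0)) * (S * a) $$ (k, q))"
      using S that a by (auto simp: scalar_prod_def a_def intro!: sum.cong)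
    also have "\<dots> = (\<Sum>k\<in>{0..<n}. (if k = p then (S * a) $$ (p, q) else 0)
        + (if k = r then conjugate (\<alpha> p) * (S * a) $$ (r, q) else 0))"
      by (intro sum.cong) (auto simp: conjugate_dist_add algebra_simps)
    also have "\<dots> = (S * a) $$ (p, q) + conjugate (\<alpha> p) * (S * a) $$ (r, q)"
      using that r by (simp add: sum.distrib)
    finally show ?thesis using that r by (simp add: Sa)
  qed
  then have "?T = mat_adjoint a * (S * a)"
    using a S by (intro eq_matI) auto
  also have "\<dots> = mat_adjoint a * S * a"
    using a S by (simp add: assoc_mult_square[of _ n])
  finally show ?thesis using UT by (auto simp: congruent_UT_def)
qed

text \<open>The case k = i is a lone diagonal entry, k different from i an arc, and a zero row
  counts as isolated. For a hermitian matrix the condition splits off a block of size at most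
  two.\<close>

definition isolated :: "nat \<Rightarrow> 'a :: zero mat \<Rightarrow> nat \<Rightarrow> bool" where
  "isolated n S i \<longleftrightarrow> (\<forall>k<n. S $$ (i, k) \<noteq> 0 \<longrightarrow>
     (\<forall>j<n. S $$ (i, j) \<noteq> 0 \<longrightarrow> j = k) \<and> (\<forall>j<n. S $$ (k, j) \<noteq> 0 \<longrightarrow> j = i))"

lemma isolatedD:
  assumes "isolated n S i" "k < n" "S $$ (i, k) \<noteq> 0"
  shows "j < n \<Longrightarrow> S $$ (i, j) \<noteq> 0 \<Longrightarrow> j = k" "j < n \<Longrightarrow> S $$ (k, j) \<noteq> 0 \<Longrightarrow> j = i"
  using assms by (auto simp: isolated_def)

text \<open>What has been cleared must survive later moves. With a pivot r after i, row i could
  change only through \<open>S $$ (i, r)\<close>, and the row of its partner k only through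
  \<open>S $$ (k, r)\<close>, which isolation makes zero, or through
  \<open>\<alpha> k\<close>.\<close>

lemma isolated_row_op:
  fixes S T :: "'a :: conjugatable_field mat"
  assumes i: "isolated n S i" "i < r" "r < n" "S $$ (i, r) = 0"
    and \<alpha>: "\<And>j. j \<le> r \<Longrightarrow> \<alpha> j = 0" "\<And>k. k < n \<Longrightarrow> S $$ (i, k) \<noteq> 0 \<Longrightarrow> \<alpha> k = 0"
    and T: "\<And>p q. p < n \<Longrightarrow> q < n \<Longrightarrow> T $$ (p, q) = S $$ (p, q) + S $$ (p, r) * \<alpha> q
      + conjugate (\<alpha> p) * (S $$ (r, q) + S $$ (r, r) * \<alpha> q)"
  shows "isolated n T i" "\<And>q. q < n \<Longrightarrow> T $$ (i, q) = S $$ (i, q)"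
proof -
  show row: "T $$ (i, q) = S $$ (i, q)" if "q < n" for q
    using i \<alpha>(1)[of i] that by (simp add: T)
  have partner: "T $$ (k, q) = S $$ (k, q)" if "k < n" "q < n" "S $$ (i, k) \<noteq> 0" for k q
  proof -
    have "S $$ (k, r) = 0" using isolatedD(2)[OF i(1) that(1,3), of r] i by auto
    then show ?thesis using \<alpha>(2)[OF that(1,3)] that by (simp add: T)
  qed
  show "isolated n T i"
    using i unfolding isolated_def
  proof (intro allI impI)
    fix k assume k: "k < n" "T $$ (i, k) \<noteq> 0"
    then have Sik: "S $$ (i, k) \<noteq> 0" using row by simp
    have "T $$ (i, j) = S $$ (i, j)" "T $$ (k, j) = S $$ (k, j)" if "j < n" for j
      using row[OF that] partner[OF k(1) that Sik] by auto
    then show "(\<forall>j<n. T $$ (i, j) \<noteq> 0 \<longrightarrow> j = k) \<and> (\<forall>j<n. T $$ (k, j) \<noteq> 0 \<longrightarrow> j = i)"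
      using isolatedD[OF i(1) k(1) Sik] by metis
  qed
qed

text \<open>Let k be the first column in which row m is nonzero. A move with pivot k clears the rest
  of row m; if k > m, a move with pivot m then clears row k. A pivot affects later indices only,
  which is why the first such k is taken and why the earlier rows must be isolated
  beforehand.\<close>

lemma isolate_next_row:
  fixes S :: "'a :: sign_field mat"
  assumes S: "hermitian n S" and m: "m < n" and iso: "\<And>i. i < m \<Longrightarrow> isolated n S i"
  shows "\<exists>T. congruent_UT n S T \<and> (\<forall>i\<le>m. isolated n T i)"
proof (cases "isolated n S m")
  case True
  then show ?thesis
    using iso congruent_UT_refl[OF hermitian_carrier[OF S]] le_neq_implies_less by blast
next
  case False
  note Sc = hermitian_carrier[OF S]
  define k where "k = (LEAST k. k < n \<and> S $$ (m, k) \<noteq> 0)"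
  have "\<exists>k. k < n \<and> S $$ (m, k) \<noteq> 0" using False by (auto simp: isolated_def)
  then have "k < n \<and> S $$ (m, k) \<noteq> 0" unfolding k_def by (rule LeastI_ex)
  then have k: "k < n" "S $$ (m, k) \<noteq> 0" by auto
  have small: "S $$ (m, j) = 0" if "j < k" for j
    using not_less_Least[OF that[unfolded k_def]] that k by auto
  have small': "S $$ (j, m) = 0" if "j < k" for j
    using hermitianD[OF S m, of j] small[OF that] that k by auto
  \<comment> \<open>For k < m, row k would be isolated with partner m, and then row m would be
    isolated too.\<close>
  have mk: "m \<le> k"
  proof (rule ccontr)
    assume "\<not> m \<le> k"
    then have "isolated n S k" using iso by auto
    moreover have "S $$ (k, m) \<noteq> 0" using k m hermitianD[OF S m k(1)] by auto
    ultimately have "j = k" if "j < n" "S $$ (m, j) \<noteq> 0" for j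
      using isolatedD(2)[of n S k m j] m that by auto
    moreover have "j = m" if "j < n" "S $$ (k, j) \<noteq> 0" for j
      using isolatedD(1)[OF \<open>isolated n S k\<close> m \<open>S $$ (k, m) \<noteq> 0\<close>] that by auto
    ultimately have "isolated n S m" unfolding isolated_def by metis
    then show False using False by simp
  qed
  have km0: "S $$ (k, m) \<noteq> 0" using k m hermitianD[OF S m k(1)] by auto
  \<comment> \<open>These multiples kill the entries of row m to the right of k; those to the left
    vanish by the choice of k.\<close>
  define \<alpha> where "\<alpha> j = (if k < j then - S $$ (m, j) / S $$ (m, k) else 0)" for j
  have \<alpha>0: "\<alpha> j = 0" if "j \<le> k" for j using that by (auto simp: \<alpha>_def)
  define T where "T = mat n n (\<lambda>(p, q). S $$ (p, q) + S $$ (p, k) * \<alpha> q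
    + conjugate (\<alpha> p) * (S $$ (k, q) + S $$ (k, k) * \<alpha> q))"
  have T: "T $$ (p, q) = S $$ (p, q) + S $$ (p, k) * \<alpha> q
    + conjugate (\<alpha> p) * (S $$ (k, q) + S $$ (k, k) * \<alpha> q)" if "p < n" "q < n" for p q
    using that by (simp add: T_def)
  have cT: "congruent_UT n S T" unfolding T_def by (rule congruent_UT_row_op[OF Sc k(1) \<alpha>0])
  note hT = congruent_UT_hermitian[OF S cT]
  have Tm: "T $$ (m, q) = (if q = k then S $$ (m, k) else 0)" if "q < n" for q
    using that k m mk \<alpha>0[of m] small[of q] \<alpha>0[of q]
    by (cases q k rule: linorder_cases) (auto simp: T \<alpha>_def)
  \<comment> \<open>An isolated row i < m with an entry at k would force row k to vanish outside
    column i, against \<open>S $$ (k, m) \<noteq> 0\<close>.\<close>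
  have Sik: "S $$ (i, k) = 0" if "i < m" for i
  proof (rule ccontr)
    assume "S $$ (i, k) \<noteq> 0"
    then have "m = i" using isolatedD(2)[OF iso[OF that] k(1), of m] km0 m by auto
    then show False using that by simp
  qed
  have Smk': "S $$ (m, k') = 0" if "i < m" "k' < n" "S $$ (i, k') \<noteq> 0" for i k'
  proof (rule ccontr)
    assume "S $$ (m, k') \<noteq> 0"
    then have "S $$ (k', m) \<noteq> 0" using hermitianD[OF S m that(2)] by auto
    then show False using isolatedD(2)[OF iso[OF that(1)] that(2,3), of m] m that by auto
  qed
  have isoT: "isolated n T i" and rowT: "\<And>q. q < n \<Longrightarrow> T $$ (i, q) = S $$ (i, q)" if "i < m" for i
  proof -
    have "\<alpha> k' = 0" if "k' < n" "S $$ (i, k') \<noteq> 0" for k'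
      using Smk'[OF \<open>i < m\<close> that] by (auto simp: \<alpha>_def)
    then show "isolated n T i" "\<And>q. q < n \<Longrightarrow> T $$ (i, q) = S $$ (i, q)"
      using isolated_row_op[OF iso[OF that] _ k(1) Sik[OF that] \<alpha>0 _ T] that mk by auto
  qed
  show ?thesis
  proof (cases "k = m")
    case True
    have "isolated n T m" unfolding isolated_def using Tm True by auto
    then show ?thesis using cT isoT le_neq_implies_less by blast
  next
    case False
    then have mlk: "m < k" using mk by simp
    have Tkm: "T $$ (k, m) \<noteq> 0" "T $$ (k, m) = conjugate (T $$ (m, k))"
      using hermitianD[OF hT m k(1)] Tm[OF k(1)] k by auto
    have Tmm: "T $$ (m, m) = 0" using Tm[OF m] mlk by simp
    have Tpm: "T $$ (p, m) = (if p = k then T $$ (k, m) else 0)" if "p < n" for p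
      using hermitianD[OF hT m that] Tm[OF that] by auto
    \<comment> \<open>The diagonal entry (k, k) is corrected from both sides, hence the factor 2 in
      the denominator there. Columns before m need no correction: the isolated rows before m have no
      entry at k.\<close>
    define \<beta> where "\<beta> j = (if m < j then if j = k then - T $$ (k, k) / (2 * T $$ (k, m))
      else - T $$ (k, j) / T $$ (k, m) else 0)" for j
    have \<beta>0: "\<beta> j = 0" if "j \<le> m" for j using that by (auto simp: \<beta>_def)
    define U where "U = mat n n (\<lambda>(p, q). T $$ (p, q) + T $$ (p, m) * \<beta> q
      + conjugate (\<beta> p) * (T $$ (m, q) + T $$ (m, m) * \<beta> q))"
    have U: "U $$ (p, q) = T $$ (p, q) + T $$ (p, m) * \<beta> q
      + conjugate (\<beta> p) * (T $$ (m, q) + T $$ (m, m) * \<beta> q)" if "p < n" "q < n" for p q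
      using that by (simp add: U_def)
    have cU: "congruent_UT n T U"
      unfolding U_def by (rule congruent_UT_row_op[OF hermitian_carrier[OF hT] m \<beta>0])
    have Um: "U $$ (m, q) = (if q = k then T $$ (m, k) else 0)" if "q < n" for q
      using that m k Tm[OF that] Tm[OF k(1)] \<beta>0[of m] by (auto simp: U Tmm)
    have Tik: "T $$ (i, k) = 0" if "i < m" for i using rowT[OF that] Sik[OF that] k by simp
    have Uk: "U $$ (k, q) = 0" if "q < n" "q \<noteq> m" for q
    proof (cases "q = k")
      case True
      have "conjugate (T $$ (k, k)) = T $$ (k, k)" using hermitianD[OF hT k(1) k(1)] by simp
      then have "conjugate (\<beta> k) * T $$ (m, k) = - T $$ (k, k) / 2"
      proof -
        have "conjugate (\<beta> k) * T $$ (m, k) = conjugate (\<beta> k * T $$ (k, m))"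
          using Tkm(2) by (simp add: conjugate_dist_mul)
        also have "\<beta> k * T $$ (k, m) = - T $$ (k, k) / 2"
          using Tkm(1) mlk by (simp add: \<beta>_def)
        also have "conjugate (- T $$ (k, k) / 2) = - T $$ (k, k) / 2"
        proof -
          have two: "conjugate (2::'a) = 2"
            using conjugate_dist_add[of "1::'a" 1] by simp
          have "conjugate (- T $$ (k, k) / 2) * 2 = - T $$ (k, k)"
            using \<open>conjugate (T $$ (k, k)) = T $$ (k, k)\<close> two_neq_zero[where 'a = 'a]
            by (metis conjugate_dist_mul conjugate_neg nonzero_eq_divide_eq two)
          then show ?thesis by (metis nonzero_eq_divide_eq two_neq_zero)
        qed
        finally show ?thesis .
      qed
      moreover have "T $$ (k, m) * \<beta> k = - T $$ (k, k) / 2" using Tkm(1) mlk by (simp add: \<beta>_def)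
      moreover have "T $$ (k, k) = T $$ (k, k) / 2 + T $$ (k, k) / 2"
        using two_neq_zero[where 'a = 'a] by (simp flip: mult_2_right add: field_simps)
      ultimately show ?thesis using True k by (simp add: U Tmm)
    next
      case qk: False
      show ?thesis
      proof (cases "q < m")
        case True
        then show ?thesis
          using Tik[OF True] hermitianD[OF hT that(1) k(1)] \<beta>0[of q] Tm[OF that(1)] that qk k
          by (simp add: U Tmm)
      next
        case False
        then show ?thesis using that qk k Tm[OF that(1)] Tkm(1) by (simp add: U Tmm \<beta>_def)
      qed
    qed
    have "isolated n U m"
      unfolding isolated_def
    proof (intro allI impI)
      fix k' assume "k' < n" "U $$ (m, k') \<noteq> 0"
      then have "k' = k" using Um by (auto split: if_splits)
      then show "(\<forall>j<n. U $$ (m, j) \<noteq> 0 \<longrightarrow> j = k') \<and> (\<forall>j<n. U $$ (k', j) \<noteq> 0 \<longrightarrow> j = m)"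
        using Um Uk by (metis (full_types))
    qed
    moreover have "isolated n U i" if i: "i < m" for i
    proof (rule isolated_row_op(1)[OF isoT[OF i] i m _ \<beta>0 _ U])
      show "T $$ (i, m) = 0" using Tpm[of i] i m mlk by auto
      fix k' assume k': "k' < n" "T $$ (i, k') \<noteq> 0"
      have "T $$ (k', k) = 0" using isolatedD(2)[OF isoT[OF i] k', of k] k i mlk by auto
      then have "T $$ (k, k') = 0" using hermitianD[OF hT k'(1) k(1)] by simp
      moreover have "k' \<noteq> k" using k' Tik[OF i] by auto
      ultimately show "\<beta> k' = 0" by (auto simp: \<beta>_def)
    qed
    ultimately show ?thesis
      using congruent_UT_trans[OF Sc cT cU] le_neq_implies_less by blast
  qed
qed

lemma congruent_UT_isolated:
  fixes S :: "'a :: sign_field mat"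
  assumes S: "hermitian n S"
  shows "\<exists>T. congruent_UT n S T \<and> (\<forall>i<n. isolated n T i)"
proof -
  have "\<exists>T. congruent_UT n S T \<and> (\<forall>i<m. isolated n T i)" if "m \<le> n" for m
    using that
  proof (induction m)
    case 0
    show ?case using congruent_UT_refl[OF hermitian_carrier[OF S]] by auto
  next
    case (Suc m)
    then obtain T where T: "congruent_UT n S T" "\<forall>i<m. isolated n T i" by auto
    with isolate_next_row[OF congruent_UT_hermitian[OF S T(1)], of m] Suc.prems
    obtain U where "congruent_UT n T U" "\<forall>i\<le>m. isolated n U i" by auto
    then show ?case
      using congruent_UT_trans[OF hermitian_carrier[OF S] T(1)] by (auto simp: less_Suc_eq_le)
  qed
  then show ?thesis by auto
qed

text \<open>The matrix of a signed involution. An off-diagonal entry can be rescaled through one of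
  its ends alone and becomes 1, whereas a diagonal entry changes only by a norm and keeps its
  sign.\<close>

definition normal_form :: "nat \<Rightarrow> 'a :: ring_1 mat \<Rightarrow> bool" where
  "normal_form n T \<longleftrightarrow> T \<in> carrier_mat n n \<and> (\<forall>i<n. isolated n T i) \<and>
    (\<forall>i<n. T $$ (i, i) \<in> {0, 1, - 1}) \<and>
    (\<forall>i<n. \<forall>j<n. i \<noteq> j \<longrightarrow> T $$ (i, j) \<in> {0, 1} \<and> T $$ (i, j) = T $$ (j, i))"

lemma congruent_UT_normal_form:
  fixes S :: "'a :: sign_field mat"
  assumes S: "hermitian n S"
  shows "\<exists>T. congruent_UT n S T \<and> normal_form n T"
proof -
  obtain T where ST: "congruent_UT n S T" and iso: "\<forall>i<n. isolated n T i"
    using congruent_UT_isolated[OF S] by auto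
  note hT = congruent_UT_hermitian[OF S ST]
  note Tc = hermitian_carrier[OF hT]
  \<comment> \<open>\<open>t\<close> is the scale of the i-th basis vector. A lone diagonal entry is
    normalised by a norm; on an arc only the later end is scaled, by the inverse of the entry, and
    the earlier end keeps t = 1.\<close>
  define P where "P i t \<longleftrightarrow> t \<noteq> 0 \<and>
     (T $$ (i, i) \<noteq> 0 \<longrightarrow> conjugate t * T $$ (i, i) * t \<in> {1, - 1}) \<and>
     (\<forall>k<n. k < i \<and> T $$ (k, i) \<noteq> 0 \<longrightarrow> T $$ (k, i) * t = 1) \<and>
     (\<forall>k<n. i < k \<and> T $$ (k, i) \<noteq> 0 \<longrightarrow> t = 1)" for i t
  have uniq: "k = l" if "i < n" "k < n" "l < n" "T $$ (k, i) \<noteq> 0" "T $$ (l, i) \<noteq> 0" for i k l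
    using isolatedD(2)[of n T k i l] hermitianD[OF hT that(3,1)] iso that by auto
  have "\<exists>t. P i t" if i: "i < n" for i
  proof (cases "\<exists>k<n. T $$ (k, i) \<noteq> 0")
    case False
    then show ?thesis using i by (intro exI[of _ 1]) (auto simp: P_def)
  next
    case True
    then obtain k where k: "k < n" "T $$ (k, i) \<noteq> 0" by auto
    have only: "l = k" if "l < n" "T $$ (l, i) \<noteq> 0" for l
      using uniq[OF i that(1) k(1) that(2) k(2)] .
    show ?thesis
    proof (cases i k rule: linorder_cases)
      case less
      then have "P i 1" unfolding P_def using only[OF i] only by fastforce
      then show ?thesis by blast
    next
      case greater
      have "T $$ (i, i) = 0" using only[OF i] greater by auto
      moreover have "T $$ (l, i) = 0" if "l < n" "i < l" for l
        by (rule ccontr) (use only[OF that(1)] that greater in auto)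
      moreover have "T $$ (l, i) * (1 / T $$ (k, i)) = 1" if "l < n" "T $$ (l, i) \<noteq> 0" for l
        using only[OF that] k by simp
      ultimately have "P i (1 / T $$ (k, i))" unfolding P_def using k by (metis divide_eq_0_iff one_neq_zero)
      then show ?thesis by blast
    next
      case equal
      then obtain t where t: "conjugate t * T $$ (i, i) * t = 1 \<or> conjugate t * T $$ (i, i) * t = - 1"
        using ex_normalizer[of "T $$ (i, i)"] hermitianD[OF hT i i] k by auto
      then have "t \<noteq> 0" by auto
      then have "P i t" unfolding P_def using only t equal by fastforce
      then show ?thesis by blast
    qed
  qed
  then obtain t where t: "\<And>i. i < n \<Longrightarrow> P i (t i)" by metis
  define a where "a = mat n n (\<lambda>(i, j). if i = j then t i else 0)"
  have a: "a \<in> carrier_mat n n" by (simp add: a_def)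
  have UT: "a \<in> UT n" using t by (auto simp: a_def UT_def P_def intro!: upper_triangularI)
  define U where "U = mat_adjoint a * T * a"
  have cU: "congruent_UT n T U" using UT by (auto simp: U_def congruent_UT_def)
  have TA: "(T * a) $$ (i, j) = T $$ (i, j) * t j" if "i < n" "j < n" for i j
  proof -
    have "(T * a) $$ (i, j) = (\<Sum>k\<in>{0..<n}. T $$ (i, k) * (if k = j then t k else 0))"
      using Tc that by (simp add: scalar_prod_def a_def)
    also have "\<dots> = (\<Sum>k\<in>{0..<n}. if k = j then T $$ (i, j) * t j else 0)"
      by (intro sum.cong) auto
    finally show ?thesis using that by simp
  qed
  have U: "U $$ (i, j) = conjugate (t i) * T $$ (i, j) * t j" if "i < n" "j < n" for i j
  proof -
    have "U $$ (i, j) = (mat_adjoint a * (T * a)) $$ (i, j)"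
      unfolding U_def using a Tc by (simp add: assoc_mult_square[of _ n])
    also have "\<dots> = (\<Sum>k\<in>{0..<n}. conjugate (if k = i then t k else 0) * (T * a) $$ (k, j))"
      using that a Tc
      by (subst index_mult_mat_sum[of _ n n _ n]) (auto simp: a_def mult_carrier_square intro!: sum.cong)
    also have "\<dots> = (\<Sum>k\<in>{0..<n}. if k = i then conjugate (t i) * (T * a) $$ (i, j) else 0)"
      by (intro sum.cong) auto
    finally show ?thesis using that by (simp add: TA mult.assoc)
  qed
  have nz: "U $$ (i, j) \<noteq> 0 \<longleftrightarrow> T $$ (i, j) \<noteq> 0" if "i < n" "j < n" for i j
    using U[OF that] t[OF that(1)] t[OF that(2)] by (auto simp: P_def)
  have "isolated n U i" if "i < n" for i
    using iso that unfolding isolated_def by (auto simp: nz)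
  moreover have "U $$ (i, i) \<in> {0, 1, - 1}" if "i < n" for i
    using t[OF that] U[OF that that] by (cases "T $$ (i, i) = 0") (auto simp: P_def)
  moreover have off: "U $$ (i, j) \<in> {0, 1}" if "i < n" "j < n" "i < j" for i j
  proof (cases "T $$ (i, j) = 0")
    case False
    have "T $$ (j, i) \<noteq> 0" using hermitianD[OF hT that(1,2)] False by simp
    then have "t i = 1" "T $$ (i, j) * t j = 1" using t[OF that(1)] t[OF that(2)] that False
      by (auto simp: P_def)
    then show ?thesis using U[OF that(1,2)] by simp
  qed (simp add: U that)
  have off': "U $$ (j, i) = U $$ (i, j)" if "i < n" "j < n" "i < j" for i j
    using off[OF that] hermitianD[OF congruent_UT_hermitian[OF hT cU] that(1,2)] by auto
  ultimately have "normal_form n U"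
    unfolding normal_form_def using a Tc off off' by (auto simp: U_def) (metis linorder_neqE_nat)+
  then show ?thesis using congruent_UT_trans[OF hermitian_carrier[OF S] ST cU] by auto
qed

section \<open>Lagrangian subspaces\<close>

text \<open>One equation from which isotropy, maximality and closure under linear combinations are
  all derived.\<close>

definition lagrangian :: "nat \<Rightarrow> 'a :: conjugatable_field vec set \<Rightarrow> bool" where
  "lagrangian n W \<longleftrightarrow> W = {v \<in> carrier_vec (2*n). \<forall>u\<in>W. skew u v = 0}"

lemma lagrangian_carrier: "lagrangian n W \<Longrightarrow> w \<in> W \<Longrightarrow> w \<in> carrier_vec (2*n)"
  by (auto simp: lagrangian_def)

lemma lagrangianI:
  "lagrangian n W \<Longrightarrow> v \<in> carrier_vec (2*n) \<Longrightarrow> (\<And>u. u \<in> W \<Longrightarrow> skew u v = 0) \<Longrightarrow> v \<in> W"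
  by (auto simp: lagrangian_def)

lemma lagrangianD: "lagrangian n W \<Longrightarrow> u \<in> W \<Longrightarrow> v \<in> W \<Longrightarrow> skew u v = 0"
  by (auto simp: lagrangian_def)

lemma skew_lincomb:
  assumes "u \<in> carrier_vec (2*n)" "v \<in> carrier_vec (2*n)" "w \<in> carrier_vec (2*n)"
  shows "skew u (v + c \<cdot>\<^sub>v w) = skew u v + c * skew u w"
proof -
  let ?S = "Sigma_mat n"
  have "skew u (v + c \<cdot>\<^sub>v w) = (?S *\<^sub>v v + c \<cdot>\<^sub>v (?S *\<^sub>v w)) \<bullet>c u"
    using assms Sigma_mat_carrier[of n]
    by (simp add: skew_def mult_add_distrib_mat_vec[of _ "2*n" "2*n"] mult_mat_vec[of _ "2*n" "2*n"])
  also have "\<dots> = (?S *\<^sub>v v) \<bullet>c u + (c \<cdot>\<^sub>v (?S *\<^sub>v w)) \<bullet>c u"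
    using assms mult_mat_vec_carrier[OF Sigma_mat_carrier[of n]]
    by (intro add_scalar_prod_distrib[of _ "2*n"]) auto
  also have "\<dots> = skew u v + c * skew u w"
    using assms mult_mat_vec_carrier[OF Sigma_mat_carrier[of n]] by (simp add: skew_def)
  finally show ?thesis .
qed

lemma lagrangian_lincomb:
  assumes W: "lagrangian n W" and v: "v \<in> W" and w: "w \<in> W"
  shows "v + c \<cdot>\<^sub>v w \<in> W"
  using lagrangian_carrier[OF W] v w lagrangianD[OF W]
  by (intro lagrangianI[OF W]) (auto simp: skew_lincomb[of _ n])

lemma lagrangian_append_lincomb:
  assumes W: "lagrangian n W" and v: "x @\<^sub>v y \<in> W" and w: "x' @\<^sub>v y' \<in> W"
    and c: "x \<in> carrier_vec n" "y \<in> carrier_vec n" "x' \<in> carrier_vec n" "y' \<in> carrier_vec n"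
  shows "(x + c \<cdot>\<^sub>v x') @\<^sub>v (y + c \<cdot>\<^sub>v y') \<in> W"
proof -
  have "(x + c \<cdot>\<^sub>v x') @\<^sub>v (y + c \<cdot>\<^sub>v y') = (x @\<^sub>v y) + c \<cdot>\<^sub>v (x' @\<^sub>v y')"
    using c by (intro eq_vecI) auto
  then show ?thesis using lagrangian_lincomb[OF W v w] by simp
qed

lemma conjugate_unit_vec [simp]:
  "conjugate (unit_vec n i :: 'a :: conjugatable_field vec) = unit_vec n i"
  by (intro eq_vecI) (auto simp: unit_vec_def)

text \<open>Pairing with the unit vectors of the first summand forces every coordinate of the second
  component to vanish.\<close>

lemma lagrangian_L0: "lagrangian n (L0 n :: 'a :: conjugatable_field vec set)"
proof -
  have L0: "x @\<^sub>v y \<in> L0 n \<longleftrightarrow> y = 0\<^sub>v n"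
    if "x \<in> carrier_vec n" "y \<in> carrier_vec n" for x y :: "'a vec"
  proof
    assume "x @\<^sub>v y \<in> L0 n"
    then have "(x @\<^sub>v y) $ (n + i) = 0" if "i < n" for i using that by (auto simp: L0_def)
    then show "y = 0\<^sub>v n" using that by (intro eq_vecI) auto
  qed (use that in \<open>auto simp: L0_def\<close>)
  have "v \<in> L0 n \<longleftrightarrow> (\<forall>u\<in>L0 n. skew u v = 0)" if v: "v \<in> carrier_vec (2*n)" for v :: "'a vec"
  proof -
    obtain x y where xy: "x \<in> carrier_vec n" "y \<in> carrier_vec n" "v = x @\<^sub>v y"
      using append_vec_cases[OF v] .
    have "skew u v = 0" if y0: "y = 0\<^sub>v n" and u: "u \<in> L0 n" for u
    proof -
      obtain a b where ab: "a \<in> carrier_vec n" "b \<in> carrier_vec n" "u = a @\<^sub>v b"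
        using append_vec_cases[of u n] u by (auto simp: L0_def)
      then have "b = 0\<^sub>v n" using L0 u by blast
      then show ?thesis using ab xy y0 by (simp add: skew_append[of _ n])
    qed
    moreover have "y = 0\<^sub>v n" if "\<forall>u\<in>L0 n. skew u v = 0"
    proof (intro eq_vecI)
      fix i assume i: "i < dim_vec (0\<^sub>v n :: 'a vec)"
      have "unit_vec n i @\<^sub>v 0\<^sub>v n \<in> (L0 n :: 'a vec set)"
        using L0[of "unit_vec n i" "0\<^sub>v n"] by simp
      then have "skew (unit_vec n i @\<^sub>v 0\<^sub>v n) v = 0" using that by blast
      then show "y $ i = 0\<^sub>v n $ i" using xy i by (simp add: skew_append[of _ n])
    qed (use xy in auto)
    ultimately show ?thesis using L0[OF xy(1,2)] xy(3) by blast
  qed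
  then show ?thesis unfolding lagrangian_def using L0_carrier[of n] by blast
qed

lemma lagrangian_img:
  fixes g :: "'a :: conjugatable_field mat"
  assumes W: "lagrangian n W" and g: "g \<in> G_grp n"
  shows "lagrangian n (img_subspace g W)"
proof -
  note gc = G_grpD(1)[OF g]
  obtain h where h: "h \<in> G_grp n" "g * h = 1\<^sub>m (2*n)" "h * g = 1\<^sub>m (2*n)"
    using mat_group_inverse[OF isom_grp_mat_group g] .
  note hc = G_grpD(1)[OF h(1)]
  have "v \<in> img_subspace g W \<longleftrightarrow> (\<forall>u\<in>img_subspace g W. skew u v = 0)" if v: "v \<in> carrier_vec (2*n)" for v
  proof
    assume "v \<in> img_subspace g W"
    then show "\<forall>u\<in>img_subspace g W. skew u v = 0"
      using lagrangian_carrier[OF W] lagrangianD[OF W]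
      by (auto simp: img_subspace_def skew_isom[OF g])
  next
    assume *: "\<forall>u\<in>img_subspace g W. skew u v = 0"
    have ghv: "g *\<^sub>v (h *\<^sub>v v) = v"
      using assoc_mult_mat_vec[OF gc hc v] h(2) v by simp
    have "h *\<^sub>v v \<in> W"
    proof (rule lagrangianI[OF W])
      show "h *\<^sub>v v \<in> carrier_vec (2*n)" using hc v by simp
      fix u assume u: "u \<in> W"
      have "skew u (h *\<^sub>v v) = skew (g *\<^sub>v u) (g *\<^sub>v (h *\<^sub>v v))"
        using skew_isom[OF g lagrangian_carrier[OF W u], of "h *\<^sub>v v"] hc v by simp
      then show "skew u (h *\<^sub>v v) = 0" using * u ghv by (auto simp: img_subspace_def)
    qed
    then show "v \<in> img_subspace g W" using ghv unfolding img_subspace_def by (metis imageI)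
  qed
  moreover have "img_subspace g W \<subseteq> carrier_vec (2*n)"
    using lagrangian_carrier[OF W] gc by (intro img_subspace_carrier) auto
  ultimately show ?thesis unfolding lagrangian_def by blast
qed

section \<open>Coordinate projections and column spaces in coordinates\<close>

definition coord_proj :: "nat \<Rightarrow> nat set \<Rightarrow> 'a :: zero_neq_one mat" where
  "coord_proj n I = mat n n (\<lambda>(i, j). if i = j \<and> i \<in> I then 1 else 0)"

lemma coord_proj_carrier [simp]: "coord_proj n I \<in> carrier_mat n n"
  by (simp add: coord_proj_def)

lemma dim_coord_proj [simp]:
  "dim_row (coord_proj n I) = n" "dim_col (coord_proj n I) = n"
  by (simp_all add: coord_proj_def)

lemma coord_proj_index [simp]:
  "i < n \<Longrightarrow> j < n \<Longrightarrow> coord_proj n I $$ (i, j) = (if i = j \<and> i \<in> I then 1 else 0)"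
  by (simp add: coord_proj_def)

lemma index_mult_mat_vec_sum:
  assumes "A \<in> carrier_mat n m" "v \<in> carrier_vec m" "i < n"
  shows "(A *\<^sub>v v) $ i = (\<Sum>l\<in>{0..<m}. A $$ (i, l) * v $ l)"
  using assms by (auto simp: scalar_prod_def intro!: sum.cong)

lemma coord_proj_mult_vec [simp]:
  fixes v :: "'a :: semiring_1 vec"
  assumes v: "v \<in> carrier_vec n" and i: "i < n"
  shows "(coord_proj n I *\<^sub>v v) $ i = (if i \<in> I then v $ i else 0)"
proof -
  have "(coord_proj n I *\<^sub>v v) $ i = (\<Sum>l\<in>{0..<n}. if l = i then if i \<in> I then v $ i else 0 else 0)"
    unfolding index_mult_mat_vec_sum[OF coord_proj_carrier v i] using i by (intro sum.cong) auto
  then show ?thesis using i by simp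
qed

text \<open>The column space of the block column with \<open>A\<close> above \<open>M\<close>, kept
  as two square blocks so that block diagonal matrices act on each separately.\<close>

definition pair_space :: "nat \<Rightarrow> 'a :: semiring_0 mat \<Rightarrow> 'a mat \<Rightarrow> 'a vec set" where
  "pair_space n A M = {(A *\<^sub>v v) @\<^sub>v (M *\<^sub>v v) | v. v \<in> carrier_vec n}"

definition supported :: "nat \<Rightarrow> nat set \<Rightarrow> 'a :: zero mat \<Rightarrow> bool" where
  "supported n I S \<longleftrightarrow> (\<forall>i<n. \<forall>j<n. S $$ (i, j) \<noteq> 0 \<longrightarrow> i \<in> I \<and> j \<in> I)"

lemma supported_mult_vec:
  assumes "S \<in> carrier_mat n n" "supported n I S" "v \<in> carrier_vec n" "i < n" "i \<notin> I"
  shows "(S *\<^sub>v v) $ i = 0"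
  unfolding index_mult_mat_vec_sum[OF assms(1,3,4)]
  using assms by (intro sum.neutral) (auto simp: supported_def)

lemma cscalar_prod_unit_vec:
  fixes y :: "'a :: conjugatable_field vec"
  assumes "y \<in> carrier_vec n" "i < n"
  shows "y \<bullet>c unit_vec n i = y $ i"
  using assms by simp

text \<open>
  The leading positions of the first components of \<open>W\<close> give the index set \<open>I\<close>. After moving
  the corresponding vectors to unit vectors, maximality of \<open>W\<close> puts all of \<open>0 \<oplus> K\<^bsup>-I\<^esup>\<close>
  into \<open>W\<close>, and isotropy makes the remaining coordinates a hermitian function of \<open>x\<close>.
\<close>

lemma lagrangian_coordinates:
  fixes W :: "'a :: conjugatable_field vec set"
  assumes W: "lagrangian n W"
  shows "\<exists>b\<in>B_grp n. \<exists>I S. hermitian n S \<and> supported n I S \<and>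
    img_subspace b W = pair_space n (coord_proj n I) (S + coord_proj n (- I))"
proof -
  \<comment> \<open>The leading position is the last nonzero index, because this is what upper
    triangular matrices preserve.\<close>
  define lead where "lead i u y \<longleftrightarrow> u \<in> carrier_vec n \<and> y \<in> carrier_vec n \<and> u @\<^sub>v y \<in> W \<and>
    u $ i = 1 \<and> (\<forall>k. i < k \<and> k < n \<longrightarrow> u $ k = 0)" for i u y
  define I where "I = {i. i < n \<and> (\<exists>u y. lead i u y)}"
  have "\<exists>u y. i \<in> I \<longrightarrow> lead i u y" for i by (auto simp: I_def)
  then obtain u y where uy: "\<And>i. i \<in> I \<Longrightarrow> lead i (u i) (y i)" by metis
  have zero: "0\<^sub>v n @\<^sub>v 0\<^sub>v n \<in> W"
  proof (rule lagrangianI[OF W])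
    fix p assume "p \<in> W"
    then obtain x z where "x \<in> carrier_vec n" "z \<in> carrier_vec n" "p = x @\<^sub>v z"
      using append_vec_cases lagrangian_carrier[OF W] by metis
    then show "skew p (0\<^sub>v n @\<^sub>v 0\<^sub>v n) = 0" by (simp add: skew_append[of _ n])
  qed simp
  have leadI: "m \<in> I" if "x @\<^sub>v z \<in> W" "x \<in> carrier_vec n" "z \<in> carrier_vec n" "m < n" "x $ m \<noteq> 0"
    "\<And>k. m < k \<Longrightarrow> k < n \<Longrightarrow> x $ k = 0" for x z m
  proof -
    have "lead m (0\<^sub>v n + (1 / x $ m) \<cdot>\<^sub>v x) (0\<^sub>v n + (1 / x $ m) \<cdot>\<^sub>v z)"
      unfolding lead_def using that lagrangian_append_lincomb[OF W zero that(1)] by auto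
    then show ?thesis using that by (auto simp: I_def)
  qed
  \<comment> \<open>Unipotent upper triangular, with the chosen vectors u_j as columns for j in I.
    Its inverse c carries u_i to the i-th unit vector.\<close>
  define a where "a = mat n n (\<lambda>(i, j). if j \<in> I then u j $ i else if i = j then 1 else 0)"
  have a: "a \<in> carrier_mat n n" "upper_triangular a" "\<And>i. i < n \<Longrightarrow> a $$ (i, i) = 1"
    using uy by (auto simp: a_def lead_def I_def intro!: upper_triangularI)
  obtain c where c: "c \<in> carrier_mat n n" "a * c = 1\<^sub>m n" "c * a = 1\<^sub>m n" "upper_triangular c"
    using obtain_inverse_upper_triangular[OF a(1,2)] a(3) by auto
  define d where "d = mat_adjoint a"
  have d: "d \<in> carrier_mat n n" using a by (simp add: d_def)
  have cd: "mat_adjoint c * d = 1\<^sub>m n"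
    unfolding d_def using mat_adjoint_mult[OF a(1) c(1)] c(2) by simp
  define b where "b = bdiag n c d"
  have b: "b \<in> B_grp n" unfolding b_def using c d cd by (intro B_grpI)
  define V where "V = img_subspace b W"
  have V: "lagrangian n V" unfolding V_def by (rule lagrangian_img[OF W B_grp_G_grp[OF b]])
  have VI: "(c *\<^sub>v x) @\<^sub>v (d *\<^sub>v z) \<in> V" if "x @\<^sub>v z \<in> W" "x \<in> carrier_vec n" "z \<in> carrier_vec n" for x z
    using that bdiag_mult_append[OF c(1) d that(2,3)] unfolding V_def b_def img_subspace_def by (metis imageI)
  have cu: "c *\<^sub>v u i = unit_vec n i" if i: "i \<in> I" for i
  proof -
    have "u i = a *\<^sub>v unit_vec n i"
    proof (rule eq_vecI)
      fix k assume k: "k < dim_vec (a *\<^sub>v unit_vec n i)"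
      then show "u i $ k = (a *\<^sub>v unit_vec n i) $ k"
        using i a(1) by (auto simp: a_def I_def)
    qed (use uy[OF i] a in \<open>auto simp: lead_def\<close>)
    then have "c *\<^sub>v u i = (c * a) *\<^sub>v unit_vec n i"
      using assoc_mult_mat_vec[OF c(1) a(1), of "unit_vec n i"] by simp
    then show ?thesis using c by simp
  qed
  have unitV: "unit_vec n i @\<^sub>v (d *\<^sub>v y i) \<in> V" if "i \<in> I" for i
    using VI[of "u i" "y i"] uy[OF that] cu[OF that] by (auto simp: lead_def)
  \<comment> \<open>The matrix c is triangular and preserves leading positions, so I describes those
    of V as well.\<close>
  have leadV: "m \<in> I" if xz: "x @\<^sub>v z \<in> V" "x \<in> carrier_vec n" "z \<in> carrier_vec n" and m: "m < n" "x $ m \<noteq> 0"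
    "\<And>k. m < k \<Longrightarrow> k < n \<Longrightarrow> x $ k = 0" for x z m
  proof -
    obtain w where w: "w \<in> W" "x @\<^sub>v z = b *\<^sub>v w" using xz by (auto simp: V_def img_subspace_def)
    obtain x0 z0 where x0: "x0 \<in> carrier_vec n" "z0 \<in> carrier_vec n" "w = x0 @\<^sub>v z0"
      using append_vec_cases[OF lagrangian_carrier[OF W w(1)]] .
    have "x = c *\<^sub>v x0"
      using w(2) bdiag_mult_append[OF c(1) d x0(1,2)]
        append_vec_eq[OF xz(2) mult_mat_vec_carrier[OF c(1) x0(1)]]
      by (simp add: b_def x0(3))
    then have "x0 = a *\<^sub>v x" using assoc_mult_mat_vec[OF a(1) c(1) x0(1)] c x0 by simp
    then have "x0 $ m \<noteq> 0" "\<And>k. m < k \<Longrightarrow> k < n \<Longrightarrow> x0 $ k = 0"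
      using upper_triangular_leading[OF a(1,2) xz(2) m(3)] m a(3) by auto
    then show ?thesis using leadI[of x0 z0 m] w(1) x0 m by auto
  qed
  \<comment> \<open>Descending elimination: a leading position m of x lies in I and is removed with
    a multiple of the vector over the m-th unit vector. The coordinate j outside I is not touched,
    yet it is 0 in the end.\<close>
  have supp: "x $ j = 0"
    if "x @\<^sub>v z \<in> V" "x \<in> carrier_vec n" "z \<in> carrier_vec n" "j < n" "j \<notin> I" for x z j
  proof -
    have "m \<le> n \<Longrightarrow> x @\<^sub>v z \<in> V \<Longrightarrow> x \<in> carrier_vec n \<Longrightarrow> z \<in> carrier_vec n \<Longrightarrow>
      (\<And>k. m \<le> k \<Longrightarrow> k < n \<Longrightarrow> x $ k = 0) \<Longrightarrow> x $ j = 0" for m x z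
    proof (induction m arbitrary: x z)
      case 0
      then show ?case using \<open>j < n\<close> by simp
    next
      case (Suc m)
      show ?case
      proof (cases "x $ m = 0")
        case True
        then have "x $ k = 0" if "m \<le> k" "k < n" for k
          using Suc.prems(5)[of k] that by (cases "k = m") auto
        then show ?thesis using Suc.IH[OF _ Suc.prems(2-4)] Suc.prems(1) by auto
      next
        case False
        then have m: "m \<in> I" using leadV[OF Suc.prems(2-4)] Suc.prems by auto
        let ?x = "x + (- x $ m) \<cdot>\<^sub>v unit_vec n m" and ?z = "z + (- x $ m) \<cdot>\<^sub>v (d *\<^sub>v y m)"
        have dy: "d *\<^sub>v y m \<in> carrier_vec n" using d uy[OF m] by (auto simp: lead_def)
        have "?x @\<^sub>v ?z \<in> V"
          using Suc.prems dy by (intro lagrangian_append_lincomb[OF V Suc.prems(2) unitV[OF m]]) auto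
        have "?x $ k = 0" if "m \<le> k" "k < n" for k
          using Suc.prems(1,3) Suc.prems(5)[of k] that by (cases "k = m") auto
        have "?x $ j = 0"
          by (rule Suc.IH[OF _ \<open>?x @\<^sub>v ?z \<in> V\<close>]) (fact | use Suc.prems(1,3,4) dy in simp)+
        moreover have "j \<noteq> m" using m \<open>j \<notin> I\<close> by auto
        ultimately show ?thesis using Suc.prems(1,3) \<open>j < n\<close> by simp
      qed
    qed
    from this[of n x z] that show ?thesis by auto
  qed
  define S where "S = mat n n (\<lambda>(k, i). if k \<in> I \<and> i \<in> I then (d *\<^sub>v y i) $ k else 0)"
  have S: "S \<in> carrier_mat n n" "supported n I S" by (auto simp: S_def supported_def)
  \<comment> \<open>First components of V vanish outside I, so truncating the second component to I
    does not change the pairing with V, and maximality admits the truncated vector.\<close>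
  have sV: "unit_vec n i @\<^sub>v col S i \<in> V" if i: "i \<in> I" for i
  proof (rule lagrangianI[OF V])
    have iN: "i < n" using i by (auto simp: I_def)
    show "unit_vec n i @\<^sub>v col S i \<in> carrier_vec (2*n)"
      using S(1) iN by (intro append_vec_carrier) auto
    fix p assume p: "p \<in> V"
    obtain x z where xz: "x \<in> carrier_vec n" "z \<in> carrier_vec n" "p = x @\<^sub>v z"
      using append_vec_cases[OF lagrangian_carrier[OF V p]] .
    have dy: "d *\<^sub>v y i \<in> carrier_vec n" using d uy[OF i] by (auto simp: lead_def)
    have "col S i \<bullet>c x = (d *\<^sub>v y i) \<bullet>c x"
      using S(1) xz dy iN i supp[OF p[unfolded xz(3)] xz(1,2)]
      by (auto simp: scalar_prod_def S_def simp del: index_mult_mat_vec intro!: sum.cong)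
    then have "skew p (unit_vec n i @\<^sub>v col S i) = skew p (unit_vec n i @\<^sub>v (d *\<^sub>v y i))"
      unfolding xz(3) using xz dy S(1) iN by (simp add: skew_append[of _ n] col_carrier_vec)
    also have "\<dots> = 0" using lagrangianD[OF V p unitV[OF i]] .
    finally show "skew p (unit_vec n i @\<^sub>v col S i) = 0" .
  qed
  have coord: "z $ i = x \<bullet>c col S i"
    if "x @\<^sub>v z \<in> V" "x \<in> carrier_vec n" "z \<in> carrier_vec n" "i \<in> I" for x z i
  proof -
    have i: "i < n" using that by (auto simp: I_def)
    have "z \<bullet>c unit_vec n i - x \<bullet>c col S i = 0"
      using lagrangianD[OF V sV[OF that(4)] that(1)] that S(1) i
      by (simp add: skew_append[of _ n] col_carrier_vec)
    then show ?thesis using cscalar_prod_unit_vec[OF that(3) i] by simp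
  qed
  \<comment> \<open>Hermitian symmetry is isotropy between two of the truncated vectors:
    \<open>coord\<close> applied to \<open>sV\<close>.\<close>
  have hS: "hermitian n S"
  proof (rule hermitianI[OF S(1)])
    fix i j assume ij: "i < n" "j < n"
    show "S $$ (j, i) = conjugate (S $$ (i, j))"
    proof (cases "i \<in> I \<and> j \<in> I")
      case True
      have "col S i $ j = unit_vec n i \<bullet>c col S j"
        using coord[OF sV, of i j] True S(1) ij by (auto simp: col_carrier_vec)
      then show ?thesis using S(1) ij by (simp add: scalar_prod_left_unit[of _ n] col_carrier_vec)
    next
      case False
      then have "S $$ (j, i) = 0" "S $$ (i, j) = 0" using S(2) ij by (auto simp: supported_def)
      then show ?thesis by simp
    qed
  qed
  let ?E = "coord_proj n I :: 'a mat" and ?D = "coord_proj n (- I) :: 'a mat"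
  have SD: "(S + ?D) *\<^sub>v v = S *\<^sub>v v + ?D *\<^sub>v v" if "v \<in> carrier_vec n" for v
    using S(1) that by (intro add_mult_distrib_mat_vec) auto
  have sub: "p \<in> pair_space n ?E (S + ?D)" if p: "p \<in> V" for p
  proof -
    obtain x z where xz: "x \<in> carrier_vec n" "z \<in> carrier_vec n" "p = x @\<^sub>v z"
      using append_vec_cases[OF lagrangian_carrier[OF V p]] .
    \<comment> \<open>The free parameters of a point are x, which lives on I, and the part of z
      outside I. On I, z is determined as S x by \<open>coord\<close>.\<close>
    let ?v = "x + ?D *\<^sub>v z"
    have v: "?v \<in> carrier_vec n" using xz by (intro add_carrier_vec mult_mat_vec_carrier[OF coord_proj_carrier])
    have x0: "x $ i = 0" if "i < n" "i \<notin> I" for i using supp[OF p[unfolded xz(3)] xz(1,2) that] .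
    have "?E *\<^sub>v ?v = x"
      using xz x0 v by (intro eq_vecI) (auto simp del: index_mult_mat_vec)
    moreover have "(S + ?D) *\<^sub>v ?v = z"
    proof (rule eq_vecI)
      fix i assume "i < dim_vec z"
      then have i: "i < n" using xz by simp
      have Sv: "(S *\<^sub>v ?v) $ i = (S *\<^sub>v x) $ i"
        unfolding index_mult_mat_vec_sum[OF S(1) v i] index_mult_mat_vec_sum[OF S(1) xz(1) i]
        using S(2) i xz by (intro sum.cong) (auto simp: supported_def simp del: index_mult_mat_vec)
      have "((S + ?D) *\<^sub>v ?v) $ i = (S *\<^sub>v x) $ i + (if i \<in> I then 0 else z $ i)"
        unfolding SD[OF v] using i xz v Sv S(1) x0[OF i]
        by (auto simp del: index_mult_mat_vec)
      also have "\<dots> = z $ i"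
      proof (cases "i \<in> I")
        case True
        have "z $ i = (\<Sum>k\<in>{0..<n}. x $ k * conjugate (S $$ (k, i)))"
          using coord[OF p[unfolded xz(3)] xz(1,2) True] S(1) i xz
          by (auto simp: scalar_prod_def intro!: sum.cong)
        also have "\<dots> = (S *\<^sub>v x) $ i"
          unfolding index_mult_mat_vec_sum[OF S(1) xz(1) i]
          using hermitianD[OF hS _ i] by (intro sum.cong) (auto simp: mult.commute)
        finally show ?thesis using True by simp
      next
        case False
        then show ?thesis using supported_mult_vec[OF S xz(1) i] by simp
      qed
      finally show "((S + ?D) *\<^sub>v ?v) $ i = z $ i" .
    qed (use xz S in auto)
    ultimately show ?thesis
      unfolding pair_space_def xz(3) using v by (intro CollectI exI[of _ ?v]) simp
  qed
  \<comment> \<open>As V already lies in the column space, its maximality reduces the reverse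
    inclusion to isotropy of that space, which is the hermitian symmetry of S.\<close>
  have sup: "p \<in> V" if p: "p \<in> pair_space n ?E (S + ?D)" for p
  proof -
    obtain v where v: "v \<in> carrier_vec n" "p = (?E *\<^sub>v v) @\<^sub>v ((S + ?D) *\<^sub>v v)"
      using p by (auto simp: pair_space_def)
    note Ec = mult_mat_vec_carrier[OF coord_proj_carrier] and
      Mc = mult_mat_vec_carrier[OF add_carrier_mat[OF coord_proj_carrier, of S n "- I"]]
    show ?thesis
    proof (rule lagrangianI[OF V])
      show "p \<in> carrier_vec (2*n)" unfolding v(2) using v(1) by (intro append_vec_carrier Ec Mc)
      fix q assume "q \<in> V"
      then obtain w where w: "w \<in> carrier_vec n" "q = (?E *\<^sub>v w) @\<^sub>v ((S + ?D) *\<^sub>v w)"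
        using sub by (auto simp: pair_space_def)
      have "skew q p = ((S + ?D) *\<^sub>v v) \<bullet>c (?E *\<^sub>v w) - (?E *\<^sub>v v) \<bullet>c ((S + ?D) *\<^sub>v w)"
        unfolding v(2) w(2) using v w by (intro skew_append[of _ n] Ec Mc)
      also have "\<dots> = (\<Sum>i\<in>{0..<n}. ((S + ?D) *\<^sub>v v) $ i * conjugate ((?E *\<^sub>v w) $ i)
          - (?E *\<^sub>v v) $ i * conjugate (((S + ?D) *\<^sub>v w) $ i))"
        using S(1) v w by (auto simp: scalar_prod_def sum_subtractf simp del: index_mult_mat_vec)
      also have "\<dots> = (\<Sum>i\<in>{0..<n}. (S *\<^sub>v v) $ i * conjugate (w $ i) - v $ i * conjugate ((S *\<^sub>v w) $ i))"
        using S(1) v w supported_mult_vec[OF S]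
        by (intro sum.cong) (auto simp: SD simp del: index_mult_mat_vec)
      also have "\<dots> = (S *\<^sub>v v) \<bullet>c w - v \<bullet>c (S *\<^sub>v w)"
        using S(1) v w by (auto simp: scalar_prod_def sum_subtractf simp del: index_mult_mat_vec)
      also have "\<dots> = 0"
        using cscalar_prod_mult_mat_vec[OF S(1) v(1) w(1)] hS by (simp add: hermitian_def)
      finally show "skew q p = 0" .
    qed
  qed
  have "img_subspace b W = pair_space n ?E (S + ?D)"
    using sub sup unfolding V_def by blast
  then show ?thesis using b hS S(2) by blast
qed

section \<open>Reduction of a Lagrangian to normal form\<close>

lemma img_bdiag_pair_space:
  fixes A :: "'a :: comm_semiring_1 mat"
  assumes "c \<in> carrier_mat n n" "d \<in> carrier_mat n n" "A \<in> carrier_mat n n" "M \<in> carrier_mat n n"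
  shows "img_subspace (bdiag n c d) (pair_space n A M) = pair_space n (c * A) (d * M)"
proof -
  have "bdiag n c d *\<^sub>v ((A *\<^sub>v v) @\<^sub>v (M *\<^sub>v v)) = ((c * A) *\<^sub>v v) @\<^sub>v ((d * M) *\<^sub>v v)"
    if "v \<in> carrier_vec n" for v
    using bdiag_mult_append[OF assms(1,2) mult_mat_vec_carrier[OF assms(3) that] mult_mat_vec_carrier[OF assms(4) that]]
      assoc_mult_mat_vec[OF assms(1,3) that] assoc_mult_mat_vec[OF assms(2,4) that] by simp
  then show ?thesis
    unfolding img_subspace_def pair_space_def by (auto simp: image_iff) metis+
qed

lemma pair_space_mult_right:
  fixes A :: "'a :: comm_semiring_1 mat"
  assumes "g \<in> carrier_mat n n" "h \<in> carrier_mat n n" "g * h = 1\<^sub>m n"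
    "A \<in> carrier_mat n n" "M \<in> carrier_mat n n"
  shows "pair_space n (A * g) (M * g) = pair_space n A M"
proof (intro equalityI subsetI)
  fix p assume "p \<in> pair_space n (A * g) (M * g)"
  then obtain v where "v \<in> carrier_vec n" "p = ((A * g) *\<^sub>v v) @\<^sub>v ((M * g) *\<^sub>v v)"
    by (auto simp: pair_space_def)
  then have "p = (A *\<^sub>v (g *\<^sub>v v)) @\<^sub>v (M *\<^sub>v (g *\<^sub>v v))" "g *\<^sub>v v \<in> carrier_vec n"
    using assms by auto
  then show "p \<in> pair_space n A M" unfolding pair_space_def by blast
next
  fix p assume "p \<in> pair_space n A M"
  then obtain v where v: "v \<in> carrier_vec n" "p = (A *\<^sub>v v) @\<^sub>v (M *\<^sub>v v)"
    by (auto simp: pair_space_def)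
  have hv: "h *\<^sub>v v \<in> carrier_vec n" using assms(2) v by simp
  have "g *\<^sub>v (h *\<^sub>v v) = v" using assoc_mult_mat_vec[OF assms(1,2) v(1)] assms(3) v by simp
  then have "p = ((A * g) *\<^sub>v (h *\<^sub>v v)) @\<^sub>v ((M * g) *\<^sub>v (h *\<^sub>v v))"
    unfolding v(2) using assoc_mult_mat_vec[OF assms(4,1) hv] assoc_mult_mat_vec[OF assms(5,1) hv] by simp
  then show "p \<in> pair_space n (A * g) (M * g)" unfolding pair_space_def using hv by blast
qed

lemma coord_proj_mult_left:
  fixes A :: "'a :: semiring_1 mat"
  assumes "A \<in> carrier_mat n n" "i < n" "j < n"
  shows "(coord_proj n I * A) $$ (i, j) = (if i \<in> I then A $$ (i, j) else 0)"
proof -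
  have "(coord_proj n I * A) $$ (i, j)
      = (\<Sum>l\<in>{0..<n}. if l = i then if i \<in> I then A $$ (i, j) else 0 else 0)"
    unfolding index_mult_mat_sum[OF coord_proj_carrier assms] using assms by (intro sum.cong) auto
  then show ?thesis using assms by simp
qed

lemma coord_proj_mult_right:
  fixes A :: "'a :: semiring_1 mat"
  assumes "A \<in> carrier_mat n n" "i < n" "j < n"
  shows "(A * coord_proj n I) $$ (i, j) = (if j \<in> I then A $$ (i, j) else 0)"
proof -
  have "(A * coord_proj n I) $$ (i, j)
      = (\<Sum>l\<in>{0..<n}. if l = j then if j \<in> I then A $$ (i, j) else 0 else 0)"
    unfolding index_mult_mat_sum[OF assms(1) coord_proj_carrier assms(2,3)]
    using assms by (intro sum.cong) auto
  then show ?thesis using assms by simp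
qed

lemma mat_adjoint_coord_proj [simp]: "mat_adjoint (coord_proj n I) = coord_proj n I"
  by (intro eq_matI) auto

text \<open>Restricting the congruence to the coordinates in \<open>I\<close> keeps \<open>K\<^bsup>I\<^esup> \<oplus> 0\<close> and
  \<open>0 \<oplus> K\<^bsup>-I\<^esup>\<close> in place.\<close>

lemma lagrangian_normal_form:
  fixes W :: "'a :: sign_field vec set"
  assumes W: "lagrangian n W"
  shows "\<exists>b\<in>B_grp n. \<exists>I M. normal_form n M \<and> supported n I M \<and>
    img_subspace b W = pair_space n (coord_proj n I) (M + coord_proj n (- I))"
proof -
  obtain b I S where b: "b \<in> B_grp n" and S: "hermitian n S" "supported n I S"
    and W': "img_subspace b W = pair_space n (coord_proj n I) (S + coord_proj n (- I))"
    using lagrangian_coordinates[OF W] by auto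
  note Sc = hermitian_carrier[OF S(1)]
  obtain T a where T: "normal_form n T" and a: "a \<in> UT n" "T = mat_adjoint a * S * a"
    using congruent_UT_normal_form[OF S(1)] by (auto simp: congruent_UT_def)
  have ac: "a \<in> carrier_mat n n" using a by (simp add: UT_def)
  have S0: "S $$ (p, q) = 0" if "p < n" "q < n" "p \<notin> I \<or> q \<notin> I" for p q
    using S(2) that by (auto simp: supported_def)
  \<comment> \<open>Only the I-block of the congruence is kept, so e commutes with the projection to
    I. The column operation e therefore restores the first block after c has acted, and the second
    block becomes e^* (S + D) e, whose I-block is that of a^* S a since S is supported on I.\<close>
  define e where "e = mat n n (\<lambda>(i, j). if i \<in> I \<and> j \<in> I then a $$ (i, j) else if i = j then 1 else 0)"
  have e: "e \<in> carrier_mat n n" by (simp add: e_def)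
  have e_index: "e $$ (k, l) = (if k \<in> I \<and> l \<in> I then a $$ (k, l) else if k = l then 1 else 0)"
    if "k < n" "l < n" for k l
    using that by (simp add: e_def)
  have eut: "upper_triangular e" "\<And>i. i < n \<Longrightarrow> e $$ (i, i) \<noteq> 0"
    using a(1) upper_triangularD[of a] by (auto simp: e_def UT_def intro!: upper_triangularI)
  obtain c where c: "c \<in> carrier_mat n n" "e * c = 1\<^sub>m n" "c * e = 1\<^sub>m n" "upper_triangular c"
    using obtain_inverse_upper_triangular[OF e eut] by auto
  define d where "d = mat_adjoint e"
  have d: "d \<in> carrier_mat n n" using e by (simp add: d_def)
  have cd: "mat_adjoint c * d = 1\<^sub>m n"
    unfolding d_def using mat_adjoint_mult[OF e c(1)] c(2) by simp
  have b1: "bdiag n c d \<in> B_grp n" using c d cd by (intro B_grpI)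
  let ?E = "coord_proj n I :: 'a mat" and ?D = "coord_proj n (- I) :: 'a mat"
  have SD: "S + ?D \<in> carrier_mat n n" using Sc by simp
  define M where "M = mat n n (\<lambda>(i, j). if i \<in> I \<and> j \<in> I then T $$ (i, j) else 0)"
  have M: "M \<in> carrier_mat n n" by (simp add: M_def)
  have "e * ?E = ?E * e"
    using e by (intro eq_matI) (auto simp: coord_proj_mult_left coord_proj_mult_right e_def
        simp del: index_mult_mat(1))
  then have "c * (e * ?E) * c = c * (?E * e) * c" by simp
  moreover have "c * (e * ?E) * c = (c * e) * ?E * c" "c * (?E * e) * c = c * ?E * (e * c)"
    using c(1) e coord_proj_carrier[of n I] by (simp_all add: assoc_mult_square[of _ n] mult_carrier_square[of _ n])
  ultimately have cE: "c * ?E = ?E * c" using c by (simp add: mult_carrier_square[of _ n])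
  have "d * (S + ?D) * e = M + ?D"
  proof (rule eq_matI)
    fix i j assume "i < dim_row (M + ?D)" "j < dim_col (M + ?D)"
    then have ij: "i < n" "j < n" by auto
    have Se: "((S + ?D) * e) $$ (k, l) = (if k \<in> I \<and> l \<in> I then (S * a) $$ (k, l) else if k = l \<and> k \<notin> I then 1 else 0)"
      if "k < n" "l < n" for k l
    proof -
      have "((S + ?D) * e) $$ (k, l) = (S * e) $$ (k, l) + (?D * e) $$ (k, l)"
        using Sc e that by (simp add: add_mult_distrib_mat[of _ n n])
      moreover have "(S * e) $$ (k, l) = (if k \<in> I \<and> l \<in> I then (S * a) $$ (k, l) else 0)"
        unfolding index_mult_mat_sum[OF Sc e that] index_mult_mat_sum[OF Sc ac that]
        using that by (auto simp: S0 e_def intro!: sum.cong sum.neutral)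
      moreover have "(?D * e) $$ (k, l) = (if k = l \<and> k \<notin> I then 1 else 0)"
        using e that by (auto simp: coord_proj_mult_left e_def simp del: index_mult_mat(1))
      ultimately show ?thesis by auto
    qed
    have "(d * (S + ?D) * e) $$ (i, j) = (d * ((S + ?D) * e)) $$ (i, j)"
      using d SD e by (simp add: assoc_mult_square[of _ n])
    also have "\<dots> = (\<Sum>k\<in>{0..<n}. conjugate (e $$ (k, i)) * ((S + ?D) * e) $$ (k, j))"
      using index_mult_mat_sum[OF d mult_carrier_square[OF SD e] ij] e ij by (simp add: d_def)
    also have "\<dots> = (M + ?D) $$ (i, j)"
    proof (cases "i \<in> I \<and> j \<in> I")
      case True
      have "(\<Sum>k\<in>{0..<n}. conjugate (e $$ (k, i)) * ((S + ?D) * e) $$ (k, j))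
        = (\<Sum>k\<in>{0..<n}. mat_adjoint a $$ (i, k) * (S * a) $$ (k, j))"
      proof (intro sum.cong refl)
        fix k assume "k \<in> {0..<n}"
        then have k: "k < n" by simp
        have "(S * a) $$ (k, j) = 0" if "k \<notin> I"
          unfolding index_mult_mat_sum[OF Sc ac k ij(2)] using that k
          by (intro sum.neutral) (auto simp: S0)
        then show "conjugate (e $$ (k, i)) * ((S + ?D) * e) $$ (k, j) = mat_adjoint a $$ (i, k) * (S * a) $$ (k, j)"
          using True k ij ac by (auto simp: Se[OF k ij(2)] e_index simp del: index_mult_mat(1))
      qed
      also have "\<dots> = (mat_adjoint a * (S * a)) $$ (i, j)"
        using index_mult_mat_sum[OF mat_adjoint_carrier[OF ac] mult_carrier_square[OF Sc ac] ij] by simp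
      also have "\<dots> = T $$ (i, j)" unfolding a(2) using ac Sc by (simp add: assoc_mult_square[of _ n])
      finally show ?thesis using True ij by (simp add: M_def)
    next
      case False
      have "(\<Sum>k\<in>{0..<n}. conjugate (e $$ (k, i)) * ((S + ?D) * e) $$ (k, j))
        = (\<Sum>k\<in>{0..<n}. if k = j then if i = j then 1 else 0 else 0)"
      proof (intro sum.cong refl)
        fix k assume "k \<in> {0..<n}"
        then have k: "k < n" by simp
        show "conjugate (e $$ (k, i)) * ((S + ?D) * e) $$ (k, j) = (if k = j then if i = j then 1 else 0 else 0)"
          unfolding Se[OF k ij(2)] e_index[OF k ij(1)] using False 
          by (cases "k = i"; cases "k = j"; cases "i \<in> I"; simp)
      qed
      then show ?thesis using False ij by (auto simp: M_def)
    qed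
    finally show "(d * (S + ?D) * e) $$ (i, j) = (M + ?D) $$ (i, j)" .
  qed (use d e in auto)
  then have "d * (S + ?D) * (e * c) = (M + ?D) * c"
    using assoc_mult_square[OF mult_carrier_square[OF d SD] e c(1)] by simp
  then have "d * (S + ?D) = (M + ?D) * c"
    using d SD c(2) mult_carrier_square[OF d SD] by simp
  then have "img_subspace (bdiag n c d) (img_subspace b W) = pair_space n ?E (M + ?D)"
    unfolding W' using img_bdiag_pair_space[OF c(1) d coord_proj_carrier SD] cE
      pair_space_mult_right[OF c(1) e c(3) coord_proj_carrier, of "M + ?D" I] M by simp
  moreover have "img_subspace (bdiag n c d) (img_subspace b W) = img_subspace (bdiag n c d * b) W"
    using mat_groupD(1)[OF B_grp_mat_group b1] mat_groupD(1)[OF B_grp_mat_group b] lagrangian_carrier[OF W]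
    by (intro img_subspace_mult[symmetric] subsetI)
  \<comment> \<open>Passing from T to M only deletes entries, and it does so symmetrically, which
    preserves isolation and the conditions on entries.\<close>
  moreover have "normal_form n M"
  proof -
    have nz: "T $$ (i, j) \<noteq> 0" if "M $$ (i, j) \<noteq> 0" "i < n" "j < n" for i j
      using that by (simp add: M_def split: if_splits)
    have "isolated n M i" if i: "i < n" for i
    proof -
      have "isolated n T i" using T i by (simp add: normal_form_def)
      then show ?thesis unfolding isolated_def using nz i by meson
    qed
    moreover have "M $$ (i, i) \<in> {0, 1, - 1}" if i: "i < n" for i
      using T i by (simp add: M_def normal_form_def)
    moreover have "M $$ (i, j) \<in> {0, 1} \<and> M $$ (i, j) = M $$ (j, i)" if "i < n" "j < n" "i \<noteq> j" for i j
    proof -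
      have "T $$ (i, j) \<in> {0, 1} \<and> T $$ (i, j) = T $$ (j, i)" using T that by (simp add: normal_form_def)
      then show ?thesis using that by (auto simp: M_def)
    qed
    ultimately show ?thesis using M by (simp add: normal_form_def)
  qed
  moreover have "supported n I M" by (auto simp: supported_def M_def)
  ultimately show ?thesis
    by (intro bexI[OF _ mat_groupD(3)[OF B_grp_mat_group b1 b]] exI[of _ I] exI[of _ M]) auto
qed

section \<open>Realising normal forms by isometries\<close>

lemma coord_proj_products:
  fixes S :: "'a :: ring_1 mat"
  shows "coord_proj n I * coord_proj n J = (coord_proj n (I \<inter> J) :: 'a mat)"
    and "coord_proj n I + coord_proj n (- I) = (1\<^sub>m n :: 'a mat)"
    and "S \<in> carrier_mat n n \<Longrightarrow> supported n I S \<Longrightarrow> coord_proj n I * S = S"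
    and "S \<in> carrier_mat n n \<Longrightarrow> supported n I S \<Longrightarrow> S * coord_proj n I = S"
    and "S \<in> carrier_mat n n \<Longrightarrow> supported n I S \<Longrightarrow> coord_proj n (- I) * S = 0\<^sub>m n n"
    and "S \<in> carrier_mat n n \<Longrightarrow> supported n I S \<Longrightarrow> S * coord_proj n (- I) = 0\<^sub>m n n"
  by (intro eq_matI; auto simp: coord_proj_mult_left coord_proj_mult_right supported_def
      simp del: index_mult_mat(1))+

lemma coord_proj_empty: "coord_proj n {} = 0\<^sub>m n n"
  by (intro eq_matI) auto

lemma obtain_isometry:
  fixes S :: "'a :: conjugatable_field mat"
  assumes S: "hermitian n S" "supported n I S"
  shows "\<exists>g\<in>G_grp n. img_subspace g (L0 n) = pair_space n (coord_proj n I) (S + coord_proj n (- I))"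
proof -
  let ?E = "coord_proj n I :: 'a mat" and ?D = "coord_proj n (- I) :: 'a mat" and ?Z = "0\<^sub>m n n :: 'a mat"
  note Sc = hermitian_carrier[OF S(1)]
  note cp = coord_proj_products(1)[of n, where 'a = 'a] coord_proj_products(2)[of n I, where 'a = 'a]
    coord_proj_products(3-6)[OF Sc S(2)]
  define M where "M = S + ?D"
  have M: "M \<in> carrier_mat n n" using Sc by (simp add: M_def)
  have Mh: "mat_adjoint M = M"
  proof (rule eq_matI)
    fix i j assume ij: "i < dim_row M" "j < dim_col M"
    then have "S $$ (i, j) = conjugate (S $$ (j, i))"
      using hermitianD[OF S(1), of j i] M by simp
    then show "mat_adjoint M $$ (i, j) = M $$ (i, j)"
      using ij Sc by (auto simp: M_def conjugate_dist_add)
  qed (use M in auto)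
  have EM: "?E * M = S" "M * ?E = S" "M * ?D = ?D" "?D * M = ?D"
    unfolding M_def using Sc cp
    by (simp_all add: add_mult_distrib_mat[of _ n n _ _ n] mult_add_distrib_mat[of _ n n _ n] coord_proj_empty)
  \<comment> \<open>The first block column spans the required Lagrangian; the second, -D above E,
    spans a complementary Lagrangian dual to it. The products in \<open>EM\<close> supply the
    relations between these columns.\<close>
  define g where "g = four_block_mat ?E (- ?D) M ?E"
  have g: "g \<in> carrier_mat (2*n) (2*n)" using M by (auto simp: g_def)
  have "mat_adjoint (- ?D) = - ?D" by (intro eq_matI) (auto simp: conjugate_neg)
  then have "mat_adjoint g = four_block_mat ?E M (- ?D) ?E"
    unfolding g_def using M Mh by (subst mat_adjoint_four_block) auto
  moreover have "four_block_mat ?E M (- ?D) ?E * Sigma_mat n = four_block_mat (- M) ?E (- ?E) (- ?D)"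
    unfolding Sigma_mat_def using M
    by (subst mult_four_block_mat[of _ n n _ n _ n _ _ n _ n]) auto
  moreover have "\<dots> * g = Sigma_mat n"
  proof -
    have neg0: "- ?Z = ?Z" by (intro eq_matI) auto
    have neg: "- M * ?E = - S" "- M * - ?D = ?D" "- ?E * ?E = - ?E" "- ?D * M = - ?D"
      "- ?E * - ?D = ?Z" "- ?D * ?E = ?Z" "?E * ?E = ?E"
      using EM M neg0 by (simp_all add: cp(1) coord_proj_empty)
    have "four_block_mat (- S + S) (?D + ?E) (- ?E + - ?D) (?Z + ?Z)
        = four_block_mat ?Z (1\<^sub>m n) (- 1\<^sub>m n) ?Z"
      using Sc by (intro cong_four_block_mat eq_matI) auto
    then show ?thesis
      unfolding g_def Sigma_mat_def using M
      by (subst mult_four_block_mat[of _ n n _ n _ n _ _ n _ n]) (auto simp: neg EM)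
  qed
  ultimately have "g \<in> G_grp n" using g by (simp add: isom_grp_def)
  moreover have "img_subspace g (L0 n) = pair_space n ?E M"
  proof -
    have gx: "g *\<^sub>v (x @\<^sub>v 0\<^sub>v n) = (?E *\<^sub>v x) @\<^sub>v (M *\<^sub>v x)" if "x \<in> carrier_vec n" for x
    proof -
      have "- ?D *\<^sub>v 0\<^sub>v n = 0\<^sub>v n" "?E *\<^sub>v 0\<^sub>v n = 0\<^sub>v n" by (auto intro!: eq_vecI)
      then show ?thesis
        unfolding g_def using M that
        by (subst four_block_mat_mult_vec[of _ n n _ n _ n]) (auto simp: mult_mat_vec_carrier[of _ n n])
    qed
    have "L0 n = {x @\<^sub>v 0\<^sub>v n | x :: 'a vec. x \<in> carrier_vec n}"
    proof (intro equalityI subsetI)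
      fix p :: "'a vec" assume p: "p \<in> L0 n"
      then obtain x y where xy: "x \<in> carrier_vec n" "y \<in> carrier_vec n" "p = x @\<^sub>v y"
        using append_vec_cases[of p n] by (auto simp: L0_def)
      have "p $ (n + i) = 0" if "i < n" for i using p that by (auto simp: L0_def)
      then have "y = 0\<^sub>v n" using xy by (intro eq_vecI) auto
      then show "p \<in> {x @\<^sub>v 0\<^sub>v n | x. x \<in> carrier_vec n}" using xy by blast
    qed (auto simp: L0_def)
    then show ?thesis
      unfolding img_subspace_def pair_space_def using gx by (auto simp: image_iff) metis+
  qed
  ultimately show ?thesis unfolding M_def by blast
qed

section \<open>Clans and their Lagrangians\<close>

text \<open>Matrix indices start at 0 and clans live on \<open>{1..n}\<close>, so index \<open>i\<close> belongs to vertex \<open>Suc i\<close>.\<close>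

definition clan_I :: "(nat \<Rightarrow> clan_val) \<Rightarrow> nat set" where
  "clan_I \<gamma> = {i. \<gamma> (Suc i) \<noteq> Ddec}"

definition clan_S :: "nat \<Rightarrow> (nat \<Rightarrow> clan_val) \<Rightarrow> 'a :: ring_1 mat" where
  "clan_S n \<gamma> = mat n n (\<lambda>(i, j).
     if i = j then (if \<gamma> (Suc i) = Plus then 1 else if \<gamma> (Suc i) = Minus then - 1 else 0)
     else if \<gamma> (Suc i) = Pt (Suc j) then 1 else 0)"

definition clan_space :: "nat \<Rightarrow> (nat \<Rightarrow> clan_val) \<Rightarrow> 'a :: ring_1 vec set" where
  "clan_space n \<gamma> = pair_space n (coord_proj n (clan_I \<gamma>)) (clan_S n \<gamma> + coord_proj n (- clan_I \<gamma>))"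

lemma clan_S_carrier [simp]: "clan_S n \<gamma> \<in> carrier_mat n n"
  by (simp add: clan_S_def)

lemma dim_clan_S [simp]: "dim_row (clan_S n \<gamma>) = n" "dim_col (clan_S n \<gamma>) = n"
  by (simp_all add: clan_S_def)

text \<open>Turns an arc between vertices into a pair of matrix indices below n.\<close>

lemma Gamma_partner:
  assumes "\<gamma> \<in> Gamma n" "i < n" "\<gamma> (Suc i) = Pt k"
  obtains j where "k = Suc j" "j < n" "j \<noteq> i" "\<gamma> (Suc j) = Pt (Suc i)"
proof -
  have \<gamma>: "\<gamma> \<in> {1..n} \<rightarrow>\<^sub>E (Pt ` {1..n} \<union> {Plus, Minus, Cdec, Ddec})"
    "\<forall>i\<in>{1..n}. \<forall>j. \<gamma> i = Pt j \<longrightarrow> i \<noteq> j \<and> \<gamma> j = Pt i"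
    using assms(1) unfolding Gamma_def by blast+
  have "Suc i \<in> {1..n}" using assms(2) by auto
  then have "\<gamma> (Suc i) \<in> Pt ` {1..n} \<union> {Plus, Minus, Cdec, Ddec}"
    using PiE_mem[OF \<gamma>(1)] by blast
  then have "k \<in> {1..n}" using assms(3) by auto
  moreover have k: "Suc i \<noteq> k" "\<gamma> k = Pt (Suc i)" using \<gamma>(2) \<open>Suc i \<in> {1..n}\<close> assms(3) by blast+
  ultimately have "k = Suc (k - 1)" "k - 1 < n" by auto
  then show thesis using that[of "k - 1"] k by metis
qed

lemma clan_S_hermitian:
  assumes "\<gamma> \<in> Gamma n"
  shows "hermitian n (clan_S n \<gamma> :: 'a :: conjugatable_field mat)"
proof (rule hermitianI)
  fix i j assume ij: "i < n" "j < n"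
  have "\<gamma> (Suc i) = Pt (Suc j) \<longleftrightarrow> \<gamma> (Suc j) = Pt (Suc i)"
    using Gamma_partner[OF assms ij(1), of "Suc j"] Gamma_partner[OF assms ij(2), of "Suc i"] by auto
  then show "clan_S n \<gamma> $$ (j, i) = conjugate (clan_S n \<gamma> $$ (i, j) :: 'a)"
    using ij by (auto simp: clan_S_def)
qed simp

lemma clan_S_supported:
  assumes "\<gamma> \<in> Gamma n"
  shows "supported n (clan_I \<gamma>) (clan_S n \<gamma>)"
  unfolding supported_def
proof (intro allI impI)
  fix i j assume ij: "i < n" "j < n" and nz: "clan_S n \<gamma> $$ (i, j) \<noteq> 0"
  show "i \<in> clan_I \<gamma> \<and> j \<in> clan_I \<gamma>"
  proof (cases "i = j")
    case False
    then have "\<gamma> (Suc i) = Pt (Suc j)" using ij nz by (auto simp: clan_S_def split: if_splits)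
    moreover from this have "\<gamma> (Suc j) = Pt (Suc i)" using Gamma_partner[OF assms ij(1), of "Suc j"] by auto
    ultimately show ?thesis by (simp add: clan_I_def)
  qed (use ij nz in \<open>auto simp: clan_S_def clan_I_def split: if_splits\<close>)
qed

text \<open>The inverse of passing from a clan to \<open>clan_I\<close> and \<open>clan_S\<close>.
  The \<open>LEAST\<close> names the only nonzero entry of an isolated row.\<close>

definition clan_of :: "nat \<Rightarrow> nat set \<Rightarrow> 'a :: ring_1 mat \<Rightarrow> nat \<Rightarrow> clan_val" where
  "clan_of n I M = (\<lambda>k\<in>{1..n}. let i = k - 1 in
     if i \<notin> I then Ddec else if M $$ (i, i) = 1 then Plus else if M $$ (i, i) = - 1 then Minus
     else if \<exists>j<n. M $$ (i, j) \<noteq> 0 then Pt (Suc (LEAST j. M $$ (i, j) \<noteq> 0)) else Cdec)"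

text \<open>Kept over a ring with 1 different from -1 so that it serves both the Lagrangians over
  the field and the integer matrices of Omega; if 1 = -1, the two signs could not be told
  apart.\<close>

lemma clan_of:
  fixes M :: "'a :: ring_1 mat"
  assumes M: "normal_form n M" "supported n I M" and one: "(1::'a) \<noteq> - 1"
  shows "clan_of n I M \<in> Gamma n" "coord_proj n (clan_I (clan_of n I M)) = (coord_proj n I :: 'a mat)"
    "coord_proj n (- clan_I (clan_of n I M)) = (coord_proj n (- I) :: 'a mat)"
    "clan_S n (clan_of n I M) = M"
proof -
  let ?\<gamma> = "clan_of n I M"
  have Mc: "M \<in> carrier_mat n n" using M by (simp add: normal_form_def)
  have g: "?\<gamma> (Suc i) = (if i \<notin> I then Ddec else if M $$ (i, i) = 1 then Plus else if M $$ (i, i) = - 1 then Minus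
     else if \<exists>j<n. M $$ (i, j) \<noteq> 0 then Pt (Suc (LEAST j. M $$ (i, j) \<noteq> 0)) else Cdec)" if "i < n" for i
    using that by (auto simp: clan_of_def Let_def)
  have iso: "isolated n M i" if "i < n" for i using M that by (simp add: normal_form_def)
  have diag: "M $$ (i, i) \<in> {0, 1, - 1}" if "i < n" for i using M(1) that by (simp add: normal_form_def)
  have off: "M $$ (i, j) \<in> {0, 1}" "M $$ (i, j) = M $$ (j, i)" if "i < n" "j < n" "i \<noteq> j" for i j
    using M(1) that by (simp_all add: normal_form_def)
  have least: "(LEAST j. M $$ (i, j) \<noteq> 0) = j" if "i < n" "j < n" "M $$ (i, j) \<noteq> 0" for i j
  proof -
    have "(LEAST j. M $$ (i, j) \<noteq> 0) \<le> j" "M $$ (i, LEAST j. M $$ (i, j) \<noteq> 0) \<noteq> 0"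
      using that(3) by (rule Least_le, rule LeastI)
    then show ?thesis using isolatedD(1)[OF iso[OF that(1)] that(2,3)] that(2) le_less_trans by blast
  qed
  have arc: "?\<gamma> (Suc i) = Pt (Suc j) \<longleftrightarrow> M $$ (i, j) \<noteq> 0 \<and> i \<noteq> j" if ij: "i < n" "j < n" for i j
  proof
    assume gi: "?\<gamma> (Suc i) = Pt (Suc j)"
    then obtain k where k: "k < n" "M $$ (i, k) \<noteq> 0" and d: "M $$ (i, i) \<noteq> 1" "M $$ (i, i) \<noteq> - 1"
      unfolding g[OF ij(1)] by (auto split: if_splits)
    have "i \<in> I" using M(2) k ij unfolding supported_def by blast
    moreover have "\<exists>j<n. M $$ (i, j) \<noteq> 0" using k by blast
    ultimately have "?\<gamma> (Suc i) = Pt (Suc k)" using g[OF ij(1)] least[OF ij(1) k] d by simp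
    then have "j = k" using gi by simp
    then show "M $$ (i, j) \<noteq> 0 \<and> i \<noteq> j" using k d diag[OF ij(1)] by auto
  next
    assume nz: "M $$ (i, j) \<noteq> 0 \<and> i \<noteq> j"
    then have "M $$ (i, i) = 0" using isolatedD(1)[OF iso[OF ij(1)] ij(2), of i] ij by auto
    moreover have "i \<in> I" using M(2) ij nz by (auto simp: supported_def)
    ultimately show "?\<gamma> (Suc i) = Pt (Suc j)"
      using g[OF ij(1)] least[OF ij] ij nz one by auto
  qed
  show "?\<gamma> \<in> Gamma n"
    unfolding Gamma_def
  proof (intro CollectI conjI ballI allI impI)
    show "?\<gamma> \<in> {1..n} \<rightarrow>\<^sub>E (Pt ` {1..n} \<union> {Plus, Minus, Cdec, Ddec})"
    proof (rule PiE_I)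
      fix k assume "k \<in> {1..n}"
      then obtain i where i: "k = Suc i" "i < n" by (cases k) auto
      show "?\<gamma> k \<in> Pt ` {1..n} \<union> {Plus, Minus, Cdec, Ddec}"
        unfolding i(1) g[OF i(2)] using least[OF i(2)] by auto
    next
      fix k assume "k \<notin> {1..n}"
      then show "?\<gamma> k = undefined" unfolding clan_of_def restrict_apply by (rule if_not_P)
    qed
    fix k l assume k: "k \<in> {1..n}" and kl: "?\<gamma> k = Pt l"
    obtain i where i: "k = Suc i" "i < n" using k by (cases k) auto
    obtain j where j: "j < n" "l = Suc j"
      using kl g[OF i(2)] least[OF i(2)] i(1) by (auto split: if_splits)
    have "M $$ (i, j) \<noteq> 0 \<and> i \<noteq> j" using arc[OF i(2) j(1)] kl i j by simp
    then show "k \<noteq> l" "?\<gamma> l = Pt k"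
      using arc[OF j(1) i(2)] off(2)[OF i(2) j(1)] i j by auto
  qed
  have I: "i \<in> clan_I ?\<gamma> \<longleftrightarrow> i \<in> I" if "i < n" for i
    using g[OF that] by (simp add: clan_I_def)
  show "coord_proj n (clan_I ?\<gamma>) = (coord_proj n I :: 'a mat)"
    "coord_proj n (- clan_I ?\<gamma>) = (coord_proj n (- I) :: 'a mat)"
    using I by (auto intro!: eq_matI)
  show "clan_S n ?\<gamma> = M"
  proof (rule eq_matI)
    fix i j assume "i < dim_row M" "j < dim_col M"
    then have ij: "i < n" "j < n" using Mc by auto
    show "clan_S n ?\<gamma> $$ (i, j) = M $$ (i, j)"
    proof (cases "i = j")
      case True
      have "i \<in> I" if "M $$ (i, i) \<noteq> 0" using M(2) ij that by (auto simp: supported_def)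
      then show ?thesis using True ij g[OF ij(1)] diag[OF ij(1)] one by (auto simp: clan_S_def)
    next
      case False
      then show ?thesis using ij arc[OF ij] off(1)[OF ij] by (auto simp: clan_S_def)
    qed
  qed (use Mc in auto)
qed

lemma one_neq_minus_one: "(1 :: 'a :: sign_field) \<noteq> - 1"
  using norm_neq_minus_one[of "1::'a"] by simp

lemma lagrangian_clan:
  fixes W :: "'a :: sign_field vec set"
  assumes W: "lagrangian n W"
  shows "\<exists>b\<in>B_grp n. \<exists>\<gamma>\<in>Gamma n. img_subspace b W = clan_space n \<gamma>"
proof -
  obtain b I and M :: "'a mat" where b: "b \<in> B_grp n" "normal_form n M" "supported n I M"
    "img_subspace b W = pair_space n (coord_proj n I) (M + coord_proj n (- I))"
    using lagrangian_normal_form[OF W] by auto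
  show ?thesis
    using b(1,4) clan_of[OF b(2,3) one_neq_minus_one]
    by (intro bexI[of _ b] bexI[of _ "clan_of n I M"]) (simp_all add: clan_space_def)
qed

lemma clan_isometry:
  assumes "\<gamma> \<in> Gamma n"
  shows "\<exists>g\<in>G_grp n. img_subspace g (L0 n) = (clan_space n \<gamma> :: 'a :: conjugatable_field vec set)"
  unfolding clan_space_def by (rule obtain_isometry[OF clan_S_hermitian[OF assms] clan_S_supported[OF assms]])

section \<open>Invariants of Borel orbits\<close>

text \<open>
  \<open>B\<^sub>H\<close> preserves the standard flag in the first summand and the opposite flag in the second.
  For a clan, the largest \<open>j\<close> with \<open>reaches n W i j\<close> is the partner of \<open>i\<close> (\<open>n\<close> for the
  decoration \<open>c\<close>, none for \<open>d\<close>), and \<open>positive_at\<close> separates \<open>+\<close> from \<open>-\<close>.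
\<close>

definition flag_vec :: "nat \<Rightarrow> 'a :: zero vec set \<Rightarrow> nat \<Rightarrow> nat \<Rightarrow> 'a vec \<Rightarrow> 'a vec \<Rightarrow> bool" where
  "flag_vec n W i j x y \<longleftrightarrow> x \<in> carrier_vec n \<and> y \<in> carrier_vec n \<and> x @\<^sub>v y \<in> W \<and>
    (\<forall>k. i < k \<and> k < n \<longrightarrow> x $ k = 0) \<and> (\<forall>k. k < j \<and> k < n \<longrightarrow> y $ k = 0)"

definition reaches :: "nat \<Rightarrow> 'a :: zero vec set \<Rightarrow> nat \<Rightarrow> nat \<Rightarrow> bool" where
  "reaches n W i j \<longleftrightarrow> (\<exists>x y. flag_vec n W i j x y \<and> x $ i \<noteq> 0)"

definition positive_at :: "nat \<Rightarrow> 'a :: conjugatable_field vec set \<Rightarrow> nat \<Rightarrow> bool" where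
  "positive_at n W i \<longleftrightarrow> (\<exists>x y. flag_vec n W i i x y \<and> conjugate (x $ i) * y $ i = 1)"

text \<open>B_H acts on the second summand by the adjoint of an inverse, a lower triangular matrix.
  So the opposite flag is the stable one there, with conjugated diagonal entries as
  multipliers.\<close>

lemma lower_triangular_trailing:
  fixes c :: "'a :: conjugatable_field mat"
  assumes c: "c \<in> carrier_mat n n" "upper_triangular c" and y: "y \<in> carrier_vec n"
    and trail: "\<And>k. k < m \<Longrightarrow> k < n \<Longrightarrow> y $ k = 0"
  shows "\<And>k. k < m \<Longrightarrow> k < n \<Longrightarrow> (mat_adjoint c *\<^sub>v y) $ k = 0"
    and "m < n \<Longrightarrow> (mat_adjoint c *\<^sub>v y) $ m = conjugate (c $$ (m, m)) * y $ m"
proof -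
  have eq: "(mat_adjoint c *\<^sub>v y) $ k = (\<Sum>l\<in>{0..<n}. conjugate (c $$ (l, k)) * y $ l)" if "k < n" for k
    using index_mult_mat_vec_sum[OF mat_adjoint_carrier[OF c(1)] y that] c(1) that by simp
  show "(mat_adjoint c *\<^sub>v y) $ k = 0" if k: "k < m" "k < n" for k
    unfolding eq[OF k(2)]
  proof (intro sum.neutral ballI)
    fix l assume "l \<in> {0..<n}"
    then show "conjugate (c $$ (l, k)) * y $ l = 0"
      using k c trail[of l] upper_triangularD[of c k l] by (cases "l < m") auto
  qed
  assume m: "m < n"
  have "(mat_adjoint c *\<^sub>v y) $ m = (\<Sum>l\<in>{0..<n}. if l = m then conjugate (c $$ (m, m)) * y $ m else 0)"
    unfolding eq[OF m]
  proof (intro sum.cong refl)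
    fix l assume "l \<in> {0..<n}"
    then show "conjugate (c $$ (l, m)) * y $ l = (if l = m then conjugate (c $$ (m, m)) * y $ m else 0)"
      using m c trail[of l] upper_triangularD[of c m l] by (cases l m rule: linorder_cases) auto
  qed
  then show "(mat_adjoint c *\<^sub>v y) $ m = conjugate (c $$ (m, m)) * y $ m" using m by simp
qed

text \<open>\<open>reaches\<close> uses that s is nonzero; \<open>positive_at\<close> uses that the
  multipliers of x_i and y_i cancel in x_i^* y_i. The relation with s concerns the value of t at i,
  while y is followed at j.\<close>

lemma flag_vec_img:
  fixes W :: "'a :: conjugatable_field vec set"
  assumes b: "b \<in> B_grp n" and xy: "flag_vec n W i j x y" and i: "i < n"
  shows "\<exists>x' y' s t. flag_vec n (img_subspace b W) i j x' y' \<and> x' $ i = s * x $ i \<and>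
    (j < n \<longrightarrow> y' $ j = t j * y $ j) \<and> s \<noteq> 0 \<and> conjugate s * t i = 1"
proof -
  obtain a d where ad: "b = bdiag n a d" "a \<in> carrier_mat n n" "d \<in> carrier_mat n n"
    "mat_adjoint a * d = 1\<^sub>m n" "upper_triangular a" using b by (rule B_grpE)
  define c where "c = mat_adjoint d"
  have c: "c \<in> carrier_mat n n" "a * c = 1\<^sub>m n" "d = mat_adjoint c"
    using ad adjoint_inverse_swap[OF ad(2-4)] by (simp_all add: c_def)
  have cu: "upper_triangular c" using upper_triangular_inverse[OF ad(2,5) c(1,2)] .
  note X = xy[unfolded flag_vec_def]
  have ac: "a $$ (i, i) * c $$ (i, i) = 1"
  proof -
    have "(a *\<^sub>v col c i) $ i = a $$ (i, i) * col c i $ i"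
      using upper_triangularD[OF cu] c(1) i by (intro upper_triangular_leading(2)[OF ad(2,5)]) auto
    moreover have "(a *\<^sub>v col c i) $ i = (a * c) $$ (i, i)" using ad c(1) i by auto
    ultimately show ?thesis using c i by simp
  qed
  have "flag_vec n (img_subspace b W) i j (a *\<^sub>v x) (d *\<^sub>v y)"
    unfolding flag_vec_def
  proof (intro conjI allI impI)
    have "b *\<^sub>v (x @\<^sub>v y) = (a *\<^sub>v x) @\<^sub>v (d *\<^sub>v y)"
      unfolding ad(1) using ad X by (intro bdiag_mult_append) auto
    then show "(a *\<^sub>v x) @\<^sub>v (d *\<^sub>v y) \<in> img_subspace b W"
      unfolding img_subspace_def using X by (metis imageI)
  qed (use X ad c upper_triangular_leading(1)[OF ad(2,5), of x i] lower_triangular_trailing(1)[OF c(1) cu, of y j]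
        mult_mat_vec_carrier[OF ad(2), of x] mult_mat_vec_carrier[OF ad(3), of y]
        in \<open>auto simp del: index_mult_mat_vec\<close>)
  moreover have "(a *\<^sub>v x) $ i = a $$ (i, i) * x $ i"
    using X i by (intro upper_triangular_leading(2)[OF ad(2,5)]) auto
  moreover have "j < n \<longrightarrow> (d *\<^sub>v y) $ j = conjugate (c $$ (j, j)) * y $ j"
    unfolding c(3) using X by (auto intro!: lower_triangular_trailing(2)[OF c(1) cu] simp del: index_mult_mat_vec)
  moreover have "conjugate (a $$ (i, i)) * conjugate (c $$ (i, i)) = 1"
    using arg_cong[OF ac, of conjugate] by (simp add: conjugate_dist_mul)
  ultimately show ?thesis using ac
    by (intro exI[of _ "a *\<^sub>v x"] exI[of _ "d *\<^sub>v y"] exI[of _ "a $$ (i, i)"]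
        exI[of _ "\<lambda>j. conjugate (c $$ (j, j))"]) auto
qed

lemma reaches_img:
  fixes W :: "'a :: conjugatable_field vec set"
  assumes "b \<in> B_grp n" "reaches n W i j" "i < n"
  shows "reaches n (img_subspace b W) i j"
  using assms flag_vec_img[OF assms(1) _ assms(3)] unfolding reaches_def by (metis mult_eq_0_iff)

lemma positive_at_img:
  fixes W :: "'a :: conjugatable_field vec set"
  assumes "b \<in> B_grp n" "positive_at n W i" "i < n"
  shows "positive_at n (img_subspace b W) i"
proof -
  obtain x y where xy: "flag_vec n W i i x y" "conjugate (x $ i) * y $ i = 1"
    using assms(2) by (auto simp: positive_at_def)
  obtain x' y' s t where 1: "flag_vec n (img_subspace b W) i i x' y'" "x' $ i = s * x $ i"
    "y' $ i = t i * y $ i" "conjugate s * t i = 1"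
    using flag_vec_img[OF assms(1) xy(1) assms(3)] assms(3) by blast
  have "conjugate (x' $ i) * y' $ i = (conjugate s * t i) * (conjugate (x $ i) * y $ i)"
    unfolding 1(2,3) by (simp add: conjugate_dist_mul mult_ac)
  also have "\<dots> = 1" using 1(4) xy(2) by simp
  finally show ?thesis using 1(1) unfolding positive_at_def by blast
qed

text \<open>Coordinate k of the second component of the point with parameter v. The label l of a
  vertex stands for the index l - 1.\<close>

definition clan_low_vec :: "nat \<Rightarrow> (nat \<Rightarrow> clan_val) \<Rightarrow> 'a :: ring_1 vec \<Rightarrow> nat \<Rightarrow> 'a" where
  "clan_low_vec n \<gamma> v k = (case \<gamma> (Suc k) of Pt l \<Rightarrow> v $ (l - 1) | Plus \<Rightarrow> v $ k | Minus \<Rightarrow> - v $ k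
     | Cdec \<Rightarrow> 0 | Ddec \<Rightarrow> v $ k)"

lemma clan_low_mult_vec:
  fixes v :: "'a :: ring_1 vec"
  assumes \<gamma>: "\<gamma> \<in> Gamma n" and v: "v \<in> carrier_vec n" and k: "k < n"
  shows "((clan_S n \<gamma> + coord_proj n (- clan_I \<gamma>)) *\<^sub>v v) $ k = clan_low_vec n \<gamma> v k"
proof -
  have "((clan_S n \<gamma> + coord_proj n (- clan_I \<gamma>)) *\<^sub>v v) $ k
      = (\<Sum>l\<in>{0..<n}. (clan_S n \<gamma> $$ (k, l) + coord_proj n (- clan_I \<gamma>) $$ (k, l)) * v $ l)"
    using v k by (subst index_mult_mat_vec_sum[of _ n n]) auto
  also have "\<dots> = (\<Sum>l\<in>{0..<n}. if l = (case \<gamma> (Suc k) of Pt l \<Rightarrow> l - 1 | _ \<Rightarrow> k) then clan_low_vec n \<gamma> v k else 0)"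
  proof (intro sum.cong refl)
    fix l assume "l \<in> {0..<n}"
    then show "(clan_S n \<gamma> $$ (k, l) + coord_proj n (- clan_I \<gamma>) $$ (k, l)) * v $ l
      = (if l = (case \<gamma> (Suc k) of Pt l \<Rightarrow> l - 1 | _ \<Rightarrow> k) then clan_low_vec n \<gamma> v k else 0)"
    proof (cases "\<gamma> (Suc k)")
      case (Pt m)
      then obtain j where "m = Suc j" "j < n" "j \<noteq> k" using Gamma_partner[OF \<gamma> k] by blast
      then show ?thesis using Pt k \<open>l \<in> {0..<n}\<close>
        by (auto simp: clan_S_def clan_I_def clan_low_vec_def)
    qed (use k in \<open>auto simp: clan_S_def clan_I_def clan_low_vec_def\<close>)
  qed
  also have "\<dots> = clan_low_vec n \<gamma> v k"
    using k by (cases "\<gamma> (Suc k)") (auto elim!: Gamma_partner[OF \<gamma> k])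
  finally show ?thesis .
qed

lemma flag_vec_clan_space:
  fixes x y :: "'a :: ring_1 vec"
  assumes \<gamma>: "\<gamma> \<in> Gamma n" and xy: "flag_vec n (clan_space n \<gamma>) i j x y"
  obtains v where "v \<in> carrier_vec n" "\<And>k. k < n \<Longrightarrow> x $ k = (if \<gamma> (Suc k) = Ddec then 0 else v $ k)"
    "\<And>k. k < n \<Longrightarrow> y $ k = clan_low_vec n \<gamma> v k"
proof -
  obtain v where v: "v \<in> carrier_vec n" "x @\<^sub>v y = (coord_proj n (clan_I \<gamma>) *\<^sub>v v)
      @\<^sub>v ((clan_S n \<gamma> + coord_proj n (- clan_I \<gamma>)) *\<^sub>v v)"
    using xy by (auto simp: flag_vec_def clan_space_def pair_space_def)
  have "x = coord_proj n (clan_I \<gamma>) *\<^sub>v v" "y = (clan_S n \<gamma> + coord_proj n (- clan_I \<gamma>)) *\<^sub>v v"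
    using v(2) append_vec_eq[of x n "coord_proj n (clan_I \<gamma>) *\<^sub>v v"] xy v(1)
      mult_mat_vec_carrier[OF coord_proj_carrier v(1)]
    by (auto simp: flag_vec_def)
  then show thesis using that[OF v(1)] v(1) clan_low_mult_vec[OF \<gamma> v(1)]
    by (auto simp: clan_I_def simp del: index_mult_mat_vec)
qed

text \<open>The point with parameter e_i is the witness for both invariants.\<close>

lemma unit_flag_vec:
  fixes \<gamma> :: "nat \<Rightarrow> clan_val"
  assumes \<gamma>: "\<gamma> \<in> Gamma n" and i: "i < n" "\<gamma> (Suc i) \<noteq> Ddec"
    and j: "\<And>k. k < j \<Longrightarrow> k < n \<Longrightarrow> clan_low_vec n \<gamma> (unit_vec n i :: 'a :: ring_1 vec) k = 0"
  obtains x y :: "'a :: ring_1 vec" where "flag_vec n (clan_space n \<gamma>) i j x y" "x $ i = 1"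
    "y $ i = clan_low_vec n \<gamma> (unit_vec n i) i"
proof -
  let ?v = "unit_vec n i :: 'a vec"
  let ?x = "coord_proj n (clan_I \<gamma>) *\<^sub>v ?v" and ?y = "(clan_S n \<gamma> + coord_proj n (- clan_I \<gamma>)) *\<^sub>v ?v"
  have "?x @\<^sub>v ?y \<in> clan_space n \<gamma>"
    unfolding clan_space_def pair_space_def using unit_vec_carrier by blast
  moreover have "?x \<in> carrier_vec n" "?y \<in> carrier_vec n"
    by (intro mult_mat_vec_carrier[of _ n n]; simp)+
  moreover have low: "?y $ k = clan_low_vec n \<gamma> ?v k" if "k < n" for k
    by (rule clan_low_mult_vec[OF \<gamma> unit_vec_carrier that])
  ultimately have "flag_vec n (clan_space n \<gamma>) i j ?x ?y"
    unfolding flag_vec_def using i j by (auto simp del: index_mult_mat_vec)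
  moreover have "?x $ i = 1" using i by (simp add: clan_I_def del: index_mult_mat_vec)
  ultimately show thesis using that low[OF i(1)] by blast
qed

text \<open>The value of \<open>reaches\<close> predicted from the decoration c at index i. The
  bounds j < k for an arc and j \<le> i for a sign have the same form once the label k is read as
  the index k - 1.\<close>

definition clan_reach :: "nat \<Rightarrow> clan_val \<Rightarrow> nat \<Rightarrow> nat \<Rightarrow> bool" where
  "clan_reach n c i j \<longleftrightarrow> (case c of Ddec \<Rightarrow> False | Cdec \<Rightarrow> True | Plus \<Rightarrow> j \<le> i | Minus \<Rightarrow> j \<le> i | Pt k \<Rightarrow> j < k)"

text \<open>For a sign or an arc, y at the partner of i (i itself for a sign) equals x_i up to sign,
  so the zeros of y demanded by j must stop before it. The parameter e_i realises every permitted
  j.\<close>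

lemma reaches_clan_space:
  assumes \<gamma>: "\<gamma> \<in> Gamma n" and i: "i < n"
  shows "reaches n (clan_space n \<gamma> :: 'a :: ring_1 vec set) i j \<longleftrightarrow> clan_reach n (\<gamma> (Suc i)) i j"
proof
  assume "reaches n (clan_space n \<gamma> :: 'a vec set) i j"
  then obtain x y :: "'a vec" where xy: "flag_vec n (clan_space n \<gamma>) i j x y" "x $ i \<noteq> 0"
    by (auto simp: reaches_def)
  obtain v where "v \<in> carrier_vec n" and v: "\<And>k. k < n \<Longrightarrow> x $ k = (if \<gamma> (Suc k) = Ddec then 0 else v $ k)"
    "\<And>k. k < n \<Longrightarrow> y $ k = clan_low_vec n \<gamma> v k"
    using flag_vec_clan_space[OF \<gamma> xy(1)] by blast
  have nz: "\<gamma> (Suc i) \<noteq> Ddec" "v $ i \<noteq> 0" using v(1)[OF i] xy(2) by (auto split: if_splits)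
  have low: "\<not> k < j" if "k < n" "clan_low_vec n \<gamma> v k \<noteq> 0" for k
    using xy(1) v(2) that by (auto simp: flag_vec_def)
  show "clan_reach n (\<gamma> (Suc i)) i j"
  proof (cases "\<gamma> (Suc i)")
    case (Pt k)
    then obtain l where l: "k = Suc l" "l < n" "\<gamma> (Suc l) = Pt (Suc i)" using Gamma_partner[OF \<gamma> i] by blast
    then have "\<not> l < j" using low[of l] nz by (simp add: clan_low_vec_def)
    then show ?thesis using Pt l by (simp add: clan_reach_def)
  qed (use low[OF i] nz in \<open>auto simp: clan_reach_def clan_low_vec_def\<close>)
next
  assume r: "clan_reach n (\<gamma> (Suc i)) i j"
  have nd: "\<gamma> (Suc i) \<noteq> Ddec" using r by (auto simp: clan_reach_def)
  have "clan_low_vec n \<gamma> (unit_vec n i :: 'a vec) k = 0" if k: "k < j" "k < n" for k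
  proof (cases "\<gamma> (Suc k)")
    case (Pt l)
    then obtain m where m: "l = Suc m" "m < n" "\<gamma> (Suc m) = Pt (Suc k)" using Gamma_partner[OF \<gamma> k(2)] by blast
    then have "m \<noteq> i" using r k by (auto simp: clan_reach_def)
    then show ?thesis using m Pt i by (simp add: clan_low_vec_def)
  qed (use r k i in \<open>auto simp: clan_reach_def clan_low_vec_def\<close>)
  from unit_flag_vec[OF \<gamma> i nd this] obtain x y :: "'a vec"
    where "flag_vec n (clan_space n \<gamma>) i j x y" "x $ i = 1" by blast
  then show "reaches n (clan_space n \<gamma> :: 'a vec set) i j" by (auto simp: reaches_def)
qed

text \<open>At a minus sign x_i^* y_i is -(v_i^* v_i), and \<open>norm_neq_minus_one\<close> forbids
  this to be 1. At a plus sign the parameter e_i gives the value 1.\<close>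

lemma positive_at_clan_space:
  assumes \<gamma>: "\<gamma> \<in> Gamma n" and i: "i < n"
  shows "\<gamma> (Suc i) = Plus \<Longrightarrow> positive_at n (clan_space n \<gamma> :: 'a :: sign_field vec set) i"
    and "\<gamma> (Suc i) = Minus \<Longrightarrow> \<not> positive_at n (clan_space n \<gamma> :: 'a :: sign_field vec set) i"
proof -
  assume plus: "\<gamma> (Suc i) = Plus"
  have low: "clan_low_vec n \<gamma> (unit_vec n i :: 'a vec) k = 0" if k: "k < i" "k < n" for k
  proof (cases "\<gamma> (Suc k)")
    case (Pt l)
    then obtain m where m: "l = Suc m" "m < n" "\<gamma> (Suc m) = Pt (Suc k)" using Gamma_partner[OF \<gamma> k(2)] by blast
    then have "m \<noteq> i" using plus by auto
    then show ?thesis using m Pt i by (simp add: clan_low_vec_def)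
  qed (use k i in \<open>auto simp: clan_low_vec_def\<close>)
  have "\<gamma> (Suc i) \<noteq> Ddec" using plus by simp
  from unit_flag_vec[OF \<gamma> i this low] obtain x y :: "'a vec"
    where "flag_vec n (clan_space n \<gamma>) i i x y" "x $ i = 1"
    "y $ i = clan_low_vec n \<gamma> (unit_vec n i) i" by blast
  then show "positive_at n (clan_space n \<gamma> :: 'a vec set) i"
    unfolding positive_at_def using plus i by (intro exI[of _ x] exI[of _ y]) (simp add: clan_low_vec_def)
next
  assume minus: "\<gamma> (Suc i) = Minus"
  show "\<not> positive_at n (clan_space n \<gamma> :: 'a vec set) i"
  proof
    assume "positive_at n (clan_space n \<gamma> :: 'a vec set) i"
    then obtain x y :: "'a vec" where xy: "flag_vec n (clan_space n \<gamma>) i i x y" "conjugate (x $ i) * y $ i = 1"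
      by (auto simp: positive_at_def)
    obtain v where "v \<in> carrier_vec n" and v: "\<And>k. k < n \<Longrightarrow> x $ k = (if \<gamma> (Suc k) = Ddec then 0 else v $ k)"
      "\<And>k. k < n \<Longrightarrow> y $ k = clan_low_vec n \<gamma> v k"
      using flag_vec_clan_space[OF \<gamma> xy(1)] by blast
    have "x $ i = v $ i" "y $ i = - v $ i" using v[OF i] minus by (simp_all add: clan_low_vec_def)
    then have "- (conjugate (v $ i) * v $ i) = 1" using xy(2) by simp
    then have "conjugate (v $ i) * v $ i = - 1" by (metis minus_minus)
    then show False using norm_neq_minus_one by blast
  qed
qed

lemma clan_reach_inj:
  assumes \<gamma>: "\<gamma> \<in> Gamma n" and \<delta>: "\<delta> \<in> Gamma n" and i: "i < n"
    and eq: "\<And>j. clan_reach n (\<gamma> (Suc i)) i j \<longleftrightarrow> clan_reach n (\<delta> (Suc i)) i j"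
  shows "\<gamma> (Suc i) = \<delta> (Suc i) \<or> {\<gamma> (Suc i), \<delta> (Suc i)} = {Plus, Minus}"
proof -
  have P: "case \<epsilon> (Suc i) of Pt k \<Rightarrow> 0 < k \<and> k \<le> n \<and> k \<noteq> Suc i | _ \<Rightarrow> True" if \<epsilon>: "\<epsilon> \<in> Gamma n" for \<epsilon>
  proof (cases "\<epsilon> (Suc i)")
    case (Pt k)
    show ?thesis by (rule Gamma_partner[OF \<epsilon> i Pt]) (simp add: Pt)
  qed auto
  show ?thesis
  proof (cases "\<exists>k l. \<gamma> (Suc i) = Pt k \<and> \<delta> (Suc i) = Pt l")
    case True
    then obtain k l where "\<gamma> (Suc i) = Pt k" "\<delta> (Suc i) = Pt l" by blast
    then show ?thesis using eq[of k] eq[of l] by (simp add: clan_reach_def)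
  next
    case False
    \<comment> \<open>j = 0 detects d and j = n detects c. A sign is reached at j = i but not at i +
      1; an arc with this behaviour would have label i + 1, its own vertex.\<close>
    then show ?thesis
      using eq[of 0] eq[of n] eq[of i] eq[of "Suc i"] P[OF \<gamma>] P[OF \<delta>] i
      by (cases "\<gamma> (Suc i)"; cases "\<delta> (Suc i)") (simp_all add: clan_reach_def insert_commute)
  qed
qed

text \<open>Both b and its inverse transport the invariants, so these agree for the two clans.
  \<open>reaches\<close> leaves only the choice between the signs open, and
  \<open>positive_at\<close> settles it.\<close>

lemma clan_space_inj:
  assumes \<gamma>: "\<gamma> \<in> Gamma n" and \<delta>: "\<delta> \<in> Gamma n" and b: "b \<in> B_grp n"
    and eq: "img_subspace b (clan_space n \<gamma>) = (clan_space n \<delta> :: 'a :: sign_field vec set)"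
  shows "\<gamma> = \<delta>"
proof -
  note B = B_grp_mat_group[of n, where 'a = 'a]
  obtain c where c: "c \<in> B_grp n" "b * c = 1\<^sub>m (2*n)" "c * b = 1\<^sub>m (2*n)"
    using mat_group_inverse[OF B b] .
  have "clan_space n \<gamma> \<subseteq> (carrier_vec (2*n) :: 'a vec set)"
    unfolding clan_space_def pair_space_def by (auto intro!: append_vec_carrier mult_mat_vec_carrier[of _ n n])
  then have "img_subspace c (img_subspace b (clan_space n \<gamma>)) = (clan_space n \<gamma> :: 'a vec set)"
    using mat_groupD(1)[OF B b] mat_groupD(1)[OF B c(1)] c(3)
    by (metis img_subspace_mult img_subspace_one)
  then have eq': "img_subspace c (clan_space n \<delta>) = (clan_space n \<gamma> :: 'a vec set)" using eq by simp
  have "\<gamma> (Suc i) = \<delta> (Suc i)" if i: "i < n" for i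
  proof -
    have "clan_reach n (\<gamma> (Suc i)) i j \<longleftrightarrow> clan_reach n (\<delta> (Suc i)) i j" for j
      using reaches_img[OF b _ i, of "clan_space n \<gamma>" j] reaches_img[OF c(1) _ i, of "clan_space n \<delta>" j]
      unfolding eq eq' reaches_clan_space[OF \<gamma> i] reaches_clan_space[OF \<delta> i] by blast
    from clan_reach_inj[OF \<gamma> \<delta> i this]
    consider "\<gamma> (Suc i) = \<delta> (Suc i)" | "\<gamma> (Suc i) = Plus" "\<delta> (Suc i) = Minus"
      | "\<gamma> (Suc i) = Minus" "\<delta> (Suc i) = Plus" by (auto simp: doubleton_eq_iff)
    then show ?thesis
      using positive_at_clan_space[OF \<gamma> i, where 'a = 'a] positive_at_clan_space[OF \<delta> i, where 'a = 'a]
        positive_at_img[OF b _ i, of "clan_space n \<gamma>"] positive_at_img[OF c(1) _ i, of "clan_space n \<delta>"]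
      unfolding eq eq' by cases auto
  qed
  then have "\<gamma> k = \<delta> k" if "k \<in> {1..n}" for k using that by (cases k) auto
  moreover have "\<gamma> \<in> extensional {1..n}" "\<delta> \<in> extensional {1..n}"
    using \<gamma> \<delta> unfolding Gamma_def PiE_def by blast+
  ultimately show ?thesis by (metis extensionalityI)
qed

section \<open>Signed permutation matrices\<close>

text \<open>To be applied to the rows and columns of an integral orthogonal matrix.\<close>

lemma sum_squares_eq_one:
  fixes f :: "'b \<Rightarrow> int"
  assumes "finite A" "(\<Sum>k\<in>A. f k * f k) = 1"
  shows "\<exists>k\<in>A. f k \<in> {- 1, 1} \<and> (\<forall>l\<in>A. l \<noteq> k \<longrightarrow> f l = 0)"
proof -
  have "\<exists>k\<in>A. f k \<noteq> 0"
  proof (rule ccontr)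
    assume "\<not> (\<exists>k\<in>A. f k \<noteq> 0)"
    then have "(\<Sum>k\<in>A. f k * f k) = 0" by (intro sum.neutral) auto
    then show False using assms(2) by simp
  qed
  then obtain k where k: "k \<in> A" "f k \<noteq> 0" by blast
  have split: "f k * f k + (\<Sum>l\<in>A - {k}. f l * f l) = 1"
    using assms k(1) by (simp add: sum.remove)
  have nonneg: "0 \<le> (\<Sum>l\<in>A - {k}. f l * f l)" by (intro sum_nonneg) simp
  have pos: "f k * f k \<ge> 1" using k(2) by (smt (verit) mult_eq_0_iff zero_le_square)
  then have "(\<Sum>l\<in>A - {k}. f l * f l) = 0" "f k * f k = 1" using split nonneg by auto
  then have "\<forall>l\<in>A - {k}. f l = 0"
    using assms(1) by (subst (asm) sum_nonneg_eq_0_iff) auto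
  moreover have "f k \<in> {- 1, 1}"
    using \<open>f k * f k = 1\<close> by (auto simp: zmult_eq_1_iff)
  ultimately show ?thesis using k(1) by auto
qed

lemma partial_signed_permD:
  assumes "partial_signed_perm n t"
  shows "t \<in> carrier_mat n n"
    and "i < n \<Longrightarrow> j < n \<Longrightarrow> t $$ (i, j) \<in> {- 1, 0, 1}"
    and "i < n \<Longrightarrow> j < n \<Longrightarrow> j' < n \<Longrightarrow> t $$ (i, j) \<noteq> 0 \<Longrightarrow> t $$ (i, j') \<noteq> 0 \<Longrightarrow> j = j'"
    and "j < n \<Longrightarrow> i < n \<Longrightarrow> i' < n \<Longrightarrow> t $$ (i, j) \<noteq> 0 \<Longrightarrow> t $$ (i', j) \<noteq> 0 \<Longrightarrow> i = i'"
  using assms unfolding partial_signed_perm_def by simp_all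

lemma signed_perm_transpose_mem:
  assumes "s \<in> signed_perm n"
  shows "transpose_mat s \<in> signed_perm n"
proof -
  have psp: "partial_signed_perm n s" and ex: "\<forall>i<n. \<exists>j<n. s $$ (i, j) \<noteq> 0" "\<forall>j<n. \<exists>i<n. s $$ (i, j) \<noteq> 0"
    using assms by (auto simp: signed_perm_def)
  have sc: "s \<in> carrier_mat n n" using psp by (simp add: partial_signed_perm_def)
  have t: "transpose_mat s $$ (i, j) = s $$ (j, i)" if "i < n" "j < n" for i j
    using sc that by simp
  have "partial_signed_perm n (transpose_mat s)"
    using psp sc unfolding partial_signed_perm_def by (simp add: t)
  moreover have "\<forall>i<n. \<exists>j<n. transpose_mat s $$ (i, j) \<noteq> 0" "\<forall>j<n. \<exists>i<n. transpose_mat s $$ (i, j) \<noteq> 0"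
    using ex t by metis+
  ultimately show ?thesis by (simp add: signed_perm_def)
qed

lemma signed_perm_mult_transpose:
  assumes s: "s \<in> signed_perm n"
  shows "s * transpose_mat s = 1\<^sub>m n"
proof -
  have psp: "partial_signed_perm n s" and rows: "\<forall>i<n. \<exists>j<n. s $$ (i, j) \<noteq> 0"
    using s by (auto simp: signed_perm_def)
  have sc: "s \<in> carrier_mat n n" using psp by (simp add: partial_signed_perm_def)
  show ?thesis
  proof (rule eq_matI)
    fix i j assume "i < dim_row (1\<^sub>m n :: int mat)" "j < dim_col (1\<^sub>m n :: int mat)"
    then have ij: "i < n" "j < n" by auto
    have eq: "(s * transpose_mat s) $$ (i, j) = (\<Sum>k\<in>{0..<n}. s $$ (i, k) * s $$ (j, k))"
      using index_mult_mat_sum[OF sc transpose_carrier_mat[THEN iffD2, OF sc] ij] sc ij by simp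
    show "(s * transpose_mat s) $$ (i, j) = 1\<^sub>m n $$ (i, j)"
    proof (cases "i = j")
      case False
      have "s $$ (i, k) * s $$ (j, k) = 0" if "k < n" for k
        using psp False ij that unfolding partial_signed_perm_def by (metis mult_eq_0_iff)
      then show ?thesis unfolding eq using False ij by (subst sum.neutral) auto
    next
      case True
      obtain k where k: "k < n" "s $$ (i, k) \<noteq> 0" using rows ij by auto
      have "s $$ (i, k) \<in> {- 1, 0, 1}" using partial_signed_permD(2)[OF psp ij(1) k(1)] .
      then have sq: "s $$ (i, k) * s $$ (i, k) = 1" using k by auto
      have "s $$ (i, l) * s $$ (i, l) = (if l = k then 1 else 0)" if "l < n" for l
        using psp ij k that sq unfolding partial_signed_perm_def by (metis mult_eq_0_iff)
      then show ?thesis unfolding eq using True ij k by simp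
    qed
  qed (use sc in auto)
qed

text \<open>Signed permutation matrices are the integral orthogonal matrices: integers with square
  sum 1 include a single \<plusminus>1 and otherwise zeros. In this form closure under products and
  inverses is immediate.\<close>

lemma signed_perm_iff:
  "s \<in> signed_perm n \<longleftrightarrow> s \<in> carrier_mat n n \<and> s * transpose_mat s = 1\<^sub>m n \<and> transpose_mat s * s = 1\<^sub>m n"
proof
  assume s: "s \<in> signed_perm n"
  then have "s \<in> carrier_mat n n" by (simp add: signed_perm_def partial_signed_perm_def)
  then show "s \<in> carrier_mat n n \<and> s * transpose_mat s = 1\<^sub>m n \<and> transpose_mat s * s = 1\<^sub>m n"
    using signed_perm_mult_transpose[OF s] signed_perm_mult_transpose[OF signed_perm_transpose_mem[OF s]] by simp
next
  assume a: "s \<in> carrier_mat n n \<and> s * transpose_mat s = 1\<^sub>m n \<and> transpose_mat s * s = 1\<^sub>m n"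
  then have s: "s \<in> carrier_mat n n" and st: "transpose_mat s \<in> carrier_mat n n"
    and ts: "transpose_mat s * s = 1\<^sub>m n" by auto
  have row: "\<exists>k\<in>{0..<n}. s $$ (i, k) \<in> {- 1, 1} \<and> (\<forall>l\<in>{0..<n}. l \<noteq> k \<longrightarrow> s $$ (i, l) = 0)" if i: "i < n" for i
    using sum_squares_eq_one[of "{0..<n}" "\<lambda>k. s $$ (i, k)"] index_mult_mat_sum[OF s st i i] a s i by simp
  have col: "\<exists>k\<in>{0..<n}. s $$ (k, i) \<in> {- 1, 1} \<and> (\<forall>l\<in>{0..<n}. l \<noteq> k \<longrightarrow> s $$ (l, i) = 0)" if i: "i < n" for i
    using sum_squares_eq_one[of "{0..<n}" "\<lambda>k. s $$ (k, i)"] index_mult_mat_sum[OF st s i i] ts s i by simp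
  have "s $$ (i, j) \<in> {- 1, 0, 1}" if "i < n" "j < n" for i j
    using row[OF that(1)] that by force
  moreover have "j = j'" if "i < n" "j < n" "j' < n" "s $$ (i, j) \<noteq> 0" "s $$ (i, j') \<noteq> 0" for i j j'
    using row[OF that(1)] that by (metis atLeastLessThan_iff zero_le)
  moreover have "i = i'" if "j < n" "i < n" "i' < n" "s $$ (i, j) \<noteq> 0" "s $$ (i', j) \<noteq> 0" for i i' j
    using col[OF that(1)] that by (metis atLeastLessThan_iff zero_le)
  ultimately have "partial_signed_perm n s" unfolding partial_signed_perm_def using s by blast
  moreover have "\<forall>i<n. \<exists>j<n. s $$ (i, j) \<noteq> 0" using row by force
  moreover have "\<forall>j<n. \<exists>i<n. s $$ (i, j) \<noteq> 0" using col by force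
  ultimately show "s \<in> signed_perm n" by (simp add: signed_perm_def)
qed

lemma signed_perm_carrier: "s \<in> signed_perm n \<Longrightarrow> s \<in> carrier_mat n n"
  by (simp add: signed_perm_iff)

lemma signed_perm_transpose:
  assumes s: "s \<in> signed_perm n"
  shows "transpose_mat s \<in> signed_perm n" "transpose_mat s * s = 1\<^sub>m n" "s * transpose_mat s = 1\<^sub>m n"
  using s signed_perm_transpose_mem[OF s] by (auto simp: signed_perm_iff)

lemma signed_perm_mult:
  assumes s: "s \<in> signed_perm n" and t: "t \<in> signed_perm n"
  shows "s * t \<in> signed_perm n"
proof -
  note c = signed_perm_carrier[OF s] signed_perm_carrier[OF t]
  have tc: "transpose_mat s \<in> carrier_mat n n" "transpose_mat t \<in> carrier_mat n n" using c by auto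
  have "(s * t) * transpose_mat (s * t) = s * (t * transpose_mat t) * transpose_mat s"
    "transpose_mat (s * t) * (s * t) = transpose_mat t * (transpose_mat s * s) * t"
    using c tc by (simp_all add: transpose_mult[of _ n n _ n] assoc_mult_square[of _ n] mult_carrier_square[of _ n])
  then show ?thesis
    using signed_perm_transpose[OF s] signed_perm_transpose[OF t] c by (auto simp: signed_perm_iff)
qed

section \<open>Diagonal sign matrices\<close>

lemma sign_diagE:
  assumes "e \<in> sign_diag n"
  obtains f where "e = mat n n (\<lambda>(i, j). if i = j then f i else 0)" "\<And>i. f i \<in> {- 1, 1 :: int}"
proof
  define f where "f i = (if i < n then e $$ (i, i) else 1)" for i
  show "e = mat n n (\<lambda>(i, j). if i = j then f i else 0)"
    using assms by (intro eq_matI) (auto simp: sign_diag_def f_def)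
  show "f i \<in> {- 1, 1}" for i using assms by (auto simp: sign_diag_def f_def)
qed

lemma sign_diagI:
  assumes "\<And>i. i < n \<Longrightarrow> f i \<in> {- 1, 1 :: int}"
  shows "mat n n (\<lambda>(i, j). if i = j then f i else 0) \<in> sign_diag n"
  using assms by (auto simp: sign_diag_def)

lemma diag_mult_left:
  fixes A :: "'a :: semiring_0 mat"
  assumes "A \<in> carrier_mat n m" "i < n" "j < m"
  shows "(mat n n (\<lambda>(i, j). if i = j then f i else 0) * A) $$ (i, j) = f i * A $$ (i, j)"
proof -
  have "(mat n n (\<lambda>(i, j). if i = j then f i else 0) * A) $$ (i, j)
      = (\<Sum>l\<in>{0..<n}. (if i = l then f i else 0) * A $$ (l, j))"
    using assms by (subst index_mult_mat_sum[of _ n n _ m]) auto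
  also have "\<dots> = (\<Sum>l\<in>{0..<n}. if l = i then f i * A $$ (i, j) else 0)"
    by (intro sum.cong) auto
  finally show ?thesis using assms by simp
qed

lemma diag_mult_right:
  fixes A :: "'a :: semiring_0 mat"
  assumes "A \<in> carrier_mat m n" "i < m" "j < n"
  shows "(A * mat n n (\<lambda>(i, j). if i = j then f i else 0)) $$ (i, j) = A $$ (i, j) * f j"
proof -
  have "(A * mat n n (\<lambda>(i, j). if i = j then f i else 0)) $$ (i, j)
      = (\<Sum>l\<in>{0..<n}. A $$ (i, l) * (if l = j then f l else 0))"
    using assms by (subst index_mult_mat_sum[of _ m n _ n]) auto
  also have "\<dots> = (\<Sum>l\<in>{0..<n}. if l = j then A $$ (i, j) * f j else 0)"
    by (intro sum.cong) auto
  finally show ?thesis using assms by simp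
qed

lemma sign_diag_carrier: "e \<in> sign_diag n \<Longrightarrow> e \<in> carrier_mat n n"
  by (simp add: sign_diag_def)

lemma sign_diag_square:
  assumes "e \<in> sign_diag n"
  shows "e * e = 1\<^sub>m n" "transpose_mat e = e"
proof -
  obtain f where f: "e = mat n n (\<lambda>(i, j). if i = j then f i else 0)" "\<And>i. f i \<in> {- 1, 1 :: int}"
    using sign_diagE[OF assms] by blast
  have "f i * f i = 1" for i using f(2)[of i] by auto
  then show "e * e = 1\<^sub>m n"
    by (intro eq_matI) (auto simp: f(1) diag_mult_left[of _ n n] simp del: index_mult_mat(1))
  show "transpose_mat e = e" by (intro eq_matI) (auto simp: f(1))
qed

lemma sign_diag_mult:
  assumes "e \<in> sign_diag n" "d \<in> sign_diag n"
  shows "e * d \<in> sign_diag n"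
proof -
  obtain f where f: "e = mat n n (\<lambda>(i, j). if i = j then f i else 0)" "\<And>i. f i \<in> {- 1, 1 :: int}"
    using sign_diagE[OF assms(1)] by blast
  obtain h where h: "d = mat n n (\<lambda>(i, j). if i = j then h i else 0)" "\<And>i. h i \<in> {- 1, 1 :: int}"
    using sign_diagE[OF assms(2)] by blast
  have "e * d = mat n n (\<lambda>(i, j). if i = j then f i * h i else 0)"
    by (intro eq_matI) (auto simp: f(1) h(1) diag_mult_left[of _ n n] simp del: index_mult_mat(1))
  moreover have "f i * h i \<in> {- 1, 1}" for i using f(2)[of i] h(2)[of i] by auto
  ultimately show ?thesis by (simp add: sign_diagI)
qed

lemma one_sign_diag: "1\<^sub>m n \<in> sign_diag n"
  by (auto simp: sign_diag_def)

lemma sign_diag_signed_perm: "e \<in> sign_diag n \<Longrightarrow> e \<in> signed_perm n"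
  using sign_diag_square[of e n] by (simp add: signed_perm_iff sign_diag_carrier)

section \<open>Blocks\<close>

lemma upper_lower_carrier [simp]:
  "upper_blk n w \<in> carrier_mat n n" "lower_blk n w \<in> carrier_mat n n"
  by (auto simp: upper_blk_def lower_blk_def)

lemma dim_upper_lower [simp]:
  "dim_row (upper_blk n w) = n" "dim_col (upper_blk n w) = n"
  "dim_row (lower_blk n w) = n" "dim_col (lower_blk n w) = n"
  by (simp_all add: upper_blk_def lower_blk_def)

lemma upper_lower_eqI:
  assumes "w \<in> carrier_mat (2*n) n" "w' \<in> carrier_mat (2*n) n"
    "upper_blk n w = upper_blk n w'" "lower_blk n w = lower_blk n w'"
  shows "w = w'"
proof (rule eq_matI)
  fix i j assume "i < dim_row w'" "j < dim_col w'"
  then have ij: "i < 2*n" "j < n" using assms by auto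
  have "upper_blk n w $$ (i, j) = upper_blk n w' $$ (i, j)" "lower_blk n w $$ (i - n, j) = lower_blk n w' $$ (i - n, j)"
    using assms by auto
  then show "w $$ (i, j) = w' $$ (i, j)"
    using ij by (cases "i < n") (auto simp: upper_blk_def lower_blk_def)
qed (use assms in auto)

lemma upper_lower_mult_right:
  assumes w: "w \<in> carrier_mat (2*n) n" and s: "s \<in> carrier_mat n n"
  shows "upper_blk n (w * s) = upper_blk n w * s" "lower_blk n (w * s) = lower_blk n w * s"
proof -
  have "upper_blk n (w * s) $$ (i, j) = (upper_blk n w * s) $$ (i, j)"
    "lower_blk n (w * s) $$ (i, j) = (lower_blk n w * s) $$ (i, j)" if ij: "i < n" "j < n" for i j
    using index_mult_mat_sum[OF w s, of i j] index_mult_mat_sum[OF w s, of "n + i" j]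
      index_mult_mat_sum[OF upper_lower_carrier(1) s ij, of w]
      index_mult_mat_sum[OF upper_lower_carrier(2) s ij, of w] ij
    by (simp_all add: upper_blk_def lower_blk_def del: index_mult_mat(1))
  then show "upper_blk n (w * s) = upper_blk n w * s" "lower_blk n (w * s) = lower_blk n w * s"
    using s upper_lower_carrier by (auto intro!: eq_matI simp del: index_mult_mat(1))
qed

lemma upper_lower_mult_left:
  fixes w :: "int mat"
  assumes w: "w \<in> carrier_mat (2*n) n" and a: "a \<in> carrier_mat n n" and d: "d \<in> carrier_mat n n"
  shows "upper_blk n (bdiag n a d * w) = a * upper_blk n w" "lower_blk n (bdiag n a d * w) = d * lower_blk n w"
proof -
  have b: "bdiag n a d \<in> carrier_mat (2*n) (2*n)" using a d by (rule bdiag_carrier)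
  have split: "(\<Sum>k\<in>{0..<2*n}. h k) = (\<Sum>k\<in>{0..<n}. h k) + (\<Sum>k\<in>{0..<n}. h (n + k))" for h :: "nat \<Rightarrow> int"
  proof -
    have "(\<Sum>k\<in>{0..<2*n}. h k) = (\<Sum>k\<in>{0..<n}. h k) + (\<Sum>k\<in>{n..<2*n}. h k)"
      by (rule sum.atLeastLessThan_concat[symmetric]) auto
    also have "(\<Sum>k\<in>{n..<2*n}. h k) = (\<Sum>k\<in>{0..<n}. h (n + k))"
      using sum.shift_bounds_nat_ivl[of h 0 n n] by (simp add: mult_2 add.commute)
    finally show ?thesis .
  qed
  have "upper_blk n (bdiag n a d * w) $$ (i, j) = (a * upper_blk n w) $$ (i, j)"
    "lower_blk n (bdiag n a d * w) $$ (i, j) = (d * lower_blk n w) $$ (i, j)" if ij: "i < n" "j < n" for i j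
    using index_mult_mat_sum[OF b w, of i j] index_mult_mat_sum[OF b w, of "n + i" j]
      index_mult_mat_sum[OF a upper_lower_carrier(1) ij, of w]
      index_mult_mat_sum[OF d upper_lower_carrier(2) ij, of w] ij a d
    by (simp_all add: split upper_blk_def lower_blk_def del: index_mult_mat(1))
  then show "upper_blk n (bdiag n a d * w) = a * upper_blk n w" "lower_blk n (bdiag n a d * w) = d * lower_blk n w"
    using a d upper_lower_carrier by (auto intro!: eq_matI simp del: index_mult_mat(1))
qed

lemma upper_lower_act:
  assumes w: "w \<in> carrier_mat (2*n) n" and e: "e \<in> carrier_mat n n" and s: "s \<in> carrier_mat n n"
  shows "upper_blk n (bdiag n e e * w * s) = e * upper_blk n w * s"
    "lower_blk n (bdiag n e e * w * s) = e * lower_blk n w * s"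
    "bdiag n e e * w * s \<in> carrier_mat (2*n) n"
  using upper_lower_mult_left[OF w e e] upper_lower_mult_right[OF mult_carrier_mat[OF bdiag_carrier[OF e e] w] s]
    mult_carrier_mat[OF mult_carrier_mat[OF bdiag_carrier[OF e e] w] s] by simp_all

section \<open>Integer matrices over the field and their column spaces\<close>

lemma map_of_int_mult:
  fixes A B :: "int mat"
  assumes A: "A \<in> carrier_mat n m" and B: "B \<in> carrier_mat m k"
  shows "map_mat of_int (A * B) = (map_mat of_int A * map_mat of_int B :: 'a :: ring_1 mat)"
proof (rule eq_matI)
  have c: "(map_mat of_int A :: 'a mat) \<in> carrier_mat n m" "(map_mat of_int B :: 'a mat) \<in> carrier_mat m k"
    using A B by auto
  fix i j assume "i < dim_row (map_mat of_int A * map_mat of_int B :: 'a mat)"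
    "j < dim_col (map_mat of_int A * map_mat of_int B :: 'a mat)"
  then have ij: "i < n" "j < k" using A B by auto
  show "map_mat of_int (A * B) $$ (i, j) = (map_mat of_int A * map_mat of_int B :: 'a mat) $$ (i, j)"
    using A B ij index_mult_mat_sum[OF A B ij] index_mult_mat_sum[OF c ij]
    by (simp del: index_mult_mat(1))
qed (use A B in auto)

lemma map_of_int_one: "map_mat of_int (1\<^sub>m n) = (1\<^sub>m n :: 'a :: ring_1 mat)"
  by (intro eq_matI) auto

lemma colspace_eq_pair_space:
  fixes w :: "int mat"
  assumes w: "w \<in> carrier_mat (2*n) n"
  shows "colspace (map_mat of_int w :: 'a :: ring_1 mat)
    = pair_space n (map_mat of_int (upper_blk n w)) (map_mat of_int (lower_blk n w))"
proof -
  let ?w = "map_mat of_int w :: 'a mat"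
  let ?u = "map_mat of_int (upper_blk n w) :: 'a mat" and ?l = "map_mat of_int (lower_blk n w) :: 'a mat"
  have wc: "?w \<in> carrier_mat (2*n) n" using w by simp
  have uc: "?u \<in> carrier_mat n n" and lc: "?l \<in> carrier_mat n n" by auto
  have eq: "?w *\<^sub>v x = (?u *\<^sub>v x) @\<^sub>v (?l *\<^sub>v x)" if x: "x \<in> carrier_vec n" for x
  proof (rule eq_vecI)
    fix i assume "i < dim_vec ((?u *\<^sub>v x) @\<^sub>v (?l *\<^sub>v x))"
    then have i: "i < 2*n" using uc lc by simp
    show "(?w *\<^sub>v x) $ i = ((?u *\<^sub>v x) @\<^sub>v (?l *\<^sub>v x)) $ i"
    proof (cases "i < n")
      case True
      then have "((?u *\<^sub>v x) @\<^sub>v (?l *\<^sub>v x)) $ i = (?u *\<^sub>v x) $ i" by (simp add: upper_blk_def lower_blk_def)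
      then show ?thesis
        using index_mult_mat_vec_sum[OF wc x i] index_mult_mat_vec_sum[OF uc x True] w True
        by (simp add: upper_blk_def del: index_mult_mat_vec)
    next
      case False
      then have "((?u *\<^sub>v x) @\<^sub>v (?l *\<^sub>v x)) $ i = (?l *\<^sub>v x) $ (i - n)" using i by (simp add: upper_blk_def lower_blk_def)
      then show ?thesis
        using index_mult_mat_vec_sum[OF wc x i] index_mult_mat_vec_sum[OF lc x, of "i - n"] w False i
        by (simp add: lower_blk_def del: index_mult_mat_vec)
    qed
  qed (use w in \<open>simp add: upper_blk_def lower_blk_def\<close>)
  then show ?thesis unfolding colspace_def pair_space_def using wc by (auto; metis)
qed

text \<open>This makes the map from classes to B_H-orbits well defined. A signed permutation on the
  right only changes the basis of the column space, and the sign matrix on the left lies in B_H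
  because e is diagonal and its own inverse adjoint.\<close>

lemma colspace_act:
  fixes w :: "int mat"
  assumes w: "w \<in> carrier_mat (2*n) n" and e: "e \<in> sign_diag n" and s: "s \<in> signed_perm n"
  shows "\<exists>b\<in>B_grp n. colspace (map_mat of_int (bdiag n e e * w * s))
    = img_subspace b (colspace (map_mat of_int w :: 'a :: conjugatable_field mat))"
proof -
  let ?h = "map_mat of_int :: int mat \<Rightarrow> 'a mat"
  note ec = sign_diag_carrier[OF e] and sc = signed_perm_carrier[OF s]
  have tc: "transpose_mat s \<in> carrier_mat n n" using sc by simp
  have he: "?h e \<in> carrier_mat n n" and hs: "?h s \<in> carrier_mat n n" and ht: "?h (transpose_mat s) \<in> carrier_mat n n"
    using ec sc by auto
  have hu: "?h (upper_blk n w) \<in> carrier_mat n n" and hl: "?h (lower_blk n w) \<in> carrier_mat n n" by auto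
  obtain f where f: "e = mat n n (\<lambda>(i, j). if i = j then f i else 0)" "\<And>i. f i \<in> {- 1, 1 :: int}"
    using sign_diagE[OF e] by blast
  have "conjugate (of_int (f i)) = (of_int (f i) :: 'a)" for i
    using f(2)[of i] by auto
  then have "mat_adjoint (?h e) = ?h e" by (intro eq_matI) (auto simp: f(1))
  moreover have "?h e * ?h e = 1\<^sub>m n"
    using map_of_int_mult[OF ec ec, where 'a = 'a] sign_diag_square[OF e] by (simp add: map_of_int_one)
  moreover have "upper_triangular (?h e)" by (rule upper_triangularI) (auto simp: f(1))
  ultimately have b: "bdiag n (?h e) (?h e) \<in> B_grp n" using he by (intro B_grpI) auto
  have st: "?h s * ?h (transpose_mat s) = 1\<^sub>m n"
    using map_of_int_mult[OF sc tc, where 'a = 'a] signed_perm_transpose[OF s] by (simp add: map_of_int_one)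
  have h3: "?h (e * x * s) = (?h e * ?h x) * ?h s" if "x \<in> carrier_mat n n" for x
    using map_of_int_mult[OF mult_carrier_square[OF ec that] sc, where 'a = 'a]
      map_of_int_mult[OF ec that, where 'a = 'a] by simp
  have "colspace (?h (bdiag n e e * w * s))
      = pair_space n ((?h e * ?h (upper_blk n w)) * ?h s) ((?h e * ?h (lower_blk n w)) * ?h s)"
    using colspace_eq_pair_space[OF upper_lower_act(3)[OF w ec sc], where 'a = 'a]
    unfolding upper_lower_act(1,2)[OF w ec sc] h3[OF upper_lower_carrier(1)] h3[OF upper_lower_carrier(2)] .
  also have "\<dots> = pair_space n (?h e * ?h (upper_blk n w)) (?h e * ?h (lower_blk n w))"
    using pair_space_mult_right[OF hs ht st mult_carrier_square[OF he hu] mult_carrier_square[OF he hl]] .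
  also have "\<dots> = img_subspace (bdiag n (?h e) (?h e)) (colspace (?h w))"
    unfolding colspace_eq_pair_space[OF w] using img_bdiag_pair_space[OF he he hu hl] by simp
  finally show ?thesis using b by blast
qed

section \<open>Classes of partial permutation pairs\<close>

lemma Omega_class_self:
  assumes "w \<in> carrier_mat (2*n) n"
  shows "w \<in> Omega_class n w"
proof -
  have "w = bdiag n (1\<^sub>m n) (1\<^sub>m n) * w * 1\<^sub>m n" using assms by (simp add: bdiag_one)
  then show ?thesis
    unfolding Omega_class_def using one_sign_diag sign_diag_signed_perm[OF one_sign_diag] by blast
qed

lemma act_act:
  fixes w :: "int mat"
  assumes w: "w \<in> carrier_mat (2*n) n" and e: "e \<in> carrier_mat n n" and d: "d \<in> carrier_mat n n"
    and s: "s \<in> carrier_mat n n" and t: "t \<in> carrier_mat n n"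
  shows "bdiag n d d * (bdiag n e e * w * s) * t = bdiag n (d * e) (d * e) * w * (s * t)"
proof (rule upper_lower_eqI)
  note 1 = upper_lower_act(3)[OF w e s]
  note uc = upper_lower_carrier[of n w]
  show "bdiag n d d * (bdiag n e e * w * s) * t \<in> carrier_mat (2*n) n"
    "bdiag n (d * e) (d * e) * w * (s * t) \<in> carrier_mat (2*n) n"
    using upper_lower_act(3)[OF 1 d t] upper_lower_act(3)[OF w mult_carrier_square[OF d e] mult_carrier_square[OF s t]] by auto
  show "upper_blk n (bdiag n d d * (bdiag n e e * w * s) * t) = upper_blk n (bdiag n (d * e) (d * e) * w * (s * t))"
    "lower_blk n (bdiag n d d * (bdiag n e e * w * s) * t) = lower_blk n (bdiag n (d * e) (d * e) * w * (s * t))"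
    unfolding upper_lower_act(1,2)[OF 1 d t] upper_lower_act(1,2)[OF w e s]
      upper_lower_act(1,2)[OF w mult_carrier_square[OF d e] mult_carrier_square[OF s t]]
    using assoc_mult_square5[OF d e uc(1) s t] assoc_mult_square5[OF d e uc(2) s t] by auto
qed

text \<open>The action of e and s is undone by e and the transpose of s, so the inclusion of classes
  can be used in both directions.\<close>

lemma Omega_class_eq:
  assumes w: "w \<in> carrier_mat (2*n) n" and w': "w' \<in> Omega_class n w"
  shows "Omega_class n w' = Omega_class n w"
proof -
  obtain e s where es: "e \<in> sign_diag n" "s \<in> signed_perm n" "w' = bdiag n e e * w * s"
    using w' by (auto simp: Omega_class_def)
  note c = sign_diag_carrier[OF es(1)] signed_perm_carrier[OF es(2)]
  have w'c: "w' \<in> carrier_mat (2*n) n" using upper_lower_act(3)[OF w c] es by simp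
  have sub: "Omega_class n v' \<subseteq> Omega_class n v"
    if v: "v \<in> carrier_mat (2*n) n" "v' = bdiag n e e * v * s" "e \<in> sign_diag n" "s \<in> signed_perm n" for v v' e s
  proof
    note c = sign_diag_carrier[OF v(3)] signed_perm_carrier[OF v(4)]
    fix x assume "x \<in> Omega_class n v'"
    then obtain d t where x: "x = bdiag n d d * v' * t" "d \<in> sign_diag n" "t \<in> signed_perm n"
      by (auto simp: Omega_class_def)
    have "x = bdiag n (d * e) (d * e) * v * (s * t)"
      unfolding x(1) v(2)
      by (rule act_act[OF v(1) c(1) sign_diag_carrier[OF x(2)] c(2) signed_perm_carrier[OF x(3)]])
    then show "x \<in> Omega_class n v"
      unfolding Omega_class_def using sign_diag_mult[OF x(2) v(3)] signed_perm_mult[OF v(4) x(3)] by blast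
  qed
  have "bdiag n e e * w' * transpose_mat s = bdiag n (e * e) (e * e) * w * (s * transpose_mat s)"
    unfolding es(3) using c by (intro act_act[OF w]) auto
  also have "\<dots> = w"
    using sign_diag_square[OF es(1)] signed_perm_transpose[OF es(2)] w by (simp add: bdiag_one)
  finally have "w = bdiag n e e * w' * transpose_mat s" by simp
  from sub[OF w'c this es(1) signed_perm_transpose(1)[OF es(2)]] sub[OF w es(3,1,2)]
  show ?thesis by blast
qed

text \<open>Independence is a property of the set of columns, so their distinctness has to be shown
  as well: two equal columns would put e_i - e_j into the kernel.\<close>

lemma rank_eq_if_inj:
  fixes A :: "'a :: field mat"
  assumes A: "A \<in> carrier_mat N m"
    and inj: "\<And>v. v \<in> carrier_vec m \<Longrightarrow> A *\<^sub>v v = 0\<^sub>v N \<Longrightarrow> v = 0\<^sub>v m"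
  shows "vec_space.rank N A = m"
proof -
  interpret vec_space "TYPE('a)" N .
  have dist: "distinct (cols A)"
    unfolding distinct_conv_nth
  proof (intro allI impI)
    fix i j assume ij: "i < length (cols A)" "j < length (cols A)" "i \<noteq> j"
    then have ij': "i < m" "j < m" using A by auto
    show "cols A ! i \<noteq> cols A ! j"
    proof
      assume "cols A ! i = cols A ! j"
      then have eq: "col A i = col A j" using ij by simp
      let ?v = "unit_vec m i - unit_vec m j :: 'a vec"
      have "A *\<^sub>v ?v = A *\<^sub>v unit_vec m i - A *\<^sub>v unit_vec m j"
        using A by (intro mult_minus_distrib_mat_vec) auto
      also have "A *\<^sub>v unit_vec m k = col A k" if "k < m" for k
        using A that by (intro eq_vecI) auto
      then have "A *\<^sub>v unit_vec m i - A *\<^sub>v unit_vec m j = 0\<^sub>v N"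
        using eq ij' A by (auto intro!: eq_vecI)
      finally have "?v = 0\<^sub>v m" by (intro inj) auto
      then have "?v $ i = 0\<^sub>v m $ i" by simp
      then show False using ij' ij(3) by simp
    qed
  qed
  have "lin_indpt (set (cols A))"
  proof
    assume "lin_dep (set (cols A))"
    then obtain v where "v \<in> carrier_vec m" "v \<noteq> 0\<^sub>v m" "A *\<^sub>v v = 0\<^sub>v N"
      using lin_depE[OF A _ dist] by blast
    then show False using inj by blast
  qed
  then show ?thesis using lin_indpt_full_rank[OF A dist] by simp
qed

text \<open>An independent set avoids the zero vector. If a column is zero, a maximal independent
  subset is thus strictly smaller than the set of columns and has fewer than m elements.\<close>

lemma full_rank_col_nonzero:
  fixes A :: "'a :: field mat"
  assumes A: "A \<in> carrier_mat N m" and rk: "vec_space.rank N A = m" and j: "j < m"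
  shows "col A j \<noteq> 0\<^sub>v N"
proof
  interpret vec_space "TYPE('a)" N .
  assume z: "col A j = 0\<^sub>v N"
  have cs: "set (cols A) \<subseteq> carrier_vec N" using A cols_dim by blast
  obtain S where S: "maximal S (\<lambda>T. T \<subseteq> set (cols A) \<and> lin_indpt T)"
    using maximal_exists[of "\<lambda>T. T \<subseteq> set (cols A) \<and> lin_indpt T" "card (set (cols A))" "{}"]
    by (meson List.finite_set card_mono empty_iff empty_subsetI finite_lin_indpt2 rev_finite_subset)
  have rS: "rank A = card S" using rank_card_indpt[OF A S] .
  have SL: "S \<subseteq> set (cols A)" "lin_indpt S" using S by (auto simp: maximal_def)
  have "0\<^sub>v N \<notin> S"
  proof -
    have "(UNIV :: 'a set) \<noteq> {0}" using one_neq_zero by blast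
    then show ?thesis using zero_nin_lin_indpt[of S] SL cs by (auto simp: module_vec_simps)
  qed
  moreover have "0\<^sub>v N \<in> set (cols A)"
    using z A j by (metis carrier_matD(2) cols_length cols_nth nth_mem)
  ultimately have "S \<subset> set (cols A)" using SL(1) by blast
  then have "card S < card (set (cols A))" by (intro psubset_card_mono) auto
  also have "\<dots> \<le> m" using card_length[of "cols A"] A by simp
  finally show False using rS rk by simp
qed

section \<open>The matrix in Omega attached to a clan\<close>

definition clan_mat :: "nat \<Rightarrow> (nat \<Rightarrow> clan_val) \<Rightarrow> int mat" where
  "clan_mat n \<gamma> = mat (2*n) n (\<lambda>(i, j). if i < n then coord_proj n (clan_I \<gamma>) $$ (i, j)
     else (clan_S n \<gamma> + coord_proj n (- clan_I \<gamma>)) $$ (i - n, j))"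

lemma clan_mat_carrier [simp]: "clan_mat n \<gamma> \<in> carrier_mat (2*n) n"
  by (simp add: clan_mat_def)

lemma clan_mat_blocks [simp]:
  "upper_blk n (clan_mat n \<gamma>) = coord_proj n (clan_I \<gamma>)"
  "lower_blk n (clan_mat n \<gamma>) = clan_S n \<gamma> + coord_proj n (- clan_I \<gamma>)"
  by (intro eq_matI; simp add: clan_mat_def upper_blk_def lower_blk_def)+

lemma colspace_clan_mat:
  "colspace (map_mat of_int (clan_mat n \<gamma>) :: 'a :: ring_1 mat) = clan_space n \<gamma>"
proof -
  have "map_mat of_int (coord_proj n (clan_I \<gamma>)) = (coord_proj n (clan_I \<gamma>) :: 'a mat)"
    "map_mat of_int (clan_S n \<gamma> + coord_proj n (- clan_I \<gamma>))
      = (clan_S n \<gamma> + coord_proj n (- clan_I \<gamma>) :: 'a mat)"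
    by (intro eq_matI; auto simp: clan_S_def)+
  then show ?thesis
    unfolding colspace_eq_pair_space[OF clan_mat_carrier] clan_mat_blocks clan_space_def by simp
qed

lemma lower_clan_mat_nonzero:
  assumes \<gamma>: "\<gamma> \<in> Gamma n" and ij: "i < n" "j < n"
  shows "(clan_S n \<gamma> + coord_proj n (- clan_I \<gamma>)) $$ (i, j) \<noteq> (0 :: int) \<longleftrightarrow>
    (i = j \<and> \<gamma> (Suc i) \<in> {Plus, Minus, Ddec}) \<or> \<gamma> (Suc i) = Pt (Suc j)"
proof -
  have "\<gamma> (Suc i) \<noteq> Pt (Suc i)" using Gamma_partner[OF \<gamma> ij(1), of "Suc i"] by auto
  then show ?thesis using ij by (auto simp: clan_S_def clan_I_def)
qed

lemma clan_mat_Omega: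
  assumes \<gamma>: "\<gamma> \<in> Gamma n"
  shows "clan_mat n \<gamma> \<in> Omega n"
proof -
  let ?U = "coord_proj n (clan_I \<gamma>) :: int mat" and ?L = "clan_S n \<gamma> + coord_proj n (- clan_I \<gamma>) :: int mat"
  have sym: "\<gamma> (Suc i) = Pt (Suc j) \<longleftrightarrow> \<gamma> (Suc j) = Pt (Suc i)" if "i < n" "j < n" for i j
    using Gamma_partner[OF \<gamma> that(1), of "Suc j"] Gamma_partner[OF \<gamma> that(2), of "Suc i"] by auto
  have psU: "partial_signed_perm n ?U"
    unfolding partial_signed_perm_def by auto
  have psL: "partial_signed_perm n ?L"
    unfolding partial_signed_perm_def
  proof (intro conjI allI impI)
    show "?L \<in> carrier_mat n n" by simp
    show "?L $$ (i, j) \<in> {- 1, 0, 1}" if "i < n" "j < n" for i j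
      using that by (auto simp: clan_S_def clan_I_def)
    show "j = j'" if "i < n" "j < n" "j' < n" "?L $$ (i, j) \<noteq> 0 \<and> ?L $$ (i, j') \<noteq> 0" for i j j'
      using that(4) unfolding lower_clan_mat_nonzero[OF \<gamma> that(1,2)] lower_clan_mat_nonzero[OF \<gamma> that(1,3)]
      by auto
    show "i = i'" if "j < n" "i < n" "i' < n" "?L $$ (i, j) \<noteq> 0 \<and> ?L $$ (i', j) \<noteq> 0" for i i' j
      using that(4) unfolding lower_clan_mat_nonzero[OF \<gamma> that(2,1)] lower_clan_mat_nonzero[OF \<gamma> that(3,1)]
        sym[OF that(2,1)] sym[OF that(3,1)] by auto
  qed
  have "transpose_mat ?U = ?U" by (intro eq_matI) auto
  moreover have "?U * ?L = clan_S n \<gamma>"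
  proof (rule eq_matI)
    fix i j assume "i < dim_row (clan_S n \<gamma> :: int mat)" "j < dim_col (clan_S n \<gamma> :: int mat)"
    then have ij: "i < n" "j < n" by auto
    then show "(?U * ?L) $$ (i, j) = clan_S n \<gamma> $$ (i, j)"
      using coord_proj_mult_left[of ?L n i j "clan_I \<gamma>"] by (auto simp: clan_S_def clan_I_def)
  qed auto
  moreover have "transpose_mat (clan_S n \<gamma>) = (clan_S n \<gamma> :: int mat)"
    by (intro eq_matI) (auto simp: clan_S_def sym)
  ultimately have tr: "transpose_mat ?U * ?L = transpose_mat (transpose_mat ?U * ?L)" by simp
  \<comment> \<open>Each coordinate of v is visible alone in some row: in row n + i if the
    decoration is d, in row i otherwise. So the kernel is zero.\<close>
  have "vec_space.rank (2*n) (map_mat rat_of_int (clan_mat n \<gamma>) :: rat mat) = n"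
  proof (rule rank_eq_if_inj)
    let ?w = "map_mat rat_of_int (clan_mat n \<gamma>) :: rat mat"
    show wc: "?w \<in> carrier_mat (2*n) n" by simp
    fix v :: "rat vec" assume v: "v \<in> carrier_vec n" "?w *\<^sub>v v = 0\<^sub>v (2*n)"
    have "v $ i = 0" if i: "i < n" for i
    proof (cases "\<gamma> (Suc i) = Ddec")
      case True
      have "0 = (?w *\<^sub>v v) $ (n + i)" using v i by simp
      also have "\<dots> = (\<Sum>l\<in>{0..<n}. ?w $$ (n + i, l) * v $ l)"
        using i by (intro index_mult_mat_vec_sum[OF wc v(1)]) simp
      also have "\<dots> = (\<Sum>l\<in>{0..<n}. if l = i then v $ i else 0)"
        using i True by (intro sum.cong) (auto simp: clan_mat_def clan_S_def clan_I_def)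
      finally show ?thesis using i by simp
    next
      case False
      have "0 = (?w *\<^sub>v v) $ i" using v i by simp
      also have "\<dots> = (\<Sum>l\<in>{0..<n}. ?w $$ (i, l) * v $ l)"
        using i by (intro index_mult_mat_vec_sum[OF wc v(1)]) simp
      also have "\<dots> = (\<Sum>l\<in>{0..<n}. if l = i then v $ i else 0)"
        using i False by (intro sum.cong) (auto simp: clan_mat_def clan_I_def)
      finally show ?thesis using i by simp
    qed
    then show "v = 0\<^sub>v n" using v(1) by (intro eq_vecI) auto
  qed
  then show ?thesis using psU psL tr by (simp add: Omega_def)
qed

text \<open>
  Full rank makes every column nonzero, and symmetry of \<open>\<tau>\<^sub>1\<^sup>t\<tau>\<^sub>2\<close> makes the map sending a
  column to its \<open>\<tau>\<^sub>1\<close>-row (or else its \<open>\<tau>\<^sub>2\<close>-row) injective, hence a permutation. Moving each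
  column to its row turns \<open>\<tau>\<^sub>1\<close> into a coordinate projection; it remains to fix signs on arcs.
\<close>

lemma Omega_coordinates:
  assumes w: "w \<in> Omega n"
  shows "\<exists>s\<in>signed_perm n. \<exists>J M. supported n J M \<and> partial_signed_perm n M \<and>
    (\<forall>i<n. \<forall>j<n. M $$ (i, j) = M $$ (j, i)) \<and>
    upper_blk n w * s = coord_proj n J \<and> lower_blk n w * s = M + coord_proj n (- J)"
proof -
  define U L where "U = upper_blk n w" and "L = lower_blk n w"
  have wc: "w \<in> carrier_mat (2*n) n" and psU: "partial_signed_perm n U" and psL: "partial_signed_perm n L"
    and sym: "transpose_mat U * L = transpose_mat (transpose_mat U * L)"
    and rk: "vec_space.rank (2*n) (map_mat rat_of_int w :: rat mat) = n"
    using w by (simp_all add: Omega_def U_def L_def)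
  note Uc = partial_signed_permD(1)[OF psU] and Lc = partial_signed_permD(1)[OF psL]
  have Utc: "transpose_mat U \<in> carrier_mat n n" using Uc by simp
  have symm: "(\<Sum>i\<in>{0..<n}. U $$ (i, j) * L $$ (i, k)) = (\<Sum>i\<in>{0..<n}. U $$ (i, k) * L $$ (i, j))"
    if jk: "j < n" "k < n" for j k
  proof -
    have e: "(transpose_mat U * L) $$ (j, k) = (\<Sum>i\<in>{0..<n}. U $$ (i, j) * L $$ (i, k))"
      if "j < n" "k < n" for j k
      using index_mult_mat_sum[OF Utc Lc that] Uc that by simp
    have "(transpose_mat U * L) $$ (j, k) = transpose_mat (transpose_mat U * L) $$ (j, k)" using sym by simp
    also have "\<dots> = (transpose_mat U * L) $$ (k, j)" using Uc Lc jk by simp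
    finally show ?thesis using e jk by simp
  qed
  have single: "(\<Sum>i\<in>{0..<n}. U $$ (i, j) * L $$ (i, k)) = U $$ (m, j) * L $$ (m, k)"
    if "j < n" "m < n" "U $$ (m, j) \<noteq> 0" for j k m
  proof -
    have "(\<Sum>i\<in>{0..<n}. U $$ (i, j) * L $$ (i, k))
        = (\<Sum>i\<in>{0..<n}. if i = m then U $$ (m, j) * L $$ (m, k) else 0)"
    proof (intro sum.cong refl)
      fix i assume "i \<in> {0..<n}"
      then have "i < n" by simp
      then have "U $$ (i, j) = 0" if "i \<noteq> m"
        using partial_signed_permD(4)[OF psU \<open>j < n\<close> \<open>i < n\<close> \<open>m < n\<close>] \<open>U $$ (m, j) \<noteq> 0\<close> that by blast
      then show "U $$ (i, j) * L $$ (i, k) = (if i = m then U $$ (m, j) * L $$ (m, k) else 0)" by auto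
    qed
    then show ?thesis using that by simp
  qed
  have colnz: "\<exists>i<n. U $$ (i, j) \<noteq> 0 \<or> ((\<forall>k<n. U $$ (k, j) = 0) \<and> L $$ (i, j) \<noteq> 0)" if j: "j < n" for j
  proof (rule ccontr)
    assume "\<not> ?thesis"
    then have U0: "\<forall>i<n. U $$ (i, j) = 0" and L0: "\<forall>i<n. L $$ (i, j) = 0" by blast+
    have "w $$ (i, j) = 0" if "i < 2*n" for i
    proof (cases "i < n")
      case True
      then show ?thesis using U0 j by (simp add: U_def upper_blk_def)
    next
      case False
      then have "L $$ (i - n, j) = 0" using L0 that by auto
      then show ?thesis using False that j by (simp add: L_def lower_blk_def)
    qed
    then have "col (map_mat rat_of_int w) j = 0\<^sub>v (2*n)" using wc j by (intro eq_vecI) auto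
    then show False using full_rank_col_nonzero[OF _ rk j] wc by simp
  qed
  define P where "P j i \<longleftrightarrow> i < n \<and> (U $$ (i, j) \<noteq> 0 \<or> ((\<forall>k<n. U $$ (k, j) = 0) \<and> L $$ (i, j) \<noteq> 0))" for j i
  have "\<forall>j. \<exists>i. j < n \<longrightarrow> P j i" using colnz by (auto simp: P_def)
  then obtain r where r: "\<And>j. j < n \<Longrightarrow> P j (r j)" by metis
  have rn: "r j < n" if "j < n" for j using r[OF that] by (simp add: P_def)
  have rU: "r j = i" if "j < n" "i < n" "U $$ (i, j) \<noteq> 0" for i j
    using r[OF that(1)] partial_signed_permD(4)[OF psU that(1) rn[OF that(1)] that(2)] that by (auto simp: P_def)
  have rL: "L $$ (r j, j) \<noteq> 0" if "j < n" "U $$ (r j, j) = 0" for j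
    using r[OF that(1)] that(2) by (auto simp: P_def)
  \<comment> \<open>If the \<open>U\<close>-entry of column j shares its row with the
    \<open>L\<close>-entry of a column j' whose \<open>U\<close>-part is zero, their product is
    entry (j, j') of U^t L, while entry (j', j) is 0.\<close>
  have mixed: False if j: "j < n" and j': "j' < n" and eq: "r j = r j'" and u: "U $$ (r j, j) \<noteq> 0"
    and u': "U $$ (r j', j') = 0" for j j'
  proof -
    have "U $$ (k, j') = 0" if "k < n" for k using rU[OF j' that] u' by auto
    then have "U $$ (r j, j) * L $$ (r j, j') = 0"
      using single[OF j rn[OF j] u, of j'] symm[OF j j'] by simp
    then show False using u rL[OF j' u'] eq by simp
  qed
  have inj: "j = j'" if "j < n" "j' < n" "r j = r j'" for j j'
  proof (cases "U $$ (r j, j) = 0"; cases "U $$ (r j', j') = 0")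
    assume "U $$ (r j, j) = 0" "U $$ (r j', j') = 0"
    then show ?thesis
      using partial_signed_permD(3)[OF psL rn[OF that(1)] that(1,2) rL[OF that(1)]] rL[OF that(2)] that(3) by simp
  next
    assume "U $$ (r j, j) \<noteq> 0" "U $$ (r j', j') \<noteq> 0"
    then show ?thesis
      using partial_signed_permD(3)[OF psU rn[OF that(1)] that(1,2)] that(3) by simp
  qed (use mixed[OF that] mixed[OF that(2,1) that(3)[symmetric]] in blast)+
  have "r ` {0..<n} = {0..<n}"
    using inj rn by (intro endo_inj_surj) (auto simp: inj_on_def)
  then have surj: "\<exists>j<n. r j = i" if "i < n" for i
    using that by (metis atLeastLessThan_iff imageE zero_le)
  \<comment> \<open>The sign of the selected entry of column j: \<open>s\<close> moves the column to
    position r j and multiplies it by this sign, which turns the entry into 1.\<close>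
  define c where "c j = (if U $$ (r j, j) \<noteq> 0 then U $$ (r j, j) else L $$ (r j, j))" for j
  have c: "c j \<in> {- 1, 1}" if "j < n" for j
    using partial_signed_permD(2)[OF psU rn[OF that] that] partial_signed_permD(2)[OF psL rn[OF that] that]
      rL[OF that] by (auto simp: c_def)
  then have cc: "c j * c j = 1" if "j < n" for j using that by fastforce
  define s where "s = mat n n (\<lambda>(j, i). if i = r j then c j else 0)"
  have sc: "s \<in> carrier_mat n n" by (simp add: s_def)
  have s0: "s $$ (j, i) \<noteq> 0 \<longleftrightarrow> i = r j" if "j < n" "i < n" for i j
    using c[OF that(1)] that by (auto simp: s_def)
  have "partial_signed_perm n s"
    unfolding partial_signed_perm_def
  proof (intro conjI allI impI)
    show "s $$ (i, j) \<in> {- 1, 0, 1}" if "i < n" "j < n" for i j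
      using c[OF that(1)] that by (auto simp: s_def)
  qed (use sc inj s0 in auto)
  moreover have "\<forall>j<n. \<exists>i<n. s $$ (j, i) \<noteq> 0" using s0 rn by metis
  moreover have "\<forall>i<n. \<exists>j<n. s $$ (j, i) \<noteq> 0" using s0 surj by metis
  ultimately have s: "s \<in> signed_perm n" by (simp add: signed_perm_def)
  have As: "(A * s) $$ (k, r j) = A $$ (k, j) * c j" if A: "A \<in> carrier_mat n n" and k: "k < n" and j: "j < n" for A k j
  proof -
    have "(A * s) $$ (k, r j) = (\<Sum>l\<in>{0..<n}. A $$ (k, l) * s $$ (l, r j))"
      using index_mult_mat_sum[OF A sc k rn[OF j]] .
    also have "\<dots> = (\<Sum>l\<in>{0..<n}. if l = j then A $$ (k, j) * c j else 0)"
    proof (intro sum.cong refl)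
      fix l assume "l \<in> {0..<n}"
      then show "A $$ (k, l) * s $$ (l, r j) = (if l = j then A $$ (k, j) * c j else 0)"
        using inj[of l j] j rn[OF j] by (auto simp: s_def)
    qed
    finally show ?thesis using j by simp
  qed
  define J where "J = {i. \<exists>j<n. r j = i \<and> U $$ (i, j) \<noteq> 0}"
  have J: "r j \<in> J \<longleftrightarrow> U $$ (r j, j) \<noteq> 0" if "j < n" for j
  proof
    assume "r j \<in> J"
    then obtain k where k: "k < n" "r k = r j" "U $$ (r j, k) \<noteq> 0" by (auto simp: J_def)
    then have "k = j" using inj[OF k(1) that k(2)] by simp
    then show "U $$ (r j, j) \<noteq> 0" using k(3) by simp
  qed (use that in \<open>auto simp: J_def\<close>)
  define M where "M = mat n n (\<lambda>(k, i). if k \<in> J \<and> i \<in> J then (L * s) $$ (k, i) else 0)"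
  have Mc: "M \<in> carrier_mat n n" by (simp add: M_def)
  have U': "(U * s) $$ (k, i) = coord_proj n J $$ (k, i)" if k: "k < n" and i: "i < n" for k i
  proof -
    obtain j where j: "j < n" "r j = i" using surj[OF i] by blast
    have eq: "(U * s) $$ (k, i) = U $$ (k, j) * c j" using As[OF Uc k j(1)] j(2) by simp
    show ?thesis
    proof (cases "k = i \<and> i \<in> J")
      case True
      then have "c j = U $$ (k, j)" using J[OF j(1)] j(2) by (simp add: c_def)
      then show ?thesis using eq cc[OF j(1)] True i by simp
    next
      case False
      have "U $$ (k, j) = 0" using rU[OF j(1) k] J[OF j(1)] j(2) False by auto
      then show ?thesis using eq False k i by auto
    qed
  qed
  have Lcol: "(L * s) $$ (k, i) = (if k = i then 1 else 0)" if k: "k < n" and i: "i < n" "i \<notin> J" for k i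
  proof -
    obtain j where j: "j < n" "r j = i" using surj[OF i(1)] by blast
    have u0: "U $$ (r j, j) = 0" using J[OF j(1)] j(2) i(2) by simp
    have eq: "(L * s) $$ (k, i) = L $$ (k, j) * c j" using As[OF Lc k j(1)] j(2) by simp
    show ?thesis
    proof (cases "k = i")
      case True
      then show ?thesis using eq cc[OF j(1)] u0 j(2) by (simp add: c_def)
    next
      case False
      then have "L $$ (k, j) = 0"
        using partial_signed_permD(4)[OF psL j(1) k rn[OF j(1)]] rL[OF j(1) u0] j(2) by blast
      then show ?thesis using eq False by simp
    qed
  qed
  \<comment> \<open>A row k outside J already has its single \<open>L\<close>-entry in the column
    that is moved to position k.\<close>
  have Lrow: "(L * s) $$ (k, i) = 0" if k: "k < n" "k \<notin> J" and i: "i < n" "i \<in> J" for k i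
  proof (rule ccontr)
    obtain j where j: "j < n" "r j = i" using surj[OF i(1)] by blast
    obtain j' where j': "j' < n" "r j' = k" using surj[OF k(1)] by blast
    assume "(L * s) $$ (k, i) \<noteq> 0"
    then have "L $$ (k, j) \<noteq> 0" using As[OF Lc k(1) j(1)] j(2) by auto
    moreover have "L $$ (k, j') \<noteq> 0" using rL[OF j'(1)] J[OF j'(1)] j'(2) k(2) by auto
    ultimately have "j = j'" using partial_signed_permD(3)[OF psL k(1) j(1) j'(1)] by blast
    then show False using j j' i k by simp
  qed
  have "lower_blk n w * s = M + coord_proj n (- J)"
  proof (rule eq_matI)
    fix k i assume "k < dim_row (M + coord_proj n (- J))" "i < dim_col (M + coord_proj n (- J))"
    then have ki: "k < n" "i < n" by auto
    show "(lower_blk n w * s) $$ (k, i) = (M + coord_proj n (- J)) $$ (k, i)"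
      unfolding L_def[symmetric] using ki Lcol[OF ki(1,2)] Lrow[OF ki(1) _ ki(2)]
      by (auto simp: M_def simp del: index_mult_mat(1))
  qed (use sc in auto)
  moreover have "upper_blk n w * s = coord_proj n J"
    unfolding U_def[symmetric] using U' Uc sc by (intro eq_matI) auto
  moreover have "supported n J M" by (auto simp: supported_def M_def)
  moreover have "M $$ (i, k) = M $$ (k, i)" if ik: "i < n" "k < n" for i k
  proof (cases "i \<in> J \<and> k \<in> J")
    case True
    obtain j where j: "j < n" "r j = i" using surj[OF ik(1)] by blast
    obtain j' where j': "j' < n" "r j' = k" using surj[OF ik(2)] by blast
    have u: "U $$ (r j, j) \<noteq> 0" "U $$ (r j', j') \<noteq> 0" using J j j' True by auto
    \<comment> \<open>Symmetry of U^t L at (j, j'). Multiplied by both signs, whose squares are 1,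
      it becomes symmetry of M.\<close>
    have "c j * L $$ (i, j') = c j' * L $$ (k, j)"
      using symm[OF j(1) j'(1)] single[OF j(1) rn[OF j(1)] u(1), of j'] single[OF j'(1) rn[OF j'(1)] u(2), of j]
        u j(2) j'(2) by (simp add: c_def)
    then have "c j' * (c j * c j) * L $$ (i, j') = (c j' * c j') * c j * L $$ (k, j)"
      by (simp add: algebra_simps)
    then have "L $$ (i, j') * c j' = L $$ (k, j) * c j"
      using cc[OF j(1)] cc[OF j'(1)] by (simp add: mult.commute)
    then show ?thesis
      using As[OF Lc ik(1) j'(1)] As[OF Lc ik(2) j(1)] j(2) j'(2) True ik by (simp add: M_def)
  qed (use ik in \<open>auto simp: M_def\<close>)
  moreover have "partial_signed_perm n M"
    unfolding partial_signed_perm_def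
  proof (intro conjI allI impI)
    have Mnz: "\<exists>j<n. r j = i \<and> L $$ (k, j) \<noteq> 0" if ki: "k < n" "i < n" "M $$ (k, i) \<noteq> 0" for k i
    proof -
      obtain j where j: "j < n" "r j = i" using surj[OF ki(2)] by blast
      have "(L * s) $$ (k, i) \<noteq> 0" using ki by (auto simp: M_def simp del: index_mult_mat(1) split: if_splits)
      then show ?thesis using As[OF Lc ki(1) j(1)] j by auto
    qed
    show "M $$ (k, i) \<in> {- 1, 0, 1}" if ki: "k < n" "i < n" for k i
    proof -
      obtain j where j: "j < n" "r j = i" using surj[OF ki(2)] by blast
      have "L $$ (k, j) * c j \<in> {- 1, 0, 1}"
        using partial_signed_permD(2)[OF psL ki(1) j(1)] c[OF j(1)] by auto
      then show ?thesis using As[OF Lc ki(1) j(1)] j(2) ki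
        by (simp add: M_def del: index_mult_mat(1))
    qed
    show "i = i'" if k: "k < n" "i < n" "i' < n" "M $$ (k, i) \<noteq> 0 \<and> M $$ (k, i') \<noteq> 0" for k i i'
    proof -
      obtain j j' where j: "j < n" "r j = i" "L $$ (k, j) \<noteq> 0" and j': "j' < n" "r j' = i'" "L $$ (k, j') \<noteq> 0"
        using Mnz[OF k(1,2)] Mnz[OF k(1,3)] k(4) by blast
      then show ?thesis using partial_signed_permD(3)[OF psL k(1) j(1) j'(1)] by blast
    qed
    show "k = k'" if k: "i < n" "k < n" "k' < n" "M $$ (k, i) \<noteq> 0 \<and> M $$ (k', i) \<noteq> 0" for k k' i
    proof -
      obtain j j' where j: "j < n" "r j = i" "L $$ (k, j) \<noteq> 0" and j': "j' < n" "r j' = i" "L $$ (k', j') \<noteq> 0"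
        using Mnz[OF k(2,1)] Mnz[OF k(3,1)] k(4) by blast
      then have "j = j'" using inj by simp
      then show ?thesis using partial_signed_permD(4)[OF psL j(1) k(2,3)] j j' by blast
    qed
  qed (rule Mc)
  ultimately show ?thesis using s by blast
qed

text \<open>A symmetric partial permutation has isolated rows, so only signs remain to be fixed.
  Conjugation by a diagonal sign matrix e fixes the diagonal entries and both projections and can
  make every arc entry 1; it is realised by e on the left and s e on the right.\<close>

lemma Omega_class_clan:
  assumes w: "w \<in> Omega n"
  shows "\<exists>\<gamma>\<in>Gamma n. Omega_class n w = Omega_class n (clan_mat n \<gamma>)"
proof -
  have wc: "w \<in> carrier_mat (2*n) n" using w by (simp add: Omega_def)
  obtain s J M where s: "s \<in> signed_perm n" and MJ: "supported n J M" and psM: "partial_signed_perm n M"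
    and sym: "\<forall>i<n. \<forall>j<n. M $$ (i, j) = M $$ (j, i)"
    and U: "upper_blk n w * s = coord_proj n J" and L: "lower_blk n w * s = M + coord_proj n (- J)"
    using Omega_coordinates[OF w] by blast
  note Mc = partial_signed_permD(1)[OF psM] and sc = signed_perm_carrier[OF s]
  \<comment> \<open>The integral counterpart of the scaling over the field: on an arc l < k the sign
    at l is 1 and the sign at k is the entry itself.\<close>
  define Q where "Q k x \<longleftrightarrow> x \<in> {- 1, 1} \<and> (\<forall>l<n. M $$ (l, k) \<noteq> 0 \<longrightarrow> x = (if l < k then M $$ (l, k) else 1))" for k x
  have "\<exists>x. Q k x" if k: "k < n" for k
  proof (cases "\<exists>l<n. M $$ (l, k) \<noteq> 0")
    case True
    then obtain l where l: "l < n" "M $$ (l, k) \<noteq> 0" by blast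
    have "Q k (if l < k then M $$ (l, k) else 1)"
      unfolding Q_def
      using partial_signed_permD(4)[OF psM k l(1) _ l(2)] partial_signed_permD(2)[OF psM l(1) k] l(2) by auto
    then show ?thesis by blast
  next
    case False
    then have "Q k 1" unfolding Q_def by auto
    then show ?thesis by blast
  qed
  then obtain f where f: "\<And>k. k < n \<Longrightarrow> Q k (f k)" by metis
  define e where "e = mat n n (\<lambda>(i, j). if i = j then f i else 0)"
  have e: "e \<in> sign_diag n" unfolding e_def using f by (intro sign_diagI) (simp add: Q_def)
  note ec = sign_diag_carrier[OF e]
  have ff: "f k * f k = 1" if "k < n" for k using f[OF that] by (auto simp: Q_def)
  have conj: "(e * A * e) $$ (i, j) = f i * A $$ (i, j) * f j" if "A \<in> carrier_mat n n" "i < n" "j < n" for A i j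
    using diag_mult_right[OF mult_carrier_square[OF ec that(1)] that(2,3), of f] diag_mult_left[OF that, of f] that
    by (simp add: e_def del: index_mult_mat(1))
  define T where "T = e * M * e"
  have Tc: "T \<in> carrier_mat n n" using ec Mc by (auto simp: T_def)
  have T: "T $$ (i, j) = f i * M $$ (i, j) * f j" if "i < n" "j < n" for i j
    unfolding T_def using conj[OF Mc that] .
  have Tnz: "T $$ (i, j) \<noteq> 0 \<longleftrightarrow> M $$ (i, j) \<noteq> 0" if "i < n" "j < n" for i j
    using T[OF that] f[OF that(1)] f[OF that(2)] by (auto simp: Q_def)
  have sT: "supported n J T" using MJ Tnz unfolding supported_def by blast
  have up: "T $$ (i, j) \<in> {0, 1}" if ij: "i < n" "j < n" "i < j" for i j
  proof (cases "M $$ (i, j) = 0")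
    case False
    then have "M $$ (j, i) \<noteq> 0" using sym ij by auto
    then have "f i = (if j < i then M $$ (j, i) else 1)" "f j = (if i < j then M $$ (i, j) else 1)"
      using f[OF ij(1)] f[OF ij(2)] False ij(1,2) unfolding Q_def by blast+
    then have "f i = 1" "f j = M $$ (i, j)" using ij(3) by simp_all
    then show ?thesis using T[OF ij(1,2)] ff[OF ij(2)] by simp
  qed (simp add: T ij)
  have Tsym: "T $$ (i, j) = T $$ (j, i)" if "i < n" "j < n" for i j
    using T that sym by simp
  have "normal_form n T"
    unfolding normal_form_def
  proof (intro conjI allI impI)
    show "isolated n T i" if i: "i < n" for i
      unfolding isolated_def
    proof (intro allI impI conjI)
      fix k j assume k: "k < n" "T $$ (i, k) \<noteq> 0"
      show "j = k" if "j < n" "T $$ (i, j) \<noteq> 0"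
        using partial_signed_permD(3)[OF psM i that(1) k(1)] Tnz[OF i that(1)] Tnz[OF i k(1)] that k by blast
      show "j = i" if "j < n" "T $$ (k, j) \<noteq> 0"
        using partial_signed_permD(3)[OF psM k(1) that(1) i] Tnz[OF k(1) that(1)] Tnz[OF k(1) i]
          Tsym[OF i k(1)] that k by metis
    qed
    show "T $$ (i, i) \<in> {0, 1, - 1}" if i: "i < n" for i
    proof -
      have "T $$ (i, i) = (f i * f i) * M $$ (i, i)" using T[OF i i] by (simp add: mult_ac)
      then show ?thesis using ff[OF i] partial_signed_permD(2)[OF psM i i] by auto
    qed
    show "T $$ (i, j) \<in> {0, 1}" if "i < n" "j < n" "i \<noteq> j" for i j
      using up[of i j] up[of j i] Tsym[of i j] that by (cases "i < j") auto
    show "T $$ (i, j) = T $$ (j, i)" if "i < n" "j < n" for i j using Tsym[OF that] .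
  qed (rule Tc)
  note \<gamma> = clan_of[OF this sT]
  define \<gamma> where "\<gamma> = clan_of n J T"
  have g: "\<gamma> \<in> Gamma n" "coord_proj n (clan_I \<gamma>) = (coord_proj n J :: int mat)"
    "coord_proj n (- clan_I \<gamma>) = (coord_proj n (- J) :: int mat)" "clan_S n \<gamma> = T"
    unfolding \<gamma>_def by (rule \<gamma>; simp)+
  have cp: "e * coord_proj n I * e = coord_proj n I" for I
    using conj[OF coord_proj_carrier] ff ec by (intro eq_matI) (auto simp del: index_mult_mat(1))
  have "clan_mat n \<gamma> = bdiag n e e * w * (s * e)"
  proof (rule upper_lower_eqI)
    note se = mult_carrier_square[OF sc ec]
    have assoc: "e * x * (s * e) = e * (x * s) * e" if "x \<in> carrier_mat n n" for x
      using that ec sc by (simp add: assoc_mult_square[of _ n] mult_carrier_square[of _ n])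
    show "bdiag n e e * w * (s * e) \<in> carrier_mat (2*n) n" by (rule upper_lower_act(3)[OF wc ec se])
    show "upper_blk n (clan_mat n \<gamma>) = upper_blk n (bdiag n e e * w * (s * e))"
      unfolding upper_lower_act(1)[OF wc ec se] assoc[OF upper_lower_carrier(1)] U cp by (simp add: g)
    have "e * (M + coord_proj n (- J)) * e = T + coord_proj n (- J)"
    proof (rule eq_matI)
      fix i j assume "i < dim_row (T + coord_proj n (- J))" "j < dim_col (T + coord_proj n (- J))"
      then have ij: "i < n" "j < n" by auto
      have "(e * (M + coord_proj n (- J)) * e) $$ (i, j)
          = f i * M $$ (i, j) * f j + f i * coord_proj n (- J) $$ (i, j) * f j"
        using conj[OF add_carrier_mat[OF coord_proj_carrier] ij, of M "- J"] Mc ij by (simp add: algebra_simps)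
      also have "\<dots> = (T + coord_proj n (- J)) $$ (i, j)"
        using conj[OF coord_proj_carrier ij, of "- J"] cp[of "- J"] T[OF ij] ij by simp
      finally show "(e * (M + coord_proj n (- J)) * e) $$ (i, j) = (T + coord_proj n (- J)) $$ (i, j)" .
    qed (use ec in auto)
    then show "lower_blk n (clan_mat n \<gamma>) = lower_blk n (bdiag n e e * w * (s * e))"
      unfolding upper_lower_act(2)[OF wc ec se] assoc[OF upper_lower_carrier(2)] L by (simp add: g)
  qed simp
  then have "clan_mat n \<gamma> \<in> Omega_class n w"
    unfolding Omega_class_def using e signed_perm_mult[OF s sign_diag_signed_perm[OF e]] by blast
  then show ?thesis using Omega_class_eq[OF wc] g(1) by metis
qed

lemma Omega_quot_eq: "Omega_quot n = (\<lambda>\<gamma>. Omega_class n (clan_mat n \<gamma>)) ` Gamma n"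
  unfolding Omega_quot_def using Omega_class_clan clan_mat_Omega by (auto simp: image_iff)

section \<open>The bijections\<close>

lemma Omega_class_clan_space:
  assumes "w \<in> Omega_class n (clan_mat n \<gamma>)"
  shows "\<exists>b\<in>B_grp n. colspace (map_mat of_int w) = img_subspace b (clan_space n \<gamma> :: 'a :: conjugatable_field vec set)"
  using assms colspace_act[OF clan_mat_carrier, where 'a = 'a]
  unfolding Omega_class_def colspace_clan_mat by blast

lemma clan_Omega_bij: "bij_betw (\<lambda>\<gamma>. Omega_class n (clan_mat n \<gamma>)) (Gamma n) (Omega_quot n)"
  unfolding bij_betw_def Omega_quot_eq
proof (intro conjI refl inj_onI)
  fix \<gamma> \<delta> assume \<gamma>: "\<gamma> \<in> Gamma n" and \<delta>: "\<delta> \<in> Gamma n"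
    and eq: "Omega_class n (clan_mat n \<gamma>) = Omega_class n (clan_mat n \<delta>)"
  have "clan_mat n \<delta> \<in> Omega_class n (clan_mat n \<gamma>)"
    unfolding eq by (rule Omega_class_self[OF clan_mat_carrier])
  from Omega_class_clan_space[OF this, where 'a = real]
  show "\<gamma> = \<delta>" unfolding colspace_clan_mat using clan_space_inj[OF \<gamma> \<delta>, where 'a = real] by metis
qed

lemma img_subspace_B_grp_cancel:
  fixes V :: "'a :: conjugatable_field vec set"
  assumes b: "b \<in> B_grp n" and V: "V \<subseteq> carrier_vec (2*n)"
  obtains c where "c \<in> B_grp n" "img_subspace c (img_subspace b V) = V"
proof -
  note B = B_grp_mat_group[of n, where 'a = 'a]
  obtain c where c: "c \<in> B_grp n" "b * c = 1\<^sub>m (2*n)" "c * b = 1\<^sub>m (2*n)"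
    using mat_group_inverse[OF B b] .
  have "img_subspace c (img_subspace b V) = V"
    using img_subspace_mult[OF mat_groupD(1)[OF B c(1)] mat_groupD(1)[OF B b] V] c(3) img_subspace_one[OF V]
    by simp
  then show thesis using that c(1) by blast
qed

lemma clan_space_carrier: "clan_space n \<gamma> \<subseteq> (carrier_vec (2*n) :: 'a :: ring_1 vec set)"
  unfolding clan_space_def pair_space_def by (auto intro!: append_vec_carrier mult_mat_vec_carrier[of _ n n])

text \<open>Carries \<open>clan_space_inj\<close> over to double cosets. The elements b and c are
  there because the column space of an arbitrary member of a class is known only to be
  B_H-equivalent to the clan space.\<close>

lemma dcoset_eq_clan_iff:
  fixes g h :: "'a :: sign_field mat"
  assumes g: "g \<in> G_grp n" and h: "h \<in> G_grp n" and \<gamma>: "\<gamma> \<in> Gamma n" and \<delta>: "\<delta> \<in> Gamma n"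
    and b: "b \<in> B_grp n" "img_subspace g (L0 n) = img_subspace b (clan_space n \<gamma>)"
    and c: "c \<in> B_grp n" "img_subspace h (L0 n) = img_subspace c (clan_space n \<delta>)"
  shows "BgP n g = BgP n h \<longleftrightarrow> \<gamma> = \<delta>"
proof -
  note B = B_grp_mat_group[of n, where 'a = 'a]
  note Bc = mat_groupD(1)[OF B]
  note cs = clan_space_carrier[where 'a = 'a and n = n]
  obtain b' where b': "b' \<in> B_grp n" "img_subspace b' (img_subspace b (clan_space n \<gamma>)) = clan_space n \<gamma>"
    using img_subspace_B_grp_cancel[OF b(1) cs] .
  obtain c' where c': "c' \<in> B_grp n" "img_subspace c' (img_subspace c (clan_space n \<delta>)) = clan_space n \<delta>"
    using img_subspace_B_grp_cancel[OF c(1) cs] .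
  have img_g: "img_subspace (a * g) (L0 n) = img_subspace a (img_subspace b (clan_space n \<gamma>))"
    if "a \<in> B_grp n" for a
    using img_subspace_mult[OF Bc[OF that] G_grpD(1)[OF g] L0_carrier] b(2) by simp
  have bV: "img_subspace b (clan_space n \<gamma>) \<subseteq> carrier_vec (2*n)" "img_subspace c (clan_space n \<delta>) \<subseteq> carrier_vec (2*n)"
    by (rule img_subspace_carrier[OF Bc[OF b(1)] cs], rule img_subspace_carrier[OF Bc[OF c(1)] cs])
  show ?thesis
  proof
    assume "BgP n g = BgP n h"
    then obtain a where a: "a \<in> B_grp n" "img_subspace a (img_subspace b (clan_space n \<gamma>)) = img_subspace c (clan_space n \<delta>)"
      using dcoset_eq_iff[OF g h] img_g c(2) by auto
    have "img_subspace (c' * (a * b)) (clan_space n \<gamma>) = clan_space n \<delta>"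
      using img_subspace_mult[OF Bc[OF c'(1)] Bc[OF mat_groupD(3)[OF B a(1) b(1)]] cs]
        img_subspace_mult[OF Bc[OF a(1)] Bc[OF b(1)] cs] a(2) c'(2) by simp
    then show "\<gamma> = \<delta>"
      using clan_space_inj[OF \<gamma> \<delta>] mat_groupD(3)[OF B c'(1) mat_groupD(3)[OF B a(1) b(1)]] by blast
  next
    assume eq: "\<gamma> = \<delta>"
    have "img_subspace (c * b' * g) (L0 n) = img_subspace (c * b') (img_subspace b (clan_space n \<gamma>))"
      by (rule img_g[OF mat_groupD(3)[OF B c(1) b'(1)]])
    also have "\<dots> = img_subspace h (L0 n)"
      using img_subspace_mult[OF Bc[OF c(1)] Bc[OF b'(1)] bV(1)] b'(2) c(2) eq by simp
    finally show "BgP n g = BgP n h"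
      using dcoset_eq_iff[OF g h] mat_groupD(3)[OF B c(1) b'(1)] by blast
  qed
qed

text \<open>The common pattern of both maps to orbit sets: an element C goes to \<open>q g\<close>
  for any g that R relates to it. The equivalence in \<open>eq\<close> gives independence of the
  choice and injectivity at once.\<close>

lemma bij_betw_some:
  assumes ex: "\<And>C. C \<in> A \<Longrightarrow> \<exists>g\<in>G. R C g"
    and eq: "\<And>C C' g h. C \<in> A \<Longrightarrow> C' \<in> A \<Longrightarrow> g \<in> G \<Longrightarrow> h \<in> G \<Longrightarrow> R C g \<Longrightarrow> R C' h \<Longrightarrow> q g = q h \<longleftrightarrow> C = C'"
    and surj: "\<And>g. g \<in> G \<Longrightarrow> \<exists>C\<in>A. \<exists>h\<in>G. R C h \<and> q h = q g"
  shows "\<exists>f. bij_betw f A (q ` G) \<and> (\<forall>C\<in>A. \<forall>g\<in>G. R C g \<longrightarrow> f C = q g)"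
proof -
  define f where "f C = q (SOME g. g \<in> G \<and> R C g)" for C
  have some: "(SOME g. g \<in> G \<and> R C g) \<in> G \<and> R C (SOME g. g \<in> G \<and> R C g)" if "C \<in> A" for C
    by (rule someI_ex) (use ex[OF that] in blast)
  have f: "f C = q g" if "C \<in> A" "g \<in> G" "R C g" for C g
    unfolding f_def using eq[OF that(1,1) _ that(2) _ that(3)] some[OF that(1)] by blast
  have "inj_on f A"
    by (rule inj_onI) (use ex eq f in metis)
  moreover have "f ` A = q ` G"
  proof (intro equalityI subsetI)
    fix x assume "x \<in> f ` A"
    then show "x \<in> q ` G" using ex f by blast
  next
    fix x assume "x \<in> q ` G"
    then obtain g where g: "g \<in> G" "x = q g" by blast
    obtain C h where "C \<in> A" "h \<in> G" "R C h" "q h = q g" using surj[OF g(1)] by blast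
    then show "x \<in> f ` A" using f g(2) by (metis imageI)
  qed
  ultimately show ?thesis using f by (auto simp: bij_betw_def)
qed

lemma clan_class_Omega_quot: "\<gamma> \<in> Gamma n \<Longrightarrow> Omega_class n (clan_mat n \<gamma>) \<in> Omega_quot n"
  unfolding Omega_quot_eq by blast

lemma Omega_quotE:
  assumes "C \<in> Omega_quot n"
  obtains \<gamma> where "\<gamma> \<in> Gamma n" "C = Omega_class n (clan_mat n \<gamma>)"
  using assms unfolding Omega_quot_eq by blast

text \<open>Ensures that the description of the map to double cosets is never vacuous: each column
  space arising from a class is the image of \<open>L0 n\<close> under an isometry.\<close>

lemma Omega_isometry:
  assumes C: "C \<in> Omega_quot n" and w: "w \<in> C"
  shows "\<exists>g::'a::sign_field mat\<in>G_grp n. img_subspace g (L0 n) = colspace (map_mat of_int w)"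
proof -
  obtain \<gamma> where \<gamma>: "\<gamma> \<in> Gamma n" "C = Omega_class n (clan_mat n \<gamma>)" using Omega_quotE[OF C] .
  obtain b where b: "b \<in> B_grp n" "colspace (map_mat of_int w :: 'a mat) = img_subspace b (clan_space n \<gamma>)"
    using Omega_class_clan_space w \<gamma>(2) by blast
  obtain g where g: "g \<in> G_grp n" "img_subspace g (L0 n) = (clan_space n \<gamma> :: 'a vec set)"
    using clan_isometry[OF \<gamma>(1)] by blast
  have "img_subspace (b * g) (L0 n) = colspace (map_mat of_int w)"
    using img_subspace_mult[OF G_grpD(1)[OF B_grp_G_grp[OF b(1)]] G_grpD(1)[OF g(1)] L0_carrier] g(2) b(2) by simp
  then show ?thesis using G_grpD(3)[OF B_grp_G_grp[OF b(1)] g(1)] by blast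
qed

lemma Omega_BGP_bij:
  "\<exists>f. bij_betw f (Omega_quot n) (BGP (Sigma_mat n) n) \<and>
    (\<forall>C\<in>Omega_quot n. \<forall>w\<in>C. \<forall>g::'a::sign_field mat\<in>G_grp n.
       img_subspace g (L0 n) = colspace (map_mat of_int w) \<longrightarrow> f C = BgP n g)"
proof -
  let ?R = "\<lambda>C g. \<exists>w\<in>C. img_subspace g (L0 n) = colspace (map_mat of_int w :: 'a mat)"
  have "\<exists>f. bij_betw f (Omega_quot n) (BgP n ` G_grp n) \<and>
    (\<forall>C\<in>Omega_quot n. \<forall>g\<in>G_grp n. ?R C g \<longrightarrow> f C = BgP n g)"
  proof (rule bij_betw_some)
    fix C assume C: "C \<in> Omega_quot n"
    then obtain \<gamma> where \<gamma>: "\<gamma> \<in> Gamma n" "C = Omega_class n (clan_mat n \<gamma>)" using Omega_quotE by blast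
    then have "clan_mat n \<gamma> \<in> C" using Omega_class_self[OF clan_mat_carrier] by blast
    then show "\<exists>g\<in>G_grp n. ?R C g" using Omega_isometry[OF C] by blast
  next
    fix C C' and g h :: "'a mat"
    assume C: "C \<in> Omega_quot n" "C' \<in> Omega_quot n" and g: "g \<in> G_grp n" and h: "h \<in> G_grp n"
      and R: "?R C g" "?R C' h"
    obtain \<gamma> where \<gamma>: "\<gamma> \<in> Gamma n" "C = Omega_class n (clan_mat n \<gamma>)" using Omega_quotE[OF C(1)] .
    obtain \<delta> where \<delta>: "\<delta> \<in> Gamma n" "C' = Omega_class n (clan_mat n \<delta>)" using Omega_quotE[OF C(2)] .
    obtain b where "b \<in> B_grp n" "img_subspace g (L0 n) = img_subspace b (clan_space n \<gamma>)"
      using R(1) \<gamma>(2) Omega_class_clan_space[where 'a = 'a] by metis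
    moreover obtain c where "c \<in> B_grp n" "img_subspace h (L0 n) = img_subspace c (clan_space n \<delta>)"
      using R(2) \<delta>(2) Omega_class_clan_space[where 'a = 'a] by metis
    ultimately have "BgP n g = BgP n h \<longleftrightarrow> \<gamma> = \<delta>" by (rule dcoset_eq_clan_iff[OF g h \<gamma>(1) \<delta>(1)])
    then show "BgP n g = BgP n h \<longleftrightarrow> C = C'"
      using clan_Omega_bij[of n] \<gamma> \<delta> by (auto simp: bij_betw_def dest: inj_onD)
  next
    \<comment> \<open>Surjectivity is the classification of Lagrangians: the image of
      \<open>L0 n\<close> under g is B_H-equivalent to a clan space.\<close>
    fix g :: "'a mat" assume g: "g \<in> G_grp n"
    obtain b \<gamma> where b: "b \<in> B_grp n" and \<gamma>: "\<gamma> \<in> Gamma n"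
      and eq: "img_subspace b (img_subspace g (L0 n)) = clan_space n \<gamma>"
      using lagrangian_clan[OF lagrangian_img[OF lagrangian_L0 g]] by blast
    obtain h where h: "h \<in> G_grp n" "img_subspace h (L0 n) = (clan_space n \<gamma> :: 'a vec set)"
      using clan_isometry[OF \<gamma>] by blast
    have "?R (Omega_class n (clan_mat n \<gamma>)) h"
      using Omega_class_self[OF clan_mat_carrier] h(2) colspace_clan_mat[where 'a = 'a] by metis
    moreover have "img_subspace (b * g) (L0 n) = img_subspace h (L0 n)"
      using img_subspace_mult[OF G_grpD(1)[OF B_grp_G_grp[OF b]] G_grpD(1)[OF g] L0_carrier] eq h(2) by simp
    then have "BgP n h = BgP n g" using dcoset_eq_iff[OF g h(1)] b by blast
    ultimately show "\<exists>C\<in>Omega_quot n. \<exists>h\<in>G_grp n. ?R C h \<and> BgP n h = BgP n g"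
      using clan_class_Omega_quot[OF \<gamma>] h(1) by blast
  qed
  moreover have "BGP (Sigma_mat n) n = BgP n ` (G_grp n :: 'a mat set)"
    by (auto simp: BGP_def)
  ultimately obtain f where "bij_betw f (Omega_quot n) (BGP (Sigma_mat n) n)"
    "\<forall>C\<in>Omega_quot n. \<forall>g\<in>G_grp n. ?R C g \<longrightarrow> f C = BgP n g" by auto
  then show ?thesis by (intro exI[of _ f]) blast
qed

lemma BGP_HX_bij:
  "\<exists>f. bij_betw f (BGP (Sigma_mat n :: 'a :: sign_field mat) n) (HX (Sigma_mat n) n) \<and>
    (\<forall>g\<in>G_grp n. f (BgP n g) = H_orbit n (B_grp n, lcoset (g :: 'a mat) (PS_grp n)))"
proof -
  have BGP: "BGP (Sigma_mat n) n = BgP n ` (G_grp n :: 'a mat set)"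
    by (auto simp: BGP_def)
  have "\<exists>f. bij_betw f (BgP n ` G_grp n) ((\<lambda>g. H_orbit n (B_grp n, lcoset g (PS_grp n))) ` (G_grp n :: 'a mat set)) \<and>
    (\<forall>D\<in>BgP n ` G_grp n. \<forall>g\<in>G_grp n. D = BgP n g \<longrightarrow> f D = H_orbit n (B_grp n, lcoset g (PS_grp n)))"
    \<comment> \<open>Here R relates a double coset to each of its representatives, so the only real
      input is that orbits and double cosets identify the same group elements.\<close>
    by (rule bij_betw_some) (auto simp: H_orbit_eq_iff)
  then show ?thesis unfolding BGP HX_eq by blast
qed

text \<open>J_n is the scalar i times Sigma_n, and the nonzero scalar cancels from both sides of the
  isometry condition.\<close>

lemma isom_grp_J: "isom_grp (J_mat n) n = G_grp n"
proof -
  have "mat_adjoint g * J_mat n * g = J_mat n \<longleftrightarrow> mat_adjoint g * Sigma_mat n * g = Sigma_mat n"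
    if g: "g \<in> carrier_mat (2*n) (2*n)" for g
  proof -
    have ga: "mat_adjoint g \<in> carrier_mat (2*n) (2*n)" using g by simp
    have "mat_adjoint g * J_mat n * g = \<i> \<cdot>\<^sub>m (mat_adjoint g * Sigma_mat n * g)"
      unfolding J_mat_def
      using mult_smult_distrib[OF ga Sigma_mat_carrier] mult_smult_assoc_mat[OF mult_carrier_square[OF ga Sigma_mat_carrier] g]
      by simp
    moreover have "\<i> \<cdot>\<^sub>m A = \<i> \<cdot>\<^sub>m A' \<longleftrightarrow> A = A'" for A A' :: "complex mat"
    proof
      assume eq: "\<i> \<cdot>\<^sub>m A = \<i> \<cdot>\<^sub>m A'"
      have dim: "dim_row A = dim_row A'" "dim_col A = dim_col A'"
        using arg_cong[OF eq, of dim_row] arg_cong[OF eq, of dim_col] by simp_all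
      show "A = A'"
      proof (rule eq_matI)
        fix i j assume "i < dim_row A'" "j < dim_col A'"
        then show "A $$ (i, j) = A' $$ (i, j)"
          using arg_cong[OF eq, of "\<lambda>M. M $$ (i, j)"] dim by simp
      qed (use dim in auto)
    qed simp
    ultimately show ?thesis by (simp add: J_mat_def)
  qed
  then show ?thesis unfolding isom_grp_def by blast
qed

lemma J_mat_sets:
  "P_grp (J_mat n) n = PS_grp n" "BGP (J_mat n) n = BGP (Sigma_mat n) n" "HX (J_mat n) n = HX (Sigma_mat n) n"
proof -
  show P: "P_grp (J_mat n) n = PS_grp n" unfolding P_grp_def isom_grp_J ..
  show "BGP (J_mat n) n = BGP (Sigma_mat n) n" unfolding BGP_def P isom_grp_J ..
  show "HX (J_mat n) n = HX (Sigma_mat n) n" unfolding HX_def Xspace_def P isom_grp_J ..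
qed

text \<open>Equal cardinality alone would yield some bijections; the additional clauses pin
  \<open>f2\<close> and \<open>f3\<close> to the geometric maps, through column spaces and through
  the fibre over the base point of H/B_H.\<close>

lemma all_bijections:
  "\<exists>(f1 :: (nat \<Rightarrow> clan_val) \<Rightarrow> int mat set) (f2 :: int mat set \<Rightarrow> 'a :: sign_field mat set)
       (f3 :: 'a mat set \<Rightarrow> ('a mat set \<times> 'a mat set) set).
      bij_betw f1 (Gamma n) (Omega_quot n) \<and>
      bij_betw f2 (Omega_quot n) (BGP (Sigma_mat n) n) \<and>
      bij_betw f3 (BGP (Sigma_mat n) n) (HX (Sigma_mat n) n) \<and>
      (\<forall>C\<in>Omega_quot n. \<forall>w\<in>C.
         (\<exists>g::'a mat\<in>G_grp n. img_subspace g (L0 n) = colspace (map_mat of_int w)) \<and>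
         (\<forall>g\<in>G_grp n. img_subspace g (L0 n) = colspace (map_mat of_int w) \<longrightarrow> f2 C = BgP n g)) \<and>
      (\<forall>g\<in>G_grp n. f3 (BgP n g) = H_orbit n (B_grp n, lcoset g (PS_grp n)))"
proof -
  obtain f2 :: "int mat set \<Rightarrow> 'a mat set" where f2: "bij_betw f2 (Omega_quot n) (BGP (Sigma_mat n) n)"
    "\<forall>C\<in>Omega_quot n. \<forall>w\<in>C. \<forall>g\<in>G_grp n.
       img_subspace g (L0 n) = colspace (map_mat of_int w) \<longrightarrow> f2 C = BgP n g"
    using Omega_BGP_bij[of n, where 'a = 'a] by (elim exE conjE) (rule that)
  obtain f3 :: "'a mat set \<Rightarrow> ('a mat set \<times> 'a mat set) set"
    where f3: "bij_betw f3 (BGP (Sigma_mat n) n) (HX (Sigma_mat n) n)"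
      "\<forall>g\<in>G_grp n. f3 (BgP n g) = H_orbit n (B_grp n, lcoset g (PS_grp n))"
    using BGP_HX_bij[of n, where 'a = 'a] by (elim exE conjE) (rule that)
  show ?thesis
  proof (intro exI conjI ballI impI)
    show "bij_betw (\<lambda>\<gamma>. Omega_class n (clan_mat n \<gamma>)) (Gamma n) (Omega_quot n)" by (rule clan_Omega_bij)
    show "bij_betw f2 (Omega_quot n) (BGP (Sigma_mat n) n)" by (rule f2(1))
    show "bij_betw f3 (BGP (Sigma_mat n) n) (HX (Sigma_mat n) n)" by (rule f3(1))
    show "f3 (BgP n g) = H_orbit n (B_grp n, lcoset g (PS_grp n))" if "g \<in> G_grp n" for g
      using f3(2) that by blast
    fix C w assume C: "C \<in> Omega_quot n" "w \<in> C"
    show "\<exists>g::'a mat\<in>G_grp n. img_subspace g (L0 n) = colspace (map_mat of_int w)"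
      by (rule Omega_isometry[OF C])
    show "f2 C = BgP n g" if "g \<in> G_grp n" "img_subspace g (L0 n) = colspace (map_mat of_int w)" for g
      using f2(2) C that by blast
  qed
qed

theorem theorem6p2:
  fixes n :: nat
  shows
  \<comment> \<open>Case (A): G = U(n,n), form u^* J_n v\<close>
  "(\<exists>(f1 :: (nat \<Rightarrow> clan_val) \<Rightarrow> int mat set) (f2 :: int mat set \<Rightarrow> complex mat set)
       (f3 :: complex mat set \<Rightarrow> (complex mat set \<times> complex mat set) set).
      bij_betw f1 (Gamma n) (Omega_quot n) \<and>
      bij_betw f2 (Omega_quot n) (BGP (J_mat n) n) \<and>
      bij_betw f3 (BGP (J_mat n) n) (HX (J_mat n) n) \<and>
      (\<forall>C\<in>Omega_quot n. \<forall>w\<in>C.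
         (\<exists>g::complex mat\<in>isom_grp (J_mat n) n. img_subspace g (L0 n) = colspace (map_mat of_int w)) \<and>
         (\<forall>g\<in>isom_grp (J_mat n) n. img_subspace g (L0 n) = colspace (map_mat of_int w) \<longrightarrow>
            f2 C = dcoset (B_grp n) g (P_grp (J_mat n) n))) \<and>
      (\<forall>g\<in>isom_grp (J_mat n) n.
         f3 (dcoset (B_grp n) g (P_grp (J_mat n) n)) = H_orbit n (B_grp n, lcoset g (P_grp (J_mat n) n))))
   \<and>
  \<comment> \<open>Case (B): G = Sp_2n(R), form u^t Sigma_n v\<close>
   (\<exists>(f1 :: (nat \<Rightarrow> clan_val) \<Rightarrow> int mat set) (f2 :: int mat set \<Rightarrow> real mat set)
       (f3 :: real mat set \<Rightarrow> (real mat set \<times> real mat set) set).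
      bij_betw f1 (Gamma n) (Omega_quot n) \<and>
      bij_betw f2 (Omega_quot n) (BGP (Sigma_mat n) n) \<and>
      bij_betw f3 (BGP (Sigma_mat n) n) (HX (Sigma_mat n) n) \<and>
      (\<forall>C\<in>Omega_quot n. \<forall>w\<in>C.
         (\<exists>g::real mat\<in>isom_grp (Sigma_mat n) n. img_subspace g (L0 n) = colspace (map_mat of_int w)) \<and>
         (\<forall>g\<in>isom_grp (Sigma_mat n) n. img_subspace g (L0 n) = colspace (map_mat of_int w) \<longrightarrow>
            f2 C = dcoset (B_grp n) g (P_grp (Sigma_mat n) n))) \<and>
      (\<forall>g\<in>isom_grp (Sigma_mat n) n.
         f3 (dcoset (B_grp n) g (P_grp (Sigma_mat n) n)) = H_orbit n (B_grp n, lcoset g (P_grp (Sigma_mat n) n))))"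
  unfolding isom_grp_J J_mat_sets
  by (rule conjI[OF all_bijections[where 'a = complex] all_bijections[where 'a = real]])

end
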